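(* Assume $\rho_0\neq 1$. 1) Suppose that $r\Delta_t=\Delta_x$ with $r>0$ fixed. Then, for each $t\ge 0$, $\tilde Z^\Delta_t$ converges (in distribution) to the deterministic limit $-\frac{rt\eta_0}{1-\rho_0}$ as $\Delta_x\to0$. 2) Suppose that $r\Delta_t=\Delta_x^2$ with $r>0$ fixed. Then the process $(\xi^\Delta_t,\ t\ge0)$ defined by $$\xi^\Delta_t=\tilde Z^\Delta_t+\frac{t\sqrt r\,\eta_0}{(1-\rho_0)\sqrt{\Delta_t}}$$ converges in distribution, as $\Delta_x\to 0$, to the process $(\xi^0_t,\ t\ge0)$ given by $$\xi^0_t=2r\Big(\frac{-\overline\tau}{1-\rho_0}+\frac{\eta_0\tau}{(1-\rho_0)^2}\Big)t+\sqrt{\frac{r(1+\rho_0)}{1-\rho_0}\Big(1-\frac{\eta_0^2}{(1-\rho_0)^2}\Big)}\;W_t,$$ where $(W_t,\ t\ge 0)$ is a one-dimensional standard Brownian motion started at $0$, $\tau=(c_0+c_1)/2$ and $\overline\tau=(c_1-c_0)/2$.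
   Context: Let $\alpha_0,\beta_0\in[0,1]$ and $c_0,c_1\in\mathbb R$ be such that $0\le\alpha_0+c_0\Delta_x\le1$ and $0\le\beta_0+c_1\Delta_x\le1$ for all sufficiently small $\Delta_x>0$. Set $\rho_0=1-\alpha_0-\beta_0$ and $\eta_0=\beta_0-\alpha_0$. For such $\Delta_x$, $(Y_t)_{t\in\mathbb N}$ is the $\{-1,1\}$-valued Markov chain with transition matrix (rows and columns ordered as $-1,1$) $$\pi^\Delta=\begin{pmatrix}1-\alpha_0-c_0\Delta_x & \alpha_0+c_0\Delta_x\\ \beta_0+c_1\Delta_x & 1-\beta_0-c_1\Delta_x\end{pmatrix},$$ with deterministic initial value $Y_0=-1$ or $Y_0=1$ (not depending on $\Delta_x$), and $X_t=\sum_{i=0}^tY_i$ (so $X_0=Y_0$). The normalized walk is $Z^\Delta_s=\Delta_xX_{s/\Delta_t}$ for $s\in\Delta_t\mathbb N$ ($\Delta_t>0$), and $(\tilde Z^\Delta_s)_{s\ge0}$ is the continuous-time process obtained by linear interpolation of $(Z^\Delta_s)_{s\in\Delta_t\mathbb N}$. Convergence in distribution of processes means weak convergence of laws on the space of continuous functions on $[0,\infty)$ with the topology of uniform convergence on compact sets. *)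

theory Defs
  imports "HOL-Probability.Probability"
begin

section \<open>The correlated random walk\<close>

definition walk_transition :: "real \<Rightarrow> real \<Rightarrow> int \<Rightarrow> int \<Rightarrow> real" where
  "walk_transition a b x y =
     (if x = -1 then (if y = -1 then 1 - a else a)
      else (if y = -1 then b else 1 - b))"

text \<open>
  Discrete-time homogeneous Markov chain with countable state space \<open>S\<close> and transition
  probabilities \<open>p\<close>. The measurability condition also says that every \<open>Y n\<close> takes its values
  in \<open>S\<close>. The positivity guard is needed because \<^const>\<open>cond_prob\<close> is \<open>0\<close> when one conditions
  on a null event.
\<close>
definition markov_chain ::
  "'a measure \<Rightarrow> 's set \<Rightarrow> ('s \<Rightarrow> 's \<Rightarrow> real) \<Rightarrow> (nat \<Rightarrow> 'a \<Rightarrow> 's) \<Rightarrow> bool" where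
  "markov_chain M S p Y \<longleftrightarrow>
     prob_space M \<and>
     (\<forall>n. Y n \<in> M \<rightarrow>\<^sub>M count_space S) \<and>
     (\<forall>n x. (\<forall>i. x i \<in> S) \<longrightarrow> \<P>(\<omega> in M. \<forall>i\<le>n. Y i \<omega> = x i) > 0 \<longrightarrow>
        \<P>(\<omega> in M. Y (Suc n) \<omega> = x (Suc n) \<bar> \<forall>i\<le>n. Y i \<omega> = x i) = p (x n) (x (Suc n)))"

definition walk :: "(nat \<Rightarrow> 'a \<Rightarrow> int) \<Rightarrow> nat \<Rightarrow> 'a \<Rightarrow> real" where
  "walk Y n \<omega> = (\<Sum>i\<le>n. real_of_int (Y i \<omega>))"

text \<open>Only meaningful at grid points \<open>s = dt * k\<close>, where \<open>nat \<lfloor>s / dt\<rfloor> = k\<close>.\<close>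
definition normalized_walk ::
  "real \<Rightarrow> real \<Rightarrow> (nat \<Rightarrow> 'a \<Rightarrow> int) \<Rightarrow> real \<Rightarrow> 'a \<Rightarrow> real" where
  "normalized_walk dx dt Y s \<omega> = dx * walk Y (nat \<lfloor>s / dt\<rfloor>) \<omega>"

text \<open>Linear interpolation of the values of \<open>f\<close> on the grid \<open>h\<nat>\<close> (for \<open>h > 0\<close>, \<open>s \<ge> 0\<close>).\<close>
definition linear_interpolation :: "real \<Rightarrow> (real \<Rightarrow> real) \<Rightarrow> real \<Rightarrow> real" where
  "linear_interpolation h f s =
     (let k = real_of_int \<lfloor>s / h\<rfloor>
      in f (h * k) + (s / h - k) * (f (h * (k + 1)) - f (h * k)))"

definition interpolated_walk ::
  "real \<Rightarrow> real \<Rightarrow> (nat \<Rightarrow> 'a \<Rightarrow> int) \<Rightarrow> real \<Rightarrow> 'a \<Rightarrow> real" where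
  "interpolated_walk dx dt Y s \<omega> =
     linear_interpolation dt (\<lambda>u. normalized_walk dx dt Y u \<omega>) s"

lemma interpolated_walk_grid:
  assumes "dt > 0"
  shows "interpolated_walk dx dt Y (dt * real k) \<omega> = dx * walk Y k \<omega>"
  using assms by (simp add: interpolated_walk_def linear_interpolation_def normalized_walk_def)

section \<open>Standard Brownian motion\<close>

definition standard_brownian_motion :: "'a measure \<Rightarrow> (real \<Rightarrow> 'a \<Rightarrow> real) \<Rightarrow> bool" where
  "standard_brownian_motion M W \<longleftrightarrow>
     prob_space M \<and>
     (\<forall>t\<ge>0. W t \<in> borel_measurable M) \<and>
     (\<forall>\<omega>\<in>space M. W 0 \<omega> = 0) \<and>
     (\<forall>\<omega>\<in>space M. continuous_on {0..} (\<lambda>t. W t \<omega>)) \<and>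
     (\<forall>s t. 0 \<le> s \<longrightarrow> s < t \<longrightarrow>
        distributed M lborel (\<lambda>\<omega>. W t \<omega> - W s \<omega>) (normal_density 0 (sqrt (t - s)))) \<and>
     (\<forall>(n::nat) t. 0 \<le> t 0 \<longrightarrow> (\<forall>i<n. t i \<le> t (Suc i)) \<longrightarrow>
        prob_space.indep_vars M (\<lambda>_. borel) (\<lambda>i \<omega>. W (t (Suc i)) \<omega> - W (t i) \<omega>) {..<n})"

section \<open>Continuous paths and uniform convergence on compact sets\<close>

definition continuous_paths :: "(real \<Rightarrow> real) set" where
  "continuous_paths = {f \<in> extensional {0..}. continuous_on {0..} f}"

definition compact_convergence_open :: "(real \<Rightarrow> real) set \<Rightarrow> bool" where
  "compact_convergence_open U \<longleftrightarrow>
     U \<subseteq> continuous_paths \<and>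
     (\<forall>f\<in>U. \<exists>K e. compact K \<and> K \<subseteq> {0..} \<and> e > 0 \<and>
        (\<forall>g\<in>continuous_paths. (\<forall>t\<in>K. \<bar>g t - f t\<bar> < e) \<longrightarrow> g \<in> U))"

definition path_topology :: "(real \<Rightarrow> real) topology" where
  "path_topology = topology compact_convergence_open"

lemma compact_convergence_openD:
  assumes "compact_convergence_open U" and "f \<in> U"
  shows "\<exists>K e. compact K \<and> K \<subseteq> {0..} \<and> e > 0 \<and>
    (\<forall>g\<in>continuous_paths. (\<forall>t\<in>K. \<bar>g t - f t\<bar> < e) \<longrightarrow> g \<in> U)"
  using assms(1)[unfolded compact_convergence_open_def, THEN conjunct2, THEN bspec, OF assms(2)] .

lemma compact_convergence_openI:
  assumes "U \<subseteq> continuous_paths"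
    and "\<And>f. f \<in> U \<Longrightarrow> \<exists>K e. compact K \<and> K \<subseteq> {0..} \<and> e > 0 \<and>
      (\<forall>g\<in>continuous_paths. (\<forall>t\<in>K. \<bar>g t - f t\<bar> < e) \<longrightarrow> g \<in> U)"
  shows "compact_convergence_open U"
  unfolding compact_convergence_open_def by (intro conjI ballI assms)

lemma compact_convergence_open_subset:
  "compact_convergence_open U \<Longrightarrow> U \<subseteq> continuous_paths"
  unfolding compact_convergence_open_def by (rule conjunct1)

lemma openin_path_topology: "openin path_topology = compact_convergence_open"
proof -
  have "istopology compact_convergence_open"
    unfolding istopology_def
  proof (intro conjI allI impI)
    fix S T assume S: "compact_convergence_open S" and T: "compact_convergence_open T"
    show "compact_convergence_open (S \<inter> T)"
    proof (rule compact_convergence_openI)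
      show "S \<inter> T \<subseteq> continuous_paths"
        using compact_convergence_open_subset[OF S] by (rule le_infI1)
      fix f assume "f \<in> S \<inter> T"
      then have f: "f \<in> S" "f \<in> T" by simp_all
      from compact_convergence_openD[OF S f(1)] obtain K e where
        K: "compact K" "K \<subseteq> {0..}" "e > 0"
          "\<forall>g\<in>continuous_paths. (\<forall>t\<in>K. \<bar>g t - f t\<bar> < e) \<longrightarrow> g \<in> S"
        by (elim exE conjE)
      from compact_convergence_openD[OF T f(2)] obtain L d where
        L: "compact L" "L \<subseteq> {0..}" "d > 0"
          "\<forall>g\<in>continuous_paths. (\<forall>t\<in>L. \<bar>g t - f t\<bar> < d) \<longrightarrow> g \<in> T"
        by (elim exE conjE)
      show "\<exists>K e. compact K \<and> K \<subseteq> {0..} \<and> e > 0 \<and>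
          (\<forall>g\<in>continuous_paths. (\<forall>t\<in>K. \<bar>g t - f t\<bar> < e) \<longrightarrow> g \<in> S \<inter> T)"
      proof (intro exI conjI ballI impI)
        show "compact (K \<union> L)" "K \<union> L \<subseteq> {0..}" "min e d > 0"
          using K(1-3) L(1-3) by (simp_all add: compact_Un)
        fix g assume "g \<in> continuous_paths" "\<forall>t\<in>K \<union> L. \<bar>g t - f t\<bar> < min e d"
        then show "g \<in> S \<inter> T"
          using K(4) L(4) by simp
      qed
    qed
  next
    fix \<K> assume \<K>: "\<forall>U\<in>\<K>. compact_convergence_open U"
    show "compact_convergence_open (\<Union>\<K>)"
    proof (rule compact_convergence_openI)
      show "\<Union>\<K> \<subseteq> continuous_paths"
        using \<K> by (intro Union_least) (simp add: compact_convergence_open_subset)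
      fix f assume "f \<in> \<Union>\<K>"
      then obtain U where U: "U \<in> \<K>" "f \<in> U" by (rule UnionE)
      from compact_convergence_openD[OF bspec[OF \<K> U(1)] U(2)] obtain K e where
        K: "compact K" "K \<subseteq> {0..}" "e > 0"
          "\<forall>g\<in>continuous_paths. (\<forall>t\<in>K. \<bar>g t - f t\<bar> < e) \<longrightarrow> g \<in> U"
        by (elim exE conjE)
      show "\<exists>K e. compact K \<and> K \<subseteq> {0..} \<and> e > 0 \<and>
          (\<forall>g\<in>continuous_paths. (\<forall>t\<in>K. \<bar>g t - f t\<bar> < e) \<longrightarrow> g \<in> \<Union>\<K>)"
        using K U(1) by (intro exI[of _ K] exI[of _ e]) blast
    qed
  qed
  then show ?thesis
    by (simp add: path_topology_def)
qed

lemma topspace_path_topology: "topspace path_topology = continuous_paths"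
proof -
  have "\<exists>K e. compact K \<and> K \<subseteq> {0..} \<and> e > 0 \<and>
      (\<forall>g\<in>continuous_paths. (\<forall>t\<in>K. \<bar>g t - f t\<bar> < e) \<longrightarrow> g \<in> continuous_paths)"
    for f :: "real \<Rightarrow> real"
    by (intro exI[of _ "{}"] exI[of _ "1::real"]) simp
  then have "openin path_topology continuous_paths"
    unfolding openin_path_topology compact_convergence_open_def by blast
  then have "continuous_paths \<subseteq> topspace path_topology"
    by (rule openin_subset)
  moreover have "topspace path_topology \<subseteq> continuous_paths"
    using openin_topspace[of path_topology]
    unfolding openin_path_topology compact_convergence_open_def by (rule conjunct1)
  ultimately show ?thesis
    by (rule subset_antisym[rotated])
qed

section \<open>Convergence in distribution\<close>

definition borel_of :: "'a topology \<Rightarrow> 'a measure" where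
  "borel_of X = sigma (topspace X) {U. openin X U}"

lemma borel_of_euclidean: "borel_of euclidean = borel"
  by (simp add: borel_of_def borel_def)

text \<open>
  Weak convergence, along \<open>F\<close>, of the laws of the \<open>X\<close>-valued random elements \<open>\<xi> i\<close>
  (defined on possibly different probability spaces \<open>M i\<close>) to the law \<open>\<nu>\<close>.
\<close>
definition converges_in_distribution ::
  "'b topology \<Rightarrow> ('i \<Rightarrow> 'a measure) \<Rightarrow> ('i \<Rightarrow> 'a \<Rightarrow> 'b) \<Rightarrow> 'b measure \<Rightarrow> 'i filter \<Rightarrow> bool" where
  "converges_in_distribution X M \<xi> \<nu> F \<longleftrightarrow>
     (\<forall>\<^sub>F i in F. prob_space (M i) \<and> \<xi> i \<in> M i \<rightarrow>\<^sub>M borel_of X) \<and>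
     prob_space \<nu> \<and> sets \<nu> = sets (borel_of X) \<and>
     (\<forall>f. continuous_map X euclideanreal f \<and> bounded (f ` topspace X) \<longrightarrow>
        ((\<lambda>i. integral\<^sup>L (distr (M i) (borel_of X) (\<xi> i)) f) \<longlongrightarrow> integral\<^sup>L \<nu> f) F)"

text \<open>For sequences of real random variables this is the library's notion.\<close>
lemma converges_in_distribution_real_iff:
  fixes \<xi> :: "nat \<Rightarrow> 'a \<Rightarrow> real"
  assumes M: "\<And>n. prob_space (M n)" and \<xi>: "\<And>n. \<xi> n \<in> borel_measurable (M n)"
    and \<nu>: "real_distribution \<nu>"
  shows "converges_in_distribution euclideanreal M \<xi> \<nu> sequentially \<longleftrightarrow>
         weak_conv_m (\<lambda>n. distr (M n) borel (\<xi> n)) \<nu>"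
proof -
  interpret \<nu>: real_distribution \<nu> by fact
  have d: "real_distribution (distr (M n) borel (\<xi> n))" for n
    using M \<xi> by (simp add: real_distribution_def real_distribution_axioms_def prob_space.prob_space_distr)
  show ?thesis
  proof
    assume c: "converges_in_distribution euclideanreal M \<xi> \<nu> sequentially"
    show "weak_conv_m (\<lambda>n. distr (M n) borel (\<xi> n)) \<nu>"
    proof (rule integral_bdd_continuous_conv_imp_weak_conv[OF d \<nu>])
      fix f :: "real \<Rightarrow> real" assume f: "\<And>x. isCont f x" "\<And>x. \<bar>f x\<bar> \<le> 1"
      then have "continuous_map euclideanreal euclideanreal f" "bounded (range f)"
        by (auto simp: continuous_map_iff_continuous continuous_at_imp_continuous_on bounded_iff)
      then show "(\<lambda>n. integral\<^sup>L (distr (M n) borel (\<xi> n)) f) \<longlonglongrightarrow> integral\<^sup>L \<nu> f"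
        using c by (simp add: converges_in_distribution_def borel_of_euclidean)
    qed
  next
    assume w: "weak_conv_m (\<lambda>n. distr (M n) borel (\<xi> n)) \<nu>"
    show "converges_in_distribution euclideanreal M \<xi> \<nu> sequentially"
      unfolding converges_in_distribution_def borel_of_euclidean
    proof (intro conjI allI impI)
      fix f :: "real \<Rightarrow> real"
      assume "continuous_map euclideanreal euclideanreal f \<and> bounded (f ` topspace euclideanreal)"
      then obtain B where "\<And>x. isCont f x" "\<And>x. norm (f x) \<le> B"
        by (auto simp: continuous_map_iff_continuous continuous_on_eq_continuous_at bounded_iff)
      then show "(\<lambda>n. integral\<^sup>L (distr (M n) borel (\<xi> n)) f) \<longlonglongrightarrow> integral\<^sup>L \<nu> f"
        by (rule weak_conv_imp_integral_bdd_continuous_conv[OF d \<nu> w])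
    qed (use M \<xi> \<nu>.prob_space_axioms in auto)
  qed
qed

text \<open>
  A real-valued process with time set \<open>[0, \<infinity>)\<close>, seen as a random element of
  \<^const>\<open>continuous_paths\<close>.
\<close>
definition path_of :: "(real \<Rightarrow> 'a \<Rightarrow> real) \<Rightarrow> 'a \<Rightarrow> real \<Rightarrow> real" where
  "path_of \<xi> \<omega> = restrict (\<lambda>t. \<xi> t \<omega>) {0..}"

end

theory Submission
  imports Defs
begin

text \<open>
  Write \<open>a\<close> and \<open>b\<close> for the perturbed flip probabilities, \<open>\<rho> = 1 - a - b\<close>, and \<open>m = (a - b) / (a + b)\<close>
  for the mean of \<open>Y\<close> under the stationary law. Since the conditional mean of \<open>Y\<^sub>i\<^sub>+\<^sub>1 - m\<close> given the past
  is \<open>\<rho> (Y\<^sub>i - m)\<close>, the variables \<open>D\<^sub>i\<^sub>+\<^sub>1 = (Y\<^sub>i\<^sub>+\<^sub>1 - m) - \<rho> (Y\<^sub>i - m)\<close> are bounded martingale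
  differences, and summation gives \<open>(1 - \<rho>) \<Sum>(Y\<^sub>i - m) = \<Sum>D\<^sub>i + \<rho> (Y\<^sub>0 - Y\<^sub>n)\<close>. Hence the centred walk
  has fluctuations of order \<open>\<surd>n\<close>, with asymptotic variance \<open>(1 + \<rho>) / (1 - \<rho>) * (1 - m\<^sup>2)\<close> per step,
  around the drift \<open>n m\<close>. If \<open>\<Delta>\<^sub>t\<close> is proportional to \<open>\<Delta>\<^sub>x\<close>, the
  fluctuations vanish and only the drift survives. If \<open>\<Delta>\<^sub>t\<close> is proportional to \<open>\<Delta>\<^sub>x\<^sup>2\<close>, the drift
  of the unperturbed chain is of order \<open>1 / \<Delta>\<^sub>x\<close> and is exactly the term that is subtracted in the
  definition of \<open>\<xi>\<^sup>\<Delta>\<close>. The first-order change of \<open>m\<close> in \<open>\<Delta>\<^sub>x\<close> gives the drift of the limit, and the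
  fluctuations give its Brownian part.

  Weak convergence on path space is obtained by approximation, without a compactness argument.

  \<^item> A bounded continuous functional is an increasing limit of functionals that are Lipschitz for the
    supremum over a compact interval (\<open>minorant_tendsto\<close>). So Lipschitz functionals suffice
    (\<open>weak_convergence_from_lipschitz\<close>).
  \<^item> A path is replaced by its linear interpolation on a coarse grid with \<open>q\<close> cells. For the walk the
    error is controlled by a fourth-moment maximal inequality (\<open>centered_sum_maximal\<close>): a single cell
    fails with probability of order \<open>1 / q\<^sup>2\<close>, so some cell fails with probability of order \<open>1 / q\<close>, uniformly in the
    mesh. For Brownian motion uniform continuity of its paths is enough.
  \<^item> On a coarse grid only the sums over \<open>q\<close> consecutive blocks matter. The characteristic function of
    one block sum is computed from an approximate eigenvector of the two-state transfer operator
    (\<open>char_walk_bound\<close>), which gives a central limit theorem for each of the two initial states. By the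
    Skorohod representation the convergence is uniform over Lipschitz test functions
    (\<open>weak_conv_uniform\<close>). So the Markov property allows one block after the other to be replaced by
    an independent Gaussian variable (\<open>block_convergence\<close>).
\<close>

section \<open>Random elements of the path space\<close>

lemma space_borel_of: "space (borel_of X) = topspace X"
  unfolding borel_of_def by (rule space_measure_of) (auto dest: openin_subset)

lemma sets_borel_of_openin: "openin X U \<Longrightarrow> U \<in> sets (borel_of X)"
  unfolding borel_of_def by (subst sets_measure_of) (auto dest: openin_subset)

lemma continuous_map_borel_of_measurable:
  assumes "continuous_map X euclideanreal f"
  shows "f \<in> borel_measurable (borel_of X)"
proof (rule borel_measurableI)
  fix S :: "real set" assume "open S"
  then have "openin X {x \<in> topspace X. f x \<in> S}"
    using assms by (auto simp: continuous_map_def)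
  moreover have "f -` S \<inter> space (borel_of X) = {x \<in> topspace X. f x \<in> S}"
    by (auto simp: space_borel_of)
  ultimately show "f -` S \<inter> space (borel_of X) \<in> sets (borel_of X)"
    by (simp add: sets_borel_of_openin)
qed

text \<open>
  Reduces a bound on an interval to countably many conditions, which is what measurability needs.
\<close>
lemma continuous_le_from_rationals:
  fixes f :: "real \<Rightarrow> real"
  assumes c: "continuous_on {0..} f" and n: "n > 0"
    and r: "\<And>t. t \<in> \<rat> \<Longrightarrow> 0 \<le> t \<Longrightarrow> t \<le> n \<Longrightarrow> \<bar>f t\<bar> \<le> e"
    and t: "0 \<le> t" "t \<le> n"
  shows "\<bar>f t\<bar> \<le> e"
proof (rule field_le_epsilon)
  fix d :: real assume d: "d > 0"
  from c t(1) d obtain \<delta> where \<delta>: "\<delta> > 0" "\<And>s. s \<ge> 0 \<Longrightarrow> \<bar>s - t\<bar> < \<delta> \<Longrightarrow> \<bar>f s - f t\<bar> < d"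
    unfolding continuous_on_iff dist_real_def by (metis atLeast_iff)
  have "max 0 (t - \<delta>) < min n (t + \<delta>)" using \<delta>(1) t n by auto
  then obtain s where s: "s \<in> \<rat>" "max 0 (t - \<delta>) < s" "s < min n (t + \<delta>)"
    using Rats_dense_in_real by blast
  then have "\<bar>f s - f t\<bar> < d" "\<bar>f s\<bar> \<le> e" using \<delta>(2)[of s] r[of s] by auto
  then show "\<bar>f t\<bar> \<le> e + d" by linarith
qed

definition rational_step :: "rat list \<Rightarrow> nat \<Rightarrow> real \<Rightarrow> real" where
  "rational_step q N t = of_rat (q ! nat \<lfloor>t * real N\<rfloor>)"

lemma rational_step_approx:
  fixes f :: "real \<Rightarrow> real"
  assumes c: "continuous_on {0..} f" and e: "e > 0"
  shows "\<exists>q N. \<forall>t\<in>{0..real n}. \<bar>f t - rational_step q N t\<bar> \<le> e"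
proof -
  have "uniformly_continuous_on {0..real n} f"
    using c by (intro compact_uniformly_continuous) (auto intro: continuous_on_subset)
  then obtain d where d: "d > 0"
    "\<And>s t. s \<in> {0..real n} \<Longrightarrow> t \<in> {0..real n} \<Longrightarrow> \<bar>s - t\<bar> < d \<Longrightarrow> \<bar>f s - f t\<bar> < e / 2"
    unfolding uniformly_continuous_on_def dist_real_def using e half_gt_zero by metis
  obtain N0 where N0: "inverse (real (Suc N0)) < d" using d(1) reals_Archimedean by blast
  define N where "N = Suc N0"
  have N: "N > 0" "1 / real N < d" using N0 by (simp_all add: N_def inverse_eq_divide)
  have "\<exists>r::rat. \<bar>f (real k / real N) - of_rat r\<bar> \<le> e / 2" for k
  proof -
    have "f (real k / real N) - e/2 < f (real k / real N)" using e by simp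
    then obtain r where "f (real k / real N) - e/2 < of_rat r" "of_rat r < f (real k / real N)"
      using of_rat_dense by blast
    then show ?thesis by (intro exI[of _ r]) auto
  qed
  then obtain r :: "nat \<Rightarrow> rat" where r: "\<And>k. \<bar>f (real k / real N) - of_rat (r k)\<bar> \<le> e / 2" by metis
  define q where "q = map r [0..<Suc (n * N)]"
  show ?thesis
  proof (intro exI ballI)
    fix t assume t: "t \<in> {0..real n}"
    define k where "k = nat \<lfloor>t * real N\<rfloor>"
    have k1: "real k \<le> t * real N" "t * real N < real k + 1"
      using t by (auto simp: k_def)
    have "t * real N \<le> real n * real N" using t by (intro mult_right_mono) auto
    then have "real k \<le> real (n * N)" using k1 by simp
    then have kn: "k \<le> n * N" using of_nat_le_iff by blast
    have q: "rational_step q N t = of_rat (r k)"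
      using kn by (simp add: rational_step_def q_def k_def[symmetric] nth_append)
    have a: "real k / real N \<le> t" "t - real k / real N \<le> 1 / real N"
    proof -
      show "real k / real N \<le> t" using k1(1) N(1) by (simp add: pos_divide_le_eq)
      have "t < (real k + 1) / real N" using k1(2) N(1) by (simp add: pos_less_divide_eq)
      then show "t - real k / real N \<le> 1 / real N" by (simp add: add_divide_distrib)
    qed
    then have "\<bar>f t - f (real k / real N)\<bar> < e / 2"
      using t N by (intro d(2)) auto
    then show "\<bar>f t - rational_step q N t\<bar> \<le> e" using r[of k] unfolding q by linarith
  qed
qed

text \<open>
  The bound is imposed at rational times only, so that the preimage of a tube under a random path is a
  countable intersection of events.
\<close>
definition rational_tube :: "rat list \<times> nat \<times> nat \<times> nat \<Rightarrow> (real \<Rightarrow> real) set" where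
  "rational_tube = (\<lambda>(q, N, n, p). {g \<in> continuous_paths.
     \<forall>t\<in>\<rat> \<inter> {0..real n}. \<bar>g t - rational_step q N t\<bar> \<le> 1 / real p})"

text \<open>
  The tubes form a countable family, so this plays the role of second countability: around each path
  of an open set there is a tube inside the set, because a path is uniformly approximated on a
  compact interval by a rational step function, and two paths in one tube of width \<open>1 / p\<close> differ by at
  most \<open>2 / p\<close> there.
\<close>
lemma open_eq_Union_rational_tubes:
  assumes U: "openin path_topology U"
  shows "U = \<Union>(rational_tube ` {i. rational_tube i \<subseteq> U})"
proof (intro equalityI subsetI)
  fix f assume f: "f \<in> U"
  have fc: "f \<in> continuous_paths" using U f openin_subset topspace_path_topology by blast
  from U f obtain K e where K: "compact K" "K \<subseteq> {0..}" "e > 0"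
    "\<And>g. g \<in> continuous_paths \<Longrightarrow> \<forall>t\<in>K. \<bar>g t - f t\<bar> < e \<Longrightarrow> g \<in> U"
    unfolding openin_path_topology using compact_convergence_openD by metis
  obtain b where b: "\<And>x. x \<in> K \<Longrightarrow> \<bar>x\<bar> \<le> b"
    using compact_imp_bounded[OF K(1)] unfolding bounded_iff real_norm_def by blast
  obtain n0 :: nat where n0: "b \<le> real n0" using real_arch_simple by blast
  define n where "n = Suc n0"
  have Kn: "K \<subseteq> {0..real n}" using b n0 K(2) by (force simp: n_def)
  obtain p0 where p0: "inverse (real (Suc p0)) < e / 2" using K(3) reals_Archimedean half_gt_zero by blast
  define p where "p = Suc p0"
  have p: "1 / real p < e / 2" "0 < 1 / real p" using p0 by (simp_all add: p_def inverse_eq_divide)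
  obtain q N where q: "\<And>t. t \<in> {0..real n} \<Longrightarrow> \<bar>f t - rational_step q N t\<bar> \<le> 1 / real p"
    using rational_step_approx[of f "1 / real p" n] fc p(2) unfolding continuous_paths_def by blast
  have "f \<in> rational_tube (q, N, n, p)" using fc q by (auto simp: rational_tube_def)
  moreover have "rational_tube (q, N, n, p) \<subseteq> U"
  proof
    fix g assume g: "g \<in> rational_tube (q, N, n, p)"
    then have gc: "g \<in> continuous_paths" by (simp add: rational_tube_def)
    have "\<bar>g t - f t\<bar> \<le> 2 / real p" if "t \<in> {0..real n}" for t
    proof (rule continuous_le_from_rationals[of "\<lambda>t. g t - f t" "real n"])
      show "continuous_on {0..} (\<lambda>t. g t - f t)"
        using gc fc by (auto simp: continuous_paths_def intro: continuous_on_diff)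
      fix s assume "s \<in> \<rat>" "0 \<le> s" "s \<le> real n"
      then have "\<bar>g s - rational_step q N s\<bar> \<le> 1 / real p" "\<bar>f s - rational_step q N s\<bar> \<le> 1 / real p"
        using g q by (auto simp: rational_tube_def)
      then show "\<bar>g s - f s\<bar> \<le> 2 / real p" by linarith
    qed (use that in \<open>auto simp: n_def\<close>)
    then have "\<forall>t\<in>K. \<bar>g t - f t\<bar> < e" using Kn p by fastforce
    with K(4) gc show "g \<in> U" by blast
  qed
  ultimately show "f \<in> \<Union>(rational_tube ` {i. rational_tube i \<subseteq> U})" by blast
qed blast

lemma measurable_into_path_space:
  assumes f: "\<And>\<omega>. \<omega> \<in> space M \<Longrightarrow> f \<omega> \<in> continuous_paths"
    and m: "\<And>t. t \<ge> 0 \<Longrightarrow> (\<lambda>\<omega>. f \<omega> t) \<in> borel_measurable M"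
  shows "f \<in> M \<rightarrow>\<^sub>M borel_of path_topology"
  unfolding borel_of_def
proof (rule measurable_measure_of)
  show "{U. openin path_topology U} \<subseteq> Pow (topspace path_topology)" by (auto dest: openin_subset)
  show "f \<in> space M \<rightarrow> topspace path_topology" using f by (simp add: topspace_path_topology)
  fix U assume "U \<in> {U. openin path_topology U}"
  then have "openin path_topology U" by simp
  then have "f -` U \<inter> space M = (\<Union>i\<in>{i. rational_tube i \<subseteq> U}. f -` rational_tube i \<inter> space M)"
    by (subst open_eq_Union_rational_tubes[of U]) auto
  also have "\<dots> \<in> sets M"
  proof (rule sets.countable_UN'')
    fix i :: "rat list \<times> nat \<times> nat \<times> nat"
    obtain q N n p where i: "i = (q, N, n, p)" by (cases i)
    have "f -` rational_tube i \<inter> space M =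
        {\<omega> \<in> space M. \<forall>t\<in>\<rat> \<inter> {0..real n}. \<bar>f \<omega> t - rational_step q N t\<bar> \<le> 1 / real p}"
      using f by (auto simp: i rational_tube_def)
    also have "\<dots> \<in> sets M"
    proof (rule sets.sets_Collect_countable_All')
      show "countable (\<rat> \<inter> {0..real n})" by (simp add: countable_rat)
      fix t assume "t \<in> \<rat> \<inter> {0..real n}"
      then have [measurable]: "(\<lambda>\<omega>. f \<omega> t) \<in> borel_measurable M" using m by auto
      show "{\<omega> \<in> space M. \<bar>f \<omega> t - rational_step q N t\<bar> \<le> 1 / real p} \<in> sets M" by measurable
    qed
    finally show "f -` rational_tube i \<inter> space M \<in> sets M" .
  qed simp
  finally show "f -` U \<inter> space M \<in> sets M" .
qed

section \<open>Weak convergence tested on Lipschitz functionals\<close>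

text \<open>
  The Lipschitz condition is stated with an upper bound \<open>e\<close> instead of the supremum, so that it can be
  applied to any estimate of the distance. It also makes \<open>F\<close> depend only on the path up to time \<open>T\<close>.
\<close>
definition sup_lipschitz :: "real \<Rightarrow> real \<Rightarrow> ((real \<Rightarrow> real) \<Rightarrow> real) \<Rightarrow> bool" where
  "sup_lipschitz T K F \<longleftrightarrow> (\<forall>x\<in>continuous_paths. \<forall>y\<in>continuous_paths. \<forall>e.
     (\<forall>t\<in>{0..T}. \<bar>x t - y t\<bar> \<le> e) \<longrightarrow> \<bar>F x - F y\<bar> \<le> K * e)"

lemma sup_lipschitz_continuous:
  assumes F: "sup_lipschitz T K F" and K: "K \<ge> 0"
  shows "continuous_map path_topology euclideanreal F"
  unfolding continuous_map_def
proof (intro conjI allI impI)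
  fix U :: "real set" assume "openin euclidean U"
  then have U: "open U" by simp
  show "openin path_topology {x \<in> topspace path_topology. F x \<in> U}"
    unfolding openin_path_topology topspace_path_topology
  proof (rule compact_convergence_openI)
    fix x assume "x \<in> {x \<in> continuous_paths. F x \<in> U}"
    then have x: "x \<in> continuous_paths" "F x \<in> U" by auto
    obtain r where r: "r > 0" "\<And>z. \<bar>z - F x\<bar> < r \<Longrightarrow> z \<in> U"
      using U x(2) unfolding open_dist dist_real_def by blast
    define e where "e = r / (K + 1)"
    have e: "e > 0" "K * e < r" using r(1) K by (auto simp: e_def field_simps)
    have "g \<in> {x \<in> continuous_paths. F x \<in> U}"
      if g: "g \<in> continuous_paths" "\<forall>t\<in>{0..T}. \<bar>g t - x t\<bar> < e" for g
    proof -
      have "\<bar>F g - F x\<bar> \<le> K * e"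
        using F x(1) g unfolding sup_lipschitz_def by (meson less_imp_le)
      then show ?thesis using e r(2) g(1) by auto
    qed
    then show "\<exists>K e. compact K \<and> K \<subseteq> {0..} \<and> 0 < e \<and>
        (\<forall>g\<in>continuous_paths. (\<forall>t\<in>K. \<bar>g t - x t\<bar> < e) \<longrightarrow> g \<in> {x \<in> continuous_paths. F x \<in> U})"
      using e(1) by (intro exI[of _ "{0..T}"] exI[of _ e]) auto
  qed auto
qed auto

definition path_dist :: "nat \<Rightarrow> (real \<Rightarrow> real) \<Rightarrow> (real \<Rightarrow> real) \<Rightarrow> real" where
  "path_dist k x y = (SUP t\<in>{0..real k}. \<bar>x t - y t\<bar>)"

lemma path_dist_upper:
  assumes x: "x \<in> continuous_paths" and y: "y \<in> continuous_paths" and t: "t \<in> {0..real k}"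
  shows "\<bar>x t - y t\<bar> \<le> path_dist k x y"
  unfolding path_dist_def
proof (rule cSUP_upper[OF t])
  have "continuous_on {0..real k} (\<lambda>t. \<bar>x t - y t\<bar>)"
    using x y unfolding continuous_paths_def
    by (intro continuous_intros) (auto intro: continuous_on_subset)
  then show "bdd_above ((\<lambda>t. \<bar>x t - y t\<bar>) ` {0..real k})"
    by (intro bounded_imp_bdd_above compact_imp_bounded compact_continuous_image) auto
qed

lemma path_dist_least:
  assumes "\<And>t. t \<in> {0..real k} \<Longrightarrow> \<bar>x t - y t\<bar> \<le> e"
  shows "path_dist k x y \<le> e"
  unfolding path_dist_def using assms by (intro cSUP_least) auto

lemma path_dist_nonneg:
  assumes "x \<in> continuous_paths" "y \<in> continuous_paths"
  shows "0 \<le> path_dist k x y"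
  using path_dist_upper[OF assms, of 0 k] by simp

text \<open>
  Inf-convolution of \<open>f\<close> with the distance \<open>k * path_dist k\<close>, the largest functional below \<open>f\<close> that is
  \<open>k\<close>-Lipschitz for \<open>path_dist k\<close>. Both the slope and the time horizon grow with \<open>k\<close>, because the topology
  is given by a family of seminorms.
\<close>
definition lipschitz_minorant :: "nat \<Rightarrow> ((real \<Rightarrow> real) \<Rightarrow> real) \<Rightarrow> (real \<Rightarrow> real) \<Rightarrow> real" where
  "lipschitz_minorant k f x = (INF y\<in>continuous_paths. f y + real k * path_dist k x y)"

context
  fixes f :: "(real \<Rightarrow> real) \<Rightarrow> real" and B :: real
  assumes B: "\<And>x. x \<in> continuous_paths \<Longrightarrow> \<bar>f x\<bar> \<le> B"
begin

lemma minorant_bdd_below: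
  assumes x: "x \<in> continuous_paths"
  shows "bdd_below ((\<lambda>y. f y + real k * path_dist k x y) ` continuous_paths)"
proof (rule bdd_belowI[of _ "-B"])
  fix z assume "z \<in> (\<lambda>y. f y + real k * path_dist k x y) ` continuous_paths"
  then obtain y where y: "y \<in> continuous_paths" "z = f y + real k * path_dist k x y" by auto
  then show "- B \<le> z"
    using B[OF y(1)] path_dist_nonneg[OF x y(1), of k] by (auto simp: abs_le_iff add_increasing2)
qed

lemma minorant_lower:
  assumes x: "x \<in> continuous_paths" and y: "y \<in> continuous_paths"
  shows "lipschitz_minorant k f x \<le> f y + real k * path_dist k x y"
  unfolding lipschitz_minorant_def by (rule cINF_lower[OF minorant_bdd_below[OF x] y])

lemma minorant_le:
  assumes x: "x \<in> continuous_paths"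
  shows "lipschitz_minorant k f x \<le> f x"
proof -
  have "path_dist k x x \<le> 0" by (rule path_dist_least) simp
  then have "path_dist k x x = 0" using path_dist_nonneg[OF x x, of k] by simp
  then show ?thesis using minorant_lower[OF x x, of k] by simp
qed

lemma minorant_greatest:
  assumes "x \<in> continuous_paths" "\<And>y. y \<in> continuous_paths \<Longrightarrow> c \<le> f y + real k * path_dist k x y"
  shows "c \<le> lipschitz_minorant k f x"
  unfolding lipschitz_minorant_def using assms by (intro cINF_greatest) auto

lemma minorant_bounded:
  assumes x: "x \<in> continuous_paths"
  shows "\<bar>lipschitz_minorant k f x\<bar> \<le> B"
proof -
  have "- B \<le> lipschitz_minorant k f x"
  proof (rule minorant_greatest[OF x])
    fix y assume y: "y \<in> continuous_paths"
    have "0 \<le> real k * path_dist k x y" using path_dist_nonneg[OF x y] by simp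
    then show "- B \<le> f y + real k * path_dist k x y" using B[OF y] by (simp add: abs_le_iff)
  qed
  then show ?thesis using minorant_le[OF x, of k] B[OF x] by linarith
qed

lemma minorant_lipschitz: "sup_lipschitz (real k) (real k) (lipschitz_minorant k f)"
proof -
  have half: "lipschitz_minorant k f x \<le> lipschitz_minorant k f y + real k * e"
    if x: "x \<in> continuous_paths" and y: "y \<in> continuous_paths" and e: "\<forall>t\<in>{0..real k}. \<bar>x t - y t\<bar> \<le> e" for x y e
  proof -
    have "lipschitz_minorant k f x - real k * e \<le> lipschitz_minorant k f y"
    proof (rule minorant_greatest[OF y])
      fix z assume z: "z \<in> continuous_paths"
      have "path_dist k x z \<le> path_dist k y z + e"
      proof (rule path_dist_least)
        fix t assume t: "t \<in> {0..real k}"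
        show "\<bar>x t - z t\<bar> \<le> path_dist k y z + e"
          using path_dist_upper[OF y z t] e t by fastforce
      qed
      then have "real k * path_dist k x z \<le> real k * (path_dist k y z + e)" by (intro mult_left_mono) auto
      then show "lipschitz_minorant k f x - real k * e \<le> f z + real k * path_dist k y z"
        using minorant_lower[OF x z, of k] by (simp add: algebra_simps)
    qed
    then show ?thesis by simp
  qed
  show ?thesis unfolding sup_lipschitz_def
  proof (intro ballI allI impI)
    fix x y e assume xy: "x \<in> continuous_paths" "y \<in> continuous_paths" "\<forall>t\<in>{0..real k}. \<bar>x t - y t\<bar> \<le> e"
    then have "\<forall>t\<in>{0..real k}. \<bar>y t - x t\<bar> \<le> e" by (simp add: abs_minus_commute)
    with xy half[of x y e] half[of y x e]
    show "\<bar>lipschitz_minorant k f x - lipschitz_minorant k f y\<bar> \<le> real k * e" by auto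
  qed
qed

text \<open>
  A competitor \<open>y\<close> in the infimum either is close to \<open>x\<close>, and then \<open>f y\<close> is almost \<open>f x\<close> by continuity,
  or it is far away, and then the penalty exceeds the oscillation \<open>2 * B\<close> of \<open>f\<close> once \<open>k\<close> is large.
\<close>
lemma minorant_tendsto:
  assumes f: "continuous_map path_topology euclideanreal f" and x: "x \<in> continuous_paths"
  shows "(\<lambda>k. lipschitz_minorant k f x) \<longlonglongrightarrow> f x"
proof (rule LIMSEQ_I)
  fix r :: real assume r: "0 < r"
  have "openin path_topology {y \<in> topspace path_topology. f y \<in> {f x - r/2 <..}}"
    using f unfolding continuous_map_def by (metis open_greaterThan open_openin)
  then have "compact_convergence_open {y \<in> continuous_paths. f y \<in> {f x - r/2 <..}}"
    by (simp add: openin_path_topology topspace_path_topology)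
  from compact_convergence_openD[OF this, of x] x r obtain K e where
    K: "compact K" "K \<subseteq> {0..}" "e > 0"
      "\<And>g. g \<in> continuous_paths \<Longrightarrow> \<forall>t\<in>K. \<bar>g t - x t\<bar> < e \<Longrightarrow> f x - r/2 < f g"
    by auto
  obtain b where b: "\<And>x. x \<in> K \<Longrightarrow> \<bar>x\<bar> \<le> b"
    using compact_imp_bounded[OF K(1)] unfolding bounded_iff real_norm_def by blast
  obtain n0 :: nat where n0: "max b (2 * B / e) \<le> real n0" using real_arch_simple by blast
  have "norm (lipschitz_minorant k f x - f x) < r" if k: "k \<ge> n0" for k
  proof -
    have kr: "b \<le> real k" "2 * B / e \<le> real k" using n0 k by (simp_all add: order_trans)
    have "f x - r/2 \<le> lipschitz_minorant k f x"
    proof (rule minorant_greatest[OF x])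
      fix y assume y: "y \<in> continuous_paths"
      have nn: "0 \<le> real k * path_dist k x y" using path_dist_nonneg[OF x y] by simp
      show "f x - r/2 \<le> f y + real k * path_dist k x y"
      proof (cases "path_dist k x y < e")
        case True
        have "\<bar>y t - x t\<bar> < e" if "t \<in> K" for t
        proof -
          have "t \<in> {0..real k}" using that b[OF that] K(2) kr by auto
          then show ?thesis using path_dist_upper[OF x y, of t k] True by (simp add: abs_minus_commute)
        qed
        then show ?thesis using K(4)[OF y] nn by auto
      next
        case False
        have "2 * B \<le> real k * e" using kr(2) K(3) by (simp add: field_simps)
        also have "\<dots> \<le> real k * path_dist k x y" using False by (intro mult_left_mono) auto
        finally show ?thesis using B[OF x] B[OF y] r by (auto simp: abs_le_iff)
      qed
    qed
    then show ?thesis using minorant_le[OF x, of k] r by auto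
  qed
  then show "\<exists>no. \<forall>n\<ge>no. norm (lipschitz_minorant n f x - f x) < r" by blast
qed

end

lemma bounded_integrable:
  fixes g :: "'x \<Rightarrow> real"
  assumes "prob_space P" "g \<in> borel_measurable P" "\<And>x. x \<in> space P \<Longrightarrow> \<bar>g x\<bar> \<le> B"
  shows "integrable P g"
proof -
  interpret prob_space P by fact
  show ?thesis using assms by (intro integrable_const_bound[of _ B]) (auto intro!: AE_I2)
qed

text \<open>
  The minorants give the lower bound \<open>liminf (integral of f) \<ge> integral of f\<close> by dominated
  convergence under the limit law. The upper bound is the same statement for \<open>- f\<close>.
\<close>
lemma weak_convergence_from_lipschitz:
  fixes \<mu> :: "nat \<Rightarrow> (real \<Rightarrow> real) measure"
  assumes \<mu>: "\<And>n. prob_space (\<mu> n)" "\<And>n. sets (\<mu> n) = sets (borel_of path_topology)"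
    and \<nu>: "prob_space \<nu>" "sets \<nu> = sets (borel_of path_topology)"
    and lip: "\<And>F T K B. \<lbrakk>T > 0; K \<ge> 0; sup_lipschitz T K F; \<And>x. x \<in> continuous_paths \<Longrightarrow> \<bar>F x\<bar> \<le> B\<rbrakk>
        \<Longrightarrow> (\<lambda>n. integral\<^sup>L (\<mu> n) F) \<longlonglongrightarrow> integral\<^sup>L \<nu> F"
    and f: "continuous_map path_topology euclideanreal f" "bounded (f ` continuous_paths)"
  shows "(\<lambda>n. integral\<^sup>L (\<mu> n) f) \<longlonglongrightarrow> integral\<^sup>L \<nu> f"
proof -
  have sp: "space (\<mu> n) = continuous_paths" "space \<nu> = continuous_paths" for n
    using sets_eq_imp_space_eq[OF \<mu>(2)] sets_eq_imp_space_eq[OF \<nu>(2)]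
    by (simp_all add: space_borel_of topspace_path_topology)
  have meas: "g \<in> borel_measurable (\<mu> n)" "g \<in> borel_measurable \<nu>"
    if "continuous_map path_topology euclideanreal g" for g n
    using continuous_map_borel_of_measurable[OF that] \<mu>(2) \<nu>(2)
    by (simp_all add: measurable_def sets_eq_imp_space_eq[OF \<mu>(2)] sets_eq_imp_space_eq[OF \<nu>(2)])
  obtain B where B: "\<And>x. x \<in> continuous_paths \<Longrightarrow> \<bar>f x\<bar> \<le> B"
    using f(2) unfolding bounded_iff by auto
  have lower: "\<forall>\<^sub>F n in sequentially. integral\<^sup>L \<nu> g - e < integral\<^sup>L (\<mu> n) g"
    if g: "continuous_map path_topology euclideanreal g" "\<And>x. x \<in> continuous_paths \<Longrightarrow> \<bar>g x\<bar> \<le> B"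
      and e: "e > 0" for g e
  proof -
    let ?h = "\<lambda>k. lipschitz_minorant k g"
    have hc: "continuous_map path_topology euclideanreal (?h k)" for k
      by (rule sup_lipschitz_continuous[OF minorant_lipschitz[of g B]]) (auto simp: g)
    have "(\<lambda>k. integral\<^sup>L \<nu> (?h k)) \<longlonglongrightarrow> integral\<^sup>L \<nu> g"
    proof (rule integral_dominated_convergence[where w = "\<lambda>_. B"])
      interpret prob_space \<nu> by fact
      show "integrable \<nu> (\<lambda>_. B)" by simp
      show "AE x in \<nu>. (\<lambda>k. ?h k x) \<longlonglongrightarrow> g x"
        by (intro AE_I2 minorant_tendsto[OF g(2) g(1)]) (auto simp: sp)
      show "AE x in \<nu>. norm (?h k x) \<le> B" for k
        using minorant_bounded[OF g(2)] by (intro AE_I2) (auto simp: sp)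
    qed (use meas hc g in auto)
    then have "\<forall>\<^sub>F k in sequentially. integral\<^sup>L \<nu> g - e < integral\<^sup>L \<nu> (?h k)"
      by (rule order_tendstoD) (use e in simp)
    then obtain k0 where "integral\<^sup>L \<nu> g - e < integral\<^sup>L \<nu> (?h k0)"
      unfolding eventually_sequentially by blast
    \<comment> \<open>A successor, so that the time horizon of the minorant is positive.\<close>
    then obtain k where k: "integral\<^sup>L \<nu> g - e < integral\<^sup>L \<nu> (?h (Suc k))"
      using \<open>\<forall>\<^sub>F k in sequentially. integral\<^sup>L \<nu> g - e < integral\<^sup>L \<nu> (?h k)\<close>
      unfolding eventually_sequentially by (meson le_SucI order_refl)
    have "(\<lambda>n. integral\<^sup>L (\<mu> n) (?h (Suc k))) \<longlonglongrightarrow> integral\<^sup>L \<nu> (?h (Suc k))"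
      by (rule lip[of "real (Suc k)" "real (Suc k)" _ B])
        (use minorant_lipschitz[of g B "Suc k"] minorant_bounded[of g B _ "Suc k"] g in auto)
    then have "\<forall>\<^sub>F n in sequentially. integral\<^sup>L \<nu> g - e < integral\<^sup>L (\<mu> n) (?h (Suc k))"
      by (rule order_tendstoD) (use k in simp)
    then show ?thesis
    proof eventually_elim
      case (elim n)
      have "integral\<^sup>L (\<mu> n) (?h (Suc k)) \<le> integral\<^sup>L (\<mu> n) g"
      proof (rule integral_mono)
        show "integrable (\<mu> n) (?h (Suc k))"
          by (rule bounded_integrable[of _ _ B]) (use \<mu> hc meas minorant_bounded[of g B] g sp in auto)
        show "integrable (\<mu> n) g"
          by (rule bounded_integrable[of _ _ B]) (use \<mu> meas g sp in auto)
        show "?h (Suc k) x \<le> g x" if "x \<in> space (\<mu> n)" for x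
          using minorant_le[of g B x "Suc k"] that g sp by auto
      qed
      with elim show ?case by simp
    qed
  qed
  have neg: "continuous_map path_topology euclideanreal (\<lambda>x. - f x)"
    using f(1) by (rule continuous_map_minus)
  show ?thesis
  proof (rule order_tendstoI)
    fix a assume a: "a < integral\<^sup>L \<nu> f"
    have "\<forall>\<^sub>F n in sequentially. integral\<^sup>L \<nu> f - (integral\<^sup>L \<nu> f - a) < integral\<^sup>L (\<mu> n) f"
      by (rule lower) (use a f B in auto)
    then show "\<forall>\<^sub>F n in sequentially. a < integral\<^sup>L (\<mu> n) f" by simp
  next
    fix a assume a: "integral\<^sup>L \<nu> f < a"
    have "\<forall>\<^sub>F n in sequentially. integral\<^sup>L \<nu> (\<lambda>x. - f x) - (a - integral\<^sup>L \<nu> f) < integral\<^sup>L (\<mu> n) (\<lambda>x. - f x)"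
      by (rule lower[OF neg]) (use a B in auto)
    then show "\<forall>\<^sub>F n in sequentially. integral\<^sup>L (\<mu> n) f < a" by simp
  qed
qed

section \<open>The law of the two-state chain\<close>

definition step_pmf :: "real \<Rightarrow> real \<Rightarrow> int \<Rightarrow> int pmf" where
  "step_pmf a b y = map_pmf (\<lambda>B. if B then 1 else -1) (bernoulli_pmf (if y = -1 then a else 1 - b))"

text \<open>
  The law of \<open>Y\<^sub>1, \<dots>, Y\<^sub>n\<close> given \<open>Y\<^sub>0 = y\<close>, as a distribution on finite lists. Estimates become inductions
  over \<open>n\<close> with finitely supported expectations, and the initial state is an argument, which is what
  the Markov property requires.
\<close>
fun path_pmf :: "real \<Rightarrow> real \<Rightarrow> nat \<Rightarrow> int \<Rightarrow> int list pmf" where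
  "path_pmf a b 0 y = return_pmf []"
| "path_pmf a b (Suc n) y = bind_pmf (step_pmf a b y) (\<lambda>z. map_pmf (Cons z) (path_pmf a b n z))"

abbreviation path_mean :: "real \<Rightarrow> real \<Rightarrow> nat \<Rightarrow> int \<Rightarrow> (int list \<Rightarrow> 'c::{banach, second_countable_topology}) \<Rightarrow> 'c" where
  "path_mean a b n y \<equiv> measure_pmf.expectation (path_pmf a b n y)"

lemma set_step_pmf: "set_pmf (step_pmf a b y) \<subseteq> {-1, 1}"
  by (auto simp: step_pmf_def)

lemma pmf_step_pmf:
  assumes "a \<in> {0..1}" "b \<in> {0..1}" "y \<in> {-1, 1}" "z \<in> {-1, 1}"
  shows "pmf (step_pmf a b y) z = walk_transition a b y z"
proof -
  have inj: "inj (\<lambda>B. if B then 1 else -1 :: int)" by (auto simp: inj_def)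
  have "pmf (step_pmf a b y) z = pmf (bernoulli_pmf (if y = -1 then a else 1 - b)) (z = 1)"
    using pmf_map_inj'[OF inj, of "bernoulli_pmf (if y = -1 then a else 1 - b)" "z = 1"] assms(4)
    by (auto simp: step_pmf_def)
  then show ?thesis using assms by (auto simp: walk_transition_def)
qed

lemma finite_set_path_pmf [simp]: "finite (set_pmf (path_pmf a b n y))"
  by (induction n arbitrary: y) (auto simp: set_bind_pmf intro: finite_subset[OF set_step_pmf])

lemma integrable_path_pmf [simp]:
  fixes h :: "int list \<Rightarrow> 'c::{banach, second_countable_topology}"
  shows "integrable (measure_pmf (path_pmf a b n y)) h"
  by (rule integrable_measure_pmf_finite) simp

lemma set_path_pmf:
  assumes "l \<in> set_pmf (path_pmf a b n y)"
  shows "length l = n" "set l \<subseteq> {-1, 1}"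
  using assms set_step_pmf[of a b]
  by (induction n arbitrary: y l) (fastforce simp: set_bind_pmf)+

lemma expectation_path_Suc:
  fixes h :: "int list \<Rightarrow> 'c::{banach, second_countable_topology}"
  assumes "a \<in> {0..1}" "b \<in> {0..1}" "y \<in> {-1, 1}"
  shows "path_mean a b (Suc n) y h =
    (\<Sum>z\<in>{-1, 1}. walk_transition a b y z *\<^sub>R path_mean a b n z (\<lambda>l. h (z # l)))"
  using assms unfolding path_pmf.simps
  by (subst pmf_expectation_bind[where A = "{-1, 1}"])
    (use set_step_pmf in \<open>auto simp: pmf_step_pmf\<close>)

text \<open>
  The Markov property: after \<open>n\<close> steps the chain starts afresh from its current state.
\<close>
lemma path_pmf_add:
  "path_pmf a b (n + k) y = bind_pmf (path_pmf a b n y) (\<lambda>l. map_pmf (append l) (path_pmf a b k (last (y # l))))"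
proof (induction n arbitrary: y)
  case 0
  have "append [] = (\<lambda>l::int list. l)" by auto
  then show ?case by (simp add: bind_return_pmf map_pmf_ident)
next
  case (Suc n)
  have "append (z # l) = (\<lambda>l'. z # (l @ l'))" for z :: int and l by auto
  with Suc show ?case
    by (simp add: bind_map_pmf bind_assoc_pmf map_bind_pmf pmf.map_comp o_def)
qed

lemma expectation_path_add:
  fixes h :: "int list \<Rightarrow> 'c::{banach, second_countable_topology}"
  shows "path_mean a b (n + k) y h =
    path_mean a b n y
      (\<lambda>l. path_mean a b k (last (y # l)) (\<lambda>l'. h (l @ l')))"
  unfolding path_pmf_add
  by (subst pmf_expectation_bind[where A = "set_pmf (path_pmf a b n y)"])
    (auto simp: integral_measure_pmf[of "set_pmf (path_pmf a b n y)"])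

lemma last_in_states:
  assumes "y \<in> {-1, 1 :: int}" "l \<in> set_pmf (path_pmf a b n y)"
  shows "last (y # l) \<in> {-1, 1}"
proof -
  have "last (y # l) \<in> set (y # l)" by (rule last_in_set) simp
  then show ?thesis using assms set_path_pmf[OF assms(2)] by auto
qed

fun path_weight :: "real \<Rightarrow> real \<Rightarrow> int \<Rightarrow> int list \<Rightarrow> real" where
  "path_weight a b y [] = 1"
| "path_weight a b y (z # l) = walk_transition a b y z * path_weight a b z l"

lemma path_weight_snoc:
  "path_weight a b y (l @ [z]) = path_weight a b y l * walk_transition a b (last (y # l)) z"
  by (induction l arbitrary: y) auto

lemma pmf_path_pmf:
  assumes ab: "a \<in> {0..1}" "b \<in> {0..1}" and "y \<in> {-1, 1}" "set l \<subseteq> {-1, 1}"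
  shows "pmf (path_pmf a b (length l) y) l = path_weight a b y l"
  using assms(3,4)
proof (induction l arbitrary: y)
  case (Cons x l)
  have "pmf (path_pmf a b (length (x # l)) y) (x # l) =
      measure_pmf.expectation (step_pmf a b y) (\<lambda>z. pmf (map_pmf (Cons z) (path_pmf a b (length l) z)) (x # l))"
    by (simp add: pmf_bind)
  also have "\<dots> = (\<Sum>z\<in>{-1, 1}. pmf (map_pmf (Cons z) (path_pmf a b (length l) z)) (x # l) * pmf (step_pmf a b y) z)"
    using set_step_pmf by (subst integral_measure_pmf_real[of "{-1, 1}"]) auto
  also have "\<dots> = (\<Sum>z\<in>{-1, 1}. if z = x then pmf (path_pmf a b (length l) x) l * walk_transition a b y x else 0)"
  proof (rule sum.cong[OF refl])
    fix z :: int assume z: "z \<in> {-1, 1}"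
    show "pmf (map_pmf (Cons z) (path_pmf a b (length l) z)) (x # l) * pmf (step_pmf a b y) z
      = (if z = x then pmf (path_pmf a b (length l) x) l * walk_transition a b y x else 0)"
    proof (cases "z = x")
      case True
      have "pmf (map_pmf (Cons x) (path_pmf a b (length l) x)) (x # l) = pmf (path_pmf a b (length l) x) l"
        by (rule pmf_map_inj') (auto simp: inj_def)
      then show ?thesis using True Cons.prems by (simp add: pmf_step_pmf[OF ab])
    next
      case False
      then have "x # l \<notin> set_pmf (map_pmf (Cons z) (path_pmf a b (length l) z))" by auto
      then have "pmf (map_pmf (Cons z) (path_pmf a b (length l) z)) (x # l) = 0" by (simp only: set_pmf_iff not_not)
      then show ?thesis using False by simp
    qed
  qed
  also have "\<dots> = path_weight a b y (x # l)" using Cons by auto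
  finally show ?case .
qed simp

text \<open>
  If the prefix has probability zero, the conditional probability in \<^const>\<open>markov_chain\<close> gives no
  information, but then both sides vanish by monotonicity.
\<close>
lemma markov_chain_path_prob:
  assumes mc: "markov_chain M {-1, 1} (walk_transition a b) Y"
    and y: "\<And>\<omega>. \<omega> \<in> space M \<Longrightarrow> Y 0 \<omega> = y" "y \<in> {-1, 1}"
    and x: "x 0 = y" "\<And>i. x i \<in> {-1, 1}"
  shows "\<P>(\<omega> in M. \<forall>i\<le>n. Y i \<omega> = x i) = path_weight a b y (map (\<lambda>i. x (Suc i)) [0..<n])"
proof (induction n)
  case 0
  interpret prob_space M using mc by (simp add: markov_chain_def)
  have "{\<omega> \<in> space M. \<forall>i\<le>0. Y i \<omega> = x i} = space M" using y x by auto
  then show ?case by (simp add: prob_space)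
next
  case (Suc n)
  interpret prob_space M using mc by (simp add: markov_chain_def)
  have [measurable]: "Y i \<in> M \<rightarrow>\<^sub>M count_space {-1, 1}" for i using mc by (simp add: markov_chain_def)
  let ?A = "\<lambda>n. {\<omega> \<in> space M. \<forall>i\<le>n. Y i \<omega> = x i}"
  have ev: "?A n \<in> events" for n
  proof -
    have "?A n = {\<omega> \<in> space M. \<forall>i\<in>{..n}. Y i \<omega> \<in> {x i}}" by auto
    also have "\<dots> \<in> events"
    proof (rule sets.sets_Collect_finite_All)
      fix i assume "i \<in> {..n}"
      have "Y i -` {x i} \<inter> space M \<in> events"
        by (rule measurable_sets[of "Y i" M "count_space {-1, 1}"]) (use x in auto)
      then show "{\<omega> \<in> space M. Y i \<omega> \<in> {x i}} \<in> events"
        by (simp add: vimage_def Int_def conj_commute)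
    qed simp
    finally show ?thesis .
  qed
  have Aeq: "{\<omega> \<in> space M. Y (Suc n) \<omega> = x (Suc n) \<and> (\<forall>i\<le>n. Y i \<omega> = x i)} = ?A (Suc n)"
    by (auto simp: le_Suc_eq)
  have lst: "last (y # map (\<lambda>i. x (Suc i)) [0..<n]) = x n"
    using x(1) by (cases n) (auto simp: last_map)
  have "prob (?A (Suc n)) = prob (?A n) * walk_transition a b (x n) (x (Suc n))"
  proof (cases "prob (?A n) > 0")
    case True
    then have "\<P>(\<omega> in M. Y (Suc n) \<omega> = x (Suc n) \<bar> \<forall>i\<le>n. Y i \<omega> = x i) = walk_transition a b (x n) (x (Suc n))"
      using mc x(2) unfolding markov_chain_def by blast
    then show ?thesis using True unfolding cond_prob_def Aeq by (simp add: field_simps)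
  next
    case False
    then have "prob (?A n) = 0" using measure_nonneg[of M "?A n"] by linarith
    moreover have "prob (?A (Suc n)) \<le> prob (?A n)" by (rule finite_measure_mono) (auto simp: ev)
    ultimately show ?thesis using measure_nonneg[of M "?A (Suc n)"] by simp
  qed
  then show ?case using Suc by (simp add: path_weight_snoc lst del: last.simps)
qed

lemma markov_chain_law:
  assumes mc: "markov_chain M {-1, 1} (walk_transition a b) Y"
    and ab: "a \<in> {0..1}" "b \<in> {0..1}"
    and y: "\<And>\<omega>. \<omega> \<in> space M \<Longrightarrow> Y 0 \<omega> = y" "y \<in> {-1, 1}"
  shows "(\<lambda>\<omega>. map (\<lambda>i. Y (Suc i) \<omega>) [0..<n]) \<in> M \<rightarrow>\<^sub>M count_space UNIV"
    and "distr M (count_space UNIV) (\<lambda>\<omega>. map (\<lambda>i. Y (Suc i) \<omega>) [0..<n]) = measure_pmf (path_pmf a b n y)"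
proof -
  interpret prob_space M using mc by (simp add: markov_chain_def)
  let ?l = "\<lambda>\<omega>. map (\<lambda>i. Y (Suc i) \<omega>) [0..<n]"
  have mY: "Y i \<in> M \<rightarrow>\<^sub>M count_space {-1, 1}" for i using mc by (simp add: markov_chain_def)
  have Yin: "Y i \<omega> \<in> {-1, 1}" if "\<omega> \<in> space M" for i \<omega> using measurable_space[OF mY that] by simp
  let ?x = "\<lambda>l i. if i = 0 then y else if i \<le> n then l ! (i - 1) else 1"
  have form: "?l -` {l} \<inter> space M = (if length l = n \<and> set l \<subseteq> {-1, 1}
      then {\<omega> \<in> space M. \<forall>i\<le>n. Y i \<omega> = ?x l i} else {})" for l
  proof -
    have iff: "?l \<omega> = l \<longleftrightarrow> length l = n \<and> (\<forall>i\<le>n. Y i \<omega> = ?x l i)"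
      if "\<omega> \<in> space M" for \<omega>
    proof -
      have "?l \<omega> = l \<longleftrightarrow> length l = n \<and> (\<forall>i<n. Y (Suc i) \<omega> = l ! i)"
        by (auto simp: list_eq_iff_nth_eq)
      also have "(\<forall>i<n. Y (Suc i) \<omega> = l ! i) \<longleftrightarrow>
          (\<forall>i\<le>n. Y i \<omega> = ?x l i)"
      proof (intro iffI allI impI)
        fix i assume a: "\<forall>i<n. Y (Suc i) \<omega> = l ! i" "i \<le> n"
        show "Y i \<omega> = ?x l i"
          using a y(1)[OF that] by (cases i) auto
      next
        fix i assume a: "\<forall>i\<le>n. Y i \<omega> = ?x l i" "i < n"
        then show "Y (Suc i) \<omega> = l ! i" by (auto dest: spec[of _ "Suc i"])
      qed
      finally show ?thesis .
    qed
    have sub: "set (?l \<omega>) \<subseteq> {-1, 1}" if "\<omega> \<in> space M" for \<omega> using Yin[OF that] by auto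
    define L where "L = ?l"
    define Q where "Q = (\<lambda>\<omega>. \<forall>i\<le>n. Y i \<omega> = ?x l i)"
    have L: "L \<omega> = l \<longleftrightarrow> length l = n \<and> Q \<omega>" "set (L \<omega>) \<subseteq> {-1, 1}"
      if "\<omega> \<in> space M" for \<omega> using iff[OF that] sub[OF that] unfolding L_def Q_def .
    have "L -` {l} \<inter> space M = (if length l = n \<and> set l \<subseteq> {-1, 1} then {\<omega> \<in> space M. Q \<omega>} else {})"
    proof (cases "length l = n \<and> set l \<subseteq> {-1, 1}")
      case True
      have "\<omega> \<in> L -` {l} \<inter> space M \<longleftrightarrow> \<omega> \<in> space M \<and> Q \<omega>" for \<omega>
        using L(1)[of \<omega>] True by (cases "\<omega> \<in> space M") simp_all
      then have "L -` {l} \<inter> space M = {\<omega> \<in> space M. Q \<omega>}" by (intro set_eqI) simp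
      then show ?thesis by (simp only: if_P[OF True])
    next
      case False
      have "L \<omega> \<noteq> l" if "\<omega> \<in> space M" for \<omega> 
      proof
        assume "L \<omega> = l"
        then show False using False L[OF that] by simp
      qed
      then have "L -` {l} \<inter> space M = {}" by blast
      then show ?thesis by (simp only: if_not_P[OF False])
    qed
    then show ?thesis by (simp only: L_def Q_def)
  qed
  have evs: "?l -` {l} \<inter> space M \<in> events" for l
  proof (cases "length l = n")
    case True
    have "?l \<omega> = l \<longleftrightarrow> (\<forall>i\<in>{..<n}. Y (Suc i) \<omega> = l ! i)" for \<omega>
      using True by (auto simp: list_eq_iff_nth_eq)
    then have "?l -` {l} \<inter> space M = {\<omega> \<in> space M. \<forall>i\<in>{..<n}. Y (Suc i) \<omega> = l ! i}" by blast
    also have "\<dots> \<in> events"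
    proof (rule sets.sets_Collect_finite_All)
      fix i
      have "Y (Suc i) -` ({l ! i} \<inter> {-1, 1}) \<inter> space M \<in> events" by (rule measurable_sets[OF mY]) simp
      also have "Y (Suc i) -` ({l ! i} \<inter> {-1, 1}) \<inter> space M = {\<omega> \<in> space M. Y (Suc i) \<omega> = l ! i}"
        using Yin[of _ "Suc i"] by fastforce
      finally show "{\<omega> \<in> space M. Y (Suc i) \<omega> = l ! i} \<in> events" .
    qed simp
    finally show ?thesis .
  next
    case False
    then have "?l -` {l} \<inter> space M = {}" by auto
    then show ?thesis by simp
  qed
  show meas: "?l \<in> M \<rightarrow>\<^sub>M count_space UNIV"
    using evs by (simp add: measurable_count_space_eq_countable)
  show "distr M (count_space UNIV) ?l = measure_pmf (path_pmf a b n y)"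
  proof (rule measure_eqI_countable[where A = UNIV])
    fix l :: "int list" assume "l \<in> UNIV"
    have "emeasure (distr M (count_space UNIV) ?l) {l} = ennreal (prob (?l -` {l} \<inter> space M))"
      by (subst emeasure_distr[OF meas]) (auto simp: emeasure_eq_measure)
    also have "prob (?l -` {l} \<inter> space M) = pmf (path_pmf a b n y) l"
    proof (cases "length l = n \<and> set l \<subseteq> {-1, 1}")
      case True
        have "?x l i \<in> {-1, 1}" for i
      proof (cases "i = 0 \<or> i > n")
        case False
        then have "l ! (i - 1) \<in> set l" using True by (intro nth_mem) auto
        then show ?thesis using True False by auto
      qed (use y(2) in auto)
      then have "\<P>(\<omega> in M. \<forall>i\<le>n. Y i \<omega> = ?x l i) = path_weight a b y (map (\<lambda>i. ?x l (Suc i)) [0..<n])"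
        by (intro markov_chain_path_prob[OF mc y]) auto
      also have "map (\<lambda>i. ?x l (Suc i)) [0..<n] = l" using True by (auto simp: list_eq_iff_nth_eq)
      also have "path_weight a b y l = pmf (path_pmf a b n y) l" using pmf_path_pmf[OF ab y(2), of l] True by simp
      finally show ?thesis using True by (simp add: form)
    next
      case False
      then have "l \<notin> set_pmf (path_pmf a b n y)" using set_path_pmf by blast
      then have "pmf (path_pmf a b n y) l = 0" by (simp only: set_pmf_iff not_not)
      then show ?thesis unfolding form if_not_P[OF False] by simp
    qed
    also have "ennreal (pmf (path_pmf a b n y) l) = emeasure (path_pmf a b n y) {l}" by (simp add: emeasure_pmf_single)
    finally show "emeasure (distr M (count_space UNIV) ?l) {l} = emeasure (path_pmf a b n y) {l}" .
  qed auto
qed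

section \<open>The martingale of the walk and a maximal inequality\<close>

text \<open>
  Mean of the stationary law, which gives the states \<open>-1\<close> and \<open>1\<close> the masses \<open>b / (a + b)\<close> and
  \<open>a / (a + b)\<close>.
\<close>
definition stationary_mean :: "real \<Rightarrow> real \<Rightarrow> real" where
  "stationary_mean a b = (a - b) / (a + b)"

text \<open>
  The martingale \<open>x + \<Sum>D\<^sub>i\<close> along a trajectory, where \<open>D\<close> is the deviation of the next state from its
  conditional mean if \<open>m\<close> is the stationary mean and \<open>\<rho> = 1 - a - b\<close>.
\<close>
fun walk_martingale :: "real \<Rightarrow> real \<Rightarrow> real \<Rightarrow> int \<Rightarrow> int list \<Rightarrow> real" where
  "walk_martingale m \<rho> x y [] = x"
| "walk_martingale m \<rho> x y (z # l) = walk_martingale m \<rho> (x + (z - m - \<rho> * (y - m))) z l"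

definition centered_sum :: "real \<Rightarrow> int list \<Rightarrow> real" where
  "centered_sum m l = (\<Sum>z\<leftarrow>l. real_of_int z - m)"

text \<open>
  The telescoping identity that solves the Poisson equation of the chain: the centred sum and the
  martingale differ by a factor and a bounded boundary term.
\<close>
lemma walk_martingale_centered_sum: "walk_martingale m \<rho> x y l = x + (1 - \<rho>) * centered_sum m l + \<rho> * (last (y # l) - y)"
proof (induction l arbitrary: x y)
  case (Cons z l)
  show ?case unfolding walk_martingale.simps Cons.IH by (simp add: centered_sum_def algebra_simps)
qed (simp add: centered_sum_def)

lemma stationary_mean_bounds:
  assumes "a \<in> {0..1}" "b \<in> {0..1}" "a + b > 0"
  shows "\<bar>stationary_mean a b\<bar> \<le> 1"
  using assms by (auto simp: stationary_mean_def abs_le_iff field_simps)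

lemma sum_over_states: "(\<Sum>z\<in>{-1, 1::int}. f z) = f (-1) + f 1"
  by simp

lemma transition_sum:
  assumes "y \<in> {-1, 1}"
  shows "walk_transition a b y (-1) + walk_transition a b y 1 = 1"
  using assms by (auto simp: walk_transition_def)

lemma transition_nonneg:
  assumes "a \<in> {0..1}" "b \<in> {0..1}"
  shows "walk_transition a b y z \<ge> 0"
  using assms by (auto simp: walk_transition_def)

lemma transition_mean:
  assumes "y \<in> {-1, 1}" "a + b \<noteq> 0"
  shows "walk_transition a b y (-1) * (-1 - stationary_mean a b) + walk_transition a b y 1 * (1 - stationary_mean a b)
    = (1 - a - b) * (y - stationary_mean a b)"
proof -
  have m: "(a + b) * stationary_mean a b = a - b" using assms by (simp add: stationary_mean_def)
  show ?thesis
  proof (cases "y = -1")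
    case True
    then show ?thesis using m by (simp add: walk_transition_def algebra_simps)
  next
    case False
    then show ?thesis using m assms by (simp add: walk_transition_def algebra_simps)
  qed
qed

lemma ex_le_Suc_iff: "(\<exists>k\<le>Suc n. P k) \<longleftrightarrow> P 0 \<or> (\<exists>k\<le>n. P (Suc k))"
  by (metis Suc_le_mono le0 not0_implies_Suc)

text \<open>
  First-step analysis. The right-hand side dominates \<open>1\<close> as soon as \<open>\<bar>x\<bar> \<ge> e\<close>, and averaging it over one
  step from \<open>x\<close> does not exceed its value with \<open>n + 1\<close> in place of \<open>n\<close>. The induction therefore yields
  the fourth-moment bound and Doob's inequality at the same time. The constants come
  from \<open>\<bar>D\<bar> \<le> 4\<close>: one step adds at most \<open>224 x\<^sup>2 + 768 + 3584 n\<close> to the polynomial, and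
  \<open>1792 ((n + 1)\<^sup>2 - n\<^sup>2)\<close> absorbs the last two terms.
\<close>
lemma maximal_inequality:
  assumes ab: "a \<in> {0..1}" "b \<in> {0..1}" "a + b > 0" and e: "e > 0" and y: "y \<in> {-1, 1}"
  shows "path_mean a b n y
      (\<lambda>l. of_bool (\<exists>k\<le>n. \<bar>walk_martingale (stationary_mean a b) (1 - a - b) x y (take k l)\<bar> \<ge> e) :: real)
    \<le> (x^4 + 224 * n * x\<^sup>2 + 1792 * n\<^sup>2) / e^4"
  using y
proof (induction n arbitrary: x y)
  case 0
  have "\<bar>x\<bar> \<ge> e \<Longrightarrow> x^4 \<ge> e^4" using power_mono[of e "\<bar>x\<bar>" 4] e by (simp add: power_abs)
  then show ?case using e by (simp add: of_bool_def)
next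
  case (Suc n)
  define m where "m = stationary_mean a b"
  define \<rho> where "\<rho> = 1 - a - b"
  let ?M = "walk_martingale m \<rho>"
  let ?E = "\<lambda>n y. path_mean a b n y"
  define G where "G = (\<lambda>n x::real. x^4 + 224 * real n * x\<^sup>2 + 1792 * (real n)\<^sup>2)"
  have IH: "?E n z (\<lambda>l. of_bool (\<exists>k\<le>n. \<bar>?M x z (take k l)\<bar> \<ge> e)) \<le> G n x / e^4" if "z \<in> {-1, 1}" for x z
    using Suc.IH[OF that, of x] by (simp add: m_def \<rho>_def G_def)
  have "?E (Suc n) y (\<lambda>l. of_bool (\<exists>k\<le>Suc n. \<bar>?M x y (take k l)\<bar> \<ge> e)) \<le> G (Suc n) x / e^4"
  proof (cases "\<bar>x\<bar> \<ge> e")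
    case True
    have "?E (Suc n) y (\<lambda>l. of_bool (\<exists>k\<le>Suc n. \<bar>?M x y (take k l)\<bar> \<ge> e) :: real) \<le> ?E (Suc n) y (\<lambda>l. 1)"
      by (intro integral_mono) (auto simp del: path_pmf.simps)
    also have "\<dots> = 1" by simp
    also have "1 \<le> G (Suc n) x / e^4"
    proof -
      have "e^4 \<le> x^4" using power_mono[of e "\<bar>x\<bar>" 4] e True by (simp add: power_abs)
      also have "\<dots> \<le> G (Suc n) x" by (simp add: G_def)
      finally show ?thesis using e by simp
    qed
    finally show ?thesis .
  next
    case False
    define D where "D = (\<lambda>z::int. z - m - \<rho> * (y - m))"
    define P where "P = walk_transition a b y"
    have ex: "(\<exists>k\<le>Suc n. e \<le> \<bar>?M x y (take k (z # l))\<bar>) \<longleftrightarrow> (\<exists>k\<le>n. e \<le> \<bar>?M (x + D z) z (take k l)\<bar>)" for z l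
      unfolding ex_le_Suc_iff using False by (simp add: D_def)
    have "?E (Suc n) y (\<lambda>l. of_bool (\<exists>k\<le>Suc n. \<bar>?M x y (take k l)\<bar> \<ge> e))
        = (\<Sum>z\<in>{-1, 1}. P z * ?E n z (\<lambda>l. of_bool (\<exists>k\<le>n. e \<le> \<bar>?M (x + D z) z (take k l)\<bar>)))"
      by (subst expectation_path_Suc[OF ab(1,2) Suc.prems]) (simp only: ex P_def real_scaleR_def)
    also have "\<dots> \<le> (\<Sum>z\<in>{-1, 1}. P z * (G n (x + D z) / e^4))"
      using IH transition_nonneg[OF ab(1,2)] by (intro sum_mono mult_left_mono) (auto simp: P_def)
    also have "\<dots> = (\<Sum>z\<in>{-1, 1}. P z * G n (x + D z)) / e^4" by (simp add: add_divide_distrib)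
    also have "\<dots> \<le> G (Suc n) x / e^4"
    proof (intro divide_right_mono)
      have P1: "P (-1) + P 1 = 1" using transition_sum Suc.prems by (simp add: P_def)
      have PD: "P (-1) * D (-1) + P 1 * D 1 = 0"
      proof -
        have "P (-1) * D (-1) + P 1 * D 1 = P (-1) * (-1 - m) + P 1 * (1 - m) - (P (-1) + P 1) * (\<rho> * (y - m))"
          by (simp add: D_def algebra_simps)
        also have "\<dots> = 0" unfolding P1 unfolding P_def m_def \<rho>_def
          using transition_mean[OF Suc.prems, of a b] ab by simp
        finally show ?thesis .
      qed
      have m1: "\<bar>m\<bar> \<le> 1" using stationary_mean_bounds ab by (simp add: m_def)
      have r1: "\<bar>\<rho>\<bar> \<le> 1" using ab by (auto simp: \<rho>_def)
      have Db: "\<bar>D z\<bar> \<le> 4" if "z \<in> {-1, 1}" for z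
      proof -
        have "\<bar>real_of_int y - m\<bar> \<le> 2" "\<bar>real_of_int z - m\<bar> \<le> 2" using m1 that Suc.prems by auto
        moreover from this r1 have "\<bar>\<rho> * (y - m)\<bar> \<le> 1 * 2" unfolding abs_mult by (intro mult_mono) auto
        ultimately show ?thesis unfolding D_def by linarith
      qed
      have pt: "G n (x + D z) \<le> x^4 + (4 * x^3 + 448 * n * x) * D z + (224 * n + 224) * x\<^sup>2 + 768 + 3584 * n + 1792 * n\<^sup>2"
        if z: "z \<in> {-1, 1}" for z
      proof -
        define d where "d = D z"
        have d2: "d\<^sup>2 \<le> 16" using Db[OF z] power_mono[of "\<bar>d\<bar>" 4 2] by (simp add: d_def)
        have d4: "d^4 \<le> 256" using power_mono[OF d2, of 2] by simp
        have x2d2: "x\<^sup>2 * d\<^sup>2 \<le> x\<^sup>2 * 16" using d2 by (intro mult_left_mono) auto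
        \<comment> \<open>The odd cross term is split between the terms \<open>x\<^sup>2 d\<^sup>2\<close> and \<open>d\<^sup>4\<close>.\<close>
        have xd3: "2 * (x * d^3) \<le> x\<^sup>2 * d\<^sup>2 + d^4"
        proof -
          have "0 \<le> (x * d - d\<^sup>2)\<^sup>2" by simp
          then show ?thesis by (simp add: power2_eq_square power4_eq_xxxx power3_eq_cube algebra_simps)
        qed
        have nd2: "real n * d\<^sup>2 \<le> real n * 16" using d2 by (intro mult_left_mono) auto
        have "G n (x + d) = x^4 + (4 * x^3 + 448 * n * x) * d + 6 * (x\<^sup>2 * d\<^sup>2) + 4 * (x * d^3) + d^4
            + 224 * n * x\<^sup>2 + 224 * (real n * d\<^sup>2) + 1792 * (real n)\<^sup>2"
          by (simp add: G_def power2_eq_square power4_eq_xxxx power3_eq_cube algebra_simps)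
        also have "\<dots> \<le> x^4 + (4 * x^3 + 448 * n * x) * d + (224 * n + 224) * x\<^sup>2 + 768 + 3584 * n + 1792 * n\<^sup>2"
        proof -
          have lin: "6 * p + 4 * q + r + 224 * s \<le> 224 * u + 768 + 3584 * w"
            if "p \<le> u * 16" "2 * q \<le> p + r" "r \<le> 256" "s \<le> w * 16" "0 \<le> u" for p q r s u w :: real
            using that by linarith
          show ?thesis using lin[OF x2d2 xd3 d4 nd2 zero_le_power2] by (simp add: algebra_simps)
        qed
        finally show ?thesis by (simp add: d_def)
      qed
      let ?c = "4 * x^3 + 448 * n * x" and ?k = "x^4 + (224 * n + 224) * x\<^sup>2 + 768 + 3584 * n + 1792 * (real n)\<^sup>2"
      have "(\<Sum>z\<in>{-1, 1}. P z * G n (x + D z)) \<le> (\<Sum>z\<in>{-1, 1}. P z * (?k + ?c * D z))"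
        using pt transition_nonneg[OF ab(1,2)] by (intro sum_mono mult_left_mono) (auto simp: P_def algebra_simps)
      also have "\<dots> = (P (-1) + P 1) * ?k + (P (-1) * D (-1) + P 1 * D 1) * ?c"
        by (simp add: algebra_simps)
      also have "\<dots> = ?k" unfolding P1 PD by simp
      also have "\<dots> \<le> G (Suc n) x" by (simp add: G_def power2_eq_square algebra_simps)
      finally show "(\<Sum>z\<in>{-1, 1}. P z * G n (x + D z)) \<le> G (Suc n) x" .
    qed (use e in simp)
    finally show ?thesis .
  qed
  then show ?case by (simp only: G_def m_def \<rho>_def)
qed

text \<open>
  With \<open>n d\<^sup>2\<close> of order \<open>\<delta>\<close> this probability is of order \<open>\<delta>\<^sup>2\<close>, which stays small after summation over
  \<open>1 / \<delta>\<close> cells. The last condition on \<open>d\<close> ensures that the boundary term of the martingale uses up at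
  most half of the threshold.
\<close>
lemma centered_sum_maximal:
  assumes ab: "a \<in> {0..1}" "b \<in> {0..1}" and \<kappa>: "0 < \<kappa>" "\<kappa> \<le> a + b" and y: "y \<in> {-1, 1}"
    and d: "d > 0" "e > 0" "4 * d \<le> \<kappa> * e"
  shows "path_mean a b n y
      (\<lambda>l. of_bool (\<exists>k\<le>n. d * \<bar>centered_sum (stationary_mean a b) (take k l)\<bar> > e) :: real)
    \<le> 1792 * (real n * d\<^sup>2)\<^sup>2 / (\<kappa> * e / 2)^4"
proof -
  let ?m = "stationary_mean a b" and ?\<rho> = "1 - a - b"
  define h where "h = \<kappa> * e / (2 * d)"
  have h: "h > 0" using \<kappa> d by (simp add: h_def)
  have "path_mean a b n y (\<lambda>l. of_bool (\<exists>k\<le>n. d * \<bar>centered_sum ?m (take k l)\<bar> > e) :: real)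
    \<le> path_mean a b n y (\<lambda>l. of_bool (\<exists>k\<le>n. \<bar>walk_martingale ?m ?\<rho> 0 y (take k l)\<bar> \<ge> h))"
  proof (rule integral_mono_AE)
    show "AE l in path_pmf a b n y. (of_bool (\<exists>k\<le>n. d * \<bar>centered_sum ?m (take k l)\<bar> > e) :: real)
       \<le> of_bool (\<exists>k\<le>n. \<bar>walk_martingale ?m ?\<rho> 0 y (take k l)\<bar> \<ge> h)"
    proof (rule AE_pmfI)
      fix l assume l: "l \<in> set_pmf (path_pmf a b n y)"
      have "\<bar>walk_martingale ?m ?\<rho> 0 y (take k l)\<bar> \<ge> h" if k: "d * \<bar>centered_sum ?m (take k l)\<bar> > e" for k
      proof -
        let ?c = "centered_sum ?m (take k l)" and ?z = "last (y # take k l)"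
        have "?z \<in> set (y # take k l)" by (rule last_in_set) simp
        then have "?z \<in> {-1, 1}" using y set_path_pmf(2)[OF l] set_take_subset[of k l] by auto
        then have "\<bar>real_of_int (?z - y)\<bar> \<le> 2" using y by auto
        then have "\<bar>?\<rho> * (?z - y)\<bar> \<le> 1 * 2" unfolding abs_mult using ab by (intro mult_mono) auto
        moreover have "\<bar>(1 - ?\<rho>) * ?c\<bar> \<ge> \<kappa> * \<bar>?c\<bar>" unfolding abs_mult using \<kappa> by (intro mult_right_mono) auto
        moreover have "\<kappa> * \<bar>?c\<bar> \<ge> 2 * h"
        proof -
          have "e / d \<le> \<bar>?c\<bar>" using k d by (simp add: field_simps)
          then have "\<kappa> * (e / d) \<le> \<kappa> * \<bar>?c\<bar>" using \<kappa> by (intro mult_left_mono) auto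
          then show ?thesis using d by (simp add: h_def field_simps)
        qed
        moreover have "2 \<le> h" using d by (simp add: h_def field_simps)
        ultimately show ?thesis unfolding walk_martingale_centered_sum by linarith
      qed
      then show "(of_bool (\<exists>k\<le>n. d * \<bar>centered_sum ?m (take k l)\<bar> > e) :: real)
       \<le> of_bool (\<exists>k\<le>n. \<bar>walk_martingale ?m ?\<rho> 0 y (take k l)\<bar> \<ge> h)" by auto
    qed
  qed simp_all
  also have "\<dots> \<le> 1792 * (real n)\<^sup>2 / h^4"
    using maximal_inequality[OF ab _ h y, of n 0] \<kappa> by simp
  also have "\<dots> = 1792 * (real n * d\<^sup>2)\<^sup>2 / (\<kappa> * e / 2)^4"
    using d \<kappa> by (simp add: h_def power_mult_distrib power_divide field_simps flip: power_mult)
  finally show ?thesis .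
qed

section \<open>Characteristic function of the centred walk\<close>

definition asymptotic_variance :: "real \<Rightarrow> real \<Rightarrow> real" where
  "asymptotic_variance a b = (2 - a - b) / (a + b) * (1 - (stationary_mean a b)\<^sup>2)"

text \<open>
  Product of the second-order expansion of the exponential with the trial eigenvector, averaged over
  two points, minus eigenvalue times eigenvector, sorted by powers of \<open>E = \<i> e\<close>. The approximate
  eigenvector is determined by the vanishing of the coefficients up to order two.
\<close>
lemma two_point_expansion:
  fixes P1 P2 u1 u2 u0 A B S E :: complex
  shows "P1 * ((1 + E * u1 + E\<^sup>2 * u1\<^sup>2 / 2) * (1 + E * A * u1 - E\<^sup>2 * B * u1))
      + P2 * ((1 + E * u2 + E\<^sup>2 * u2\<^sup>2 / 2) * (1 + E * A * u2 - E\<^sup>2 * B * u2))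
      - (1 + E\<^sup>2 * S / 2) * (1 + E * A * u0 - E\<^sup>2 * B * u0)
    = (P1 + P2 - 1) + E * ((1 + A) * (P1 * u1 + P2 * u2) - A * u0)
      + E\<^sup>2 * ((1/2 + A) * (P1 * u1\<^sup>2 + P2 * u2\<^sup>2) - B * (P1 * u1 + P2 * u2) - S / 2 + B * u0)
      + E^3 * (P1 * (A * u1^3 / 2 - B * u1\<^sup>2) + P2 * (A * u2^3 / 2 - B * u2\<^sup>2) - S / 2 * A * u0)
      + E^4 * (S / 2 * B * u0 - P1 * (B * u1^3 / 2) - P2 * (B * u2^3 / 2))"
  by (simp add: power2_eq_square power3_eq_cube power4_eq_xxxx algebra_simps add_divide_distrib)

lemma transition_second_moment:
  assumes "y \<in> {-1, 1}" "a + b \<noteq> 0"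
  shows "walk_transition a b y (-1) * (-1 - stationary_mean a b)\<^sup>2 + walk_transition a b y 1 * (1 - stationary_mean a b)\<^sup>2
    = (1 - (stationary_mean a b)\<^sup>2) - 2 * stationary_mean a b * ((1 - a - b) * (y - stationary_mean a b))"
proof -
  let ?m = "stationary_mean a b" and ?P = "walk_transition a b y"
  have "?P (-1) * (-1 - ?m)\<^sup>2 + ?P 1 * (1 - ?m)\<^sup>2
     = (?P (-1) + ?P 1) * (1 - ?m\<^sup>2) - 2 * ?m * (?P (-1) * (-1 - ?m) + ?P 1 * (1 - ?m))"
    by (simp add: power2_eq_square algebra_simps)
  then show ?thesis using transition_sum[OF assms(1)] transition_mean[OF assms] by simp
qed

lemma iexp_second_order:
  "cmod (iexp x - (1 + \<i> * x + (\<i> * x)\<^sup>2 / 2)) \<le> \<bar>x\<bar>^3 / 6"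
  using iexp_approx1[of x 2] by (simp add: numeral_2_eq_2 numeral_3_eq_3 fact_numeral)

lemma exp_second_order: "0 \<le> x \<Longrightarrow> \<bar>(1 - x) - exp (- x)\<bar> \<le> x\<^sup>2" for x :: real
proof -
  assume x: "0 \<le> x"
  have "1 - x \<le> exp (- x)" using exp_ge_add_one_self[of "-x"] by simp
  moreover have "exp (- x) \<le> 1 - x + x\<^sup>2"
  proof -
    have "1 \<le> (1 + x) * (1 - x + x\<^sup>2)" using x by (simp add: power2_eq_square algebra_simps)
    also have "\<dots> \<le> exp x * (1 - x + x\<^sup>2)"
    proof (intro mult_right_mono)
      have "0 \<le> (1 - x)\<^sup>2 + x" using x by simp
      then show "0 \<le> 1 - x + x\<^sup>2" by (simp add: power2_eq_square algebra_simps)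
    qed (use exp_ge_add_one_self[of x] in simp)
    finally have "exp (- x) * 1 \<le> exp (- x) * (exp x * (1 - x + x\<^sup>2))" by (intro mult_left_mono) auto
    also have "\<dots> = 1 - x + x\<^sup>2" by (simp add: exp_minus)
    finally show ?thesis by simp
  qed
  ultimately show ?thesis by simp
qed

text \<open>
  With \<open>u = z - m\<close> the conditional mean of \<open>u\<close> after one step is \<open>\<rho> u\<close>. The first-order condition for an
  eigenvector \<open>1 + E A u - E\<^sup>2 B u\<close> is therefore \<open>(1 + A) \<rho> = A\<close>. The second-order condition then fixes both
  \<open>B\<close> and the eigenvalue \<open>1 + E\<^sup>2 \<sigma>\<^sup>2 / 2\<close>, where \<open>\<sigma>\<^sup>2\<close> is the asymptotic variance.
\<close>
definition eigvec_coeff1 :: "real \<Rightarrow> real \<Rightarrow> real" where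
  "eigvec_coeff1 a b = (1 - a - b) / (a + b)"
definition eigvec_coeff2 :: "real \<Rightarrow> real \<Rightarrow> real" where
  "eigvec_coeff2 a b = (2 - a - b) / (a + b) * stationary_mean a b * eigvec_coeff1 a b"
definition eigvec :: "real \<Rightarrow> real \<Rightarrow> real \<Rightarrow> int \<Rightarrow> complex" where
  "eigvec a b e z = 1 + (\<i> * e) * eigvec_coeff1 a b * of_real (z - stationary_mean a b)
      - (\<i> * e)\<^sup>2 * eigvec_coeff2 a b * of_real (z - stationary_mean a b)"

text \<open>
  Sum of the bounds for all terms of order at least three, in terms of an upper bound \<open>v\<close> for
  \<open>1 / (a + b)\<close>.
\<close>
definition err_const :: "real \<Rightarrow> real" where
  "err_const v = 2 * (1 + 2 * v + 4 * v\<^sup>2) + 4 * v + 18 * v\<^sup>2 + 4 * v^3"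

context
  fixes a b \<kappa> v :: real
  assumes ab: "a \<in> {0..1}" "b \<in> {0..1}" and \<kappa>: "0 < \<kappa>" "\<kappa> \<le> a + b" and v: "v = 1 / \<kappa>"
begin

lemma q_bounds: "0 < a + b" "1 / (a + b) \<le> v" "0 < v" "0 < 1 / (a + b)"
  using \<kappa> by (auto simp: v frac_le)

lemma coeff_bounds:
  "\<bar>eigvec_coeff1 a b\<bar> \<le> v" "\<bar>eigvec_coeff2 a b\<bar> \<le> 2 * v\<^sup>2"
  "0 \<le> asymptotic_variance a b" "asymptotic_variance a b \<le> 2 * v"
proof -
  have r: "\<bar>1 - a - b\<bar> \<le> 1" "0 \<le> 2 - a - b" "2 - a - b \<le> 2" using ab by auto
  have m: "\<bar>stationary_mean a b\<bar> \<le> 1" using stationary_mean_bounds ab q_bounds(1) by blast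
  have "\<bar>eigvec_coeff1 a b\<bar> = \<bar>1 - a - b\<bar> * (1 / (a + b))" using q_bounds by (simp add: eigvec_coeff1_def abs_divide)
  also have "\<dots> \<le> 1 * v" using r q_bounds by (intro mult_mono) auto
  finally show A: "\<bar>eigvec_coeff1 a b\<bar> \<le> v" by simp
  have q: "0 \<le> (2 - a - b) / (a + b)" "(2 - a - b) / (a + b) \<le> 2 * v"
  proof -
    have "(2 - a - b) * (1 / (a + b)) \<le> 2 * v" using r q_bounds by (intro mult_mono) auto
    then show "(2 - a - b) / (a + b) \<le> 2 * v" by simp
  qed (use r q_bounds in auto)
  have "\<bar>eigvec_coeff2 a b\<bar> = (2 - a - b) / (a + b) * \<bar>stationary_mean a b\<bar> * \<bar>eigvec_coeff1 a b\<bar>"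
    unfolding eigvec_coeff2_def abs_mult abs_of_nonneg[OF q(1)] ..
  also have "\<dots> \<le> 2 * v * 1 * v" using q A m q_bounds by (intro mult_mono) auto
  finally show "\<bar>eigvec_coeff2 a b\<bar> \<le> 2 * v\<^sup>2" by (simp add: power2_eq_square)
  have m2: "(stationary_mean a b)\<^sup>2 \<le> 1" using m by (simp add: abs_square_le_1)
  show "0 \<le> asymptotic_variance a b" unfolding asymptotic_variance_def using q m2 by (intro mult_nonneg_nonneg) auto
  have "asymptotic_variance a b \<le> 2 * v * 1" unfolding asymptotic_variance_def using q m2 q_bounds by (intro mult_mono) auto
  then show "asymptotic_variance a b \<le> 2 * v" by simp
qed

lemma centered_bound: "z \<in> {-1, 1} \<Longrightarrow> \<bar>real_of_int z - stationary_mean a b\<bar> \<le> 2"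
  using stationary_mean_bounds[OF ab q_bounds(1)] by auto

lemma eigvec_near_1:
  assumes z: "z \<in> {-1, 1}" and e: "\<bar>e\<bar> \<le> 1"
  shows "cmod (eigvec a b e z - 1) \<le> (2 * v + 4 * v\<^sup>2) * \<bar>e\<bar>"
proof -
  let ?u = "real_of_int z - stationary_mean a b"
  have "cmod (eigvec a b e z - 1) \<le> cmod ((\<i> * e) * eigvec_coeff1 a b * of_real ?u) + cmod ((\<i> * e)\<^sup>2 * eigvec_coeff2 a b * of_real ?u)"
    unfolding eigvec_def by (rule order_trans[OF _ norm_triangle_ineq4]) simp
  also have "\<dots> = \<bar>e\<bar> * \<bar>eigvec_coeff1 a b\<bar> * \<bar>?u\<bar> + \<bar>e\<bar>\<^sup>2 * \<bar>eigvec_coeff2 a b\<bar> * \<bar>?u\<bar>"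
    by (simp add: norm_mult norm_power del: of_real_diff)
  also have "\<dots> \<le> \<bar>e\<bar> * v * 2 + \<bar>e\<bar> * (2 * v\<^sup>2) * 2"
  proof (intro add_mono mult_mono)
    show "\<bar>e\<bar>\<^sup>2 \<le> \<bar>e\<bar>" using mult_left_mono[OF e, of "\<bar>e\<bar>"] by (simp add: power2_eq_square)
  qed (use coeff_bounds centered_bound[OF z] q_bounds in auto)
  finally show ?thesis by (simp add: algebra_simps)
qed

lemma approx_eigenvector:
  assumes y: "y \<in> {-1, 1}" and e: "\<bar>e\<bar> \<le> 1"
  shows "cmod ((\<Sum>z\<in>{-1, 1}. walk_transition a b y z *\<^sub>R (iexp (e * (z - stationary_mean a b)) * eigvec a b e z))
      - of_real (1 - asymptotic_variance a b * e\<^sup>2 / 2) * eigvec a b e y) \<le> err_const v * \<bar>e\<bar>^3"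
proof -
  define m where "m = stationary_mean a b"
  define P where "P = walk_transition a b y"
  define A where "A = eigvec_coeff1 a b"
  define B where "B = eigvec_coeff2 a b"
  define S where "S = asymptotic_variance a b"
  define u where "u = (\<lambda>z::int. real_of_int z - m)"
  define w where "w = eigvec a b e"
  define E where "E = \<i> * complex_of_real e"
  define q where "q = (\<lambda>z. 1 + E * u z + E\<^sup>2 * (u z)\<^sup>2 / 2)"
  define R where "R = (\<lambda>z. iexp (e * u z) - q z)"
  have w: "w z = 1 + E * A * u z - E\<^sup>2 * B * u z" for z
    by (simp add: w_def eigvec_def E_def A_def B_def u_def m_def)
  have Pn: "0 \<le> P z" for z using transition_nonneg[OF ab] by (simp add: P_def)
  have P1: "P (-1) + P 1 = 1" using transition_sum[OF y] by (simp add: P_def)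
  have PU: "P (-1) * u (-1) + P 1 * u 1 = (1 - a - b) * u y"
    using transition_mean[OF y, of a b] q_bounds by (simp add: P_def u_def m_def)
  have PU2: "P (-1) * (u (-1))\<^sup>2 + P 1 * (u 1)\<^sup>2 = 1 - m\<^sup>2 - 2 * m * ((1 - a - b) * u y)"
    using transition_second_moment[OF y, of a b] q_bounds by (simp add: P_def u_def m_def)
  have AA: "A * (a + b) = 1 - a - b" using q_bounds by (simp add: A_def eigvec_coeff1_def)
  have A2: "1 + 2 * A = (2 - a - b) / (a + b)"
    using q_bounds by (simp add: A_def eigvec_coeff1_def field_simps)
  have BA: "B = (1 + 2 * A) * m * A" unfolding A2 by (simp add: B_def eigvec_coeff2_def m_def A_def)
  have SA: "S = (1 + 2 * A) * (1 - m\<^sup>2)" by (simp add: S_def asymptotic_variance_def A2 m_def)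
  \<comment> \<open>The conditions of order one and two on the approximate eigenvector.\<close>
  have c1: "(1 + A) * (P (-1) * u (-1) + P 1 * u 1) - A * u y = 0"
  proof -
    have "(1 + A) * (1 - a - b) - A = 0" using AA by (simp add: algebra_simps)
    then have "((1 + A) * (1 - a - b) - A) * u y = 0" by simp
    then show ?thesis unfolding PU by (simp add: algebra_simps)
  qed
  have c2: "(1/2 + A) * (P (-1) * (u (-1))\<^sup>2 + P 1 * (u 1)\<^sup>2) - B * (P (-1) * u (-1) + P 1 * u 1) - S / 2 + B * u y = 0"
  proof -
    have "B * (a + b) = (1 + 2 * A) * m * (1 - a - b)" unfolding BA AA[symmetric] by (simp add: algebra_simps)
    then have "(B * (a + b) - (1 + 2 * A) * m * (1 - a - b)) * u y = 0" by simp
    then show ?thesis unfolding PU PU2 SA by (simp add: algebra_simps add_divide_distrib diff_divide_distrib)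
  qed
  have ub: "\<bar>u z\<bar> \<le> 2" if "z \<in> {-1, 1}" for z using centered_bound[OF that] by (simp add: u_def m_def)
  have cb: "\<bar>A\<bar> \<le> v" "\<bar>B\<bar> \<le> 2 * v\<^sup>2" "\<bar>S\<bar> \<le> 2 * v" "0 < v" "0 \<le> v"
    using coeff_bounds q_bounds(3) unfolding A_def B_def S_def by linarith+
  have ub2: "\<bar>u z\<bar>\<^sup>2 \<le> 4" "\<bar>u z\<bar>^3 \<le> 8" if "z \<in> {-1, 1}" for z
    using power_mono[OF ub[OF that], of 2] power_mono[OF ub[OF that], of 3] by auto
  have Rb: "cmod (R z) \<le> 2 * \<bar>e\<bar>^3" if z: "z \<in> {-1, 1}" for z
  proof -
    have "cmod (R z) \<le> \<bar>e * u z\<bar>^3 / 6"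
      using iexp_second_order[of "e * u z"] by (simp add: R_def q_def E_def power_mult_distrib mult.assoc)
    also have "\<dots> = \<bar>e\<bar>^3 * \<bar>u z\<bar>^3 / 6" by (simp add: abs_mult power_mult_distrib)
    also have "\<dots> \<le> \<bar>e\<bar>^3 * 8 / 6" using ub2[OF z] by (intro divide_right_mono mult_left_mono) auto
    also have "\<dots> \<le> 2 * \<bar>e\<bar>^3" by simp
    finally show ?thesis .
  qed
  have wb: "cmod (w z) \<le> 1 + 2 * v + 4 * v\<^sup>2" if z: "z \<in> {-1, 1}" for z
  proof -
    have "cmod (w z) \<le> 1 + cmod (w z - 1)" using norm_triangle_ineq[of 1 "w z - 1"] by simp
    also have "cmod (w z - 1) \<le> (2 * v + 4 * v\<^sup>2) * \<bar>e\<bar>" using eigvec_near_1[OF z e] by (simp add: w_def)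
    also have "\<dots> \<le> (2 * v + 4 * v\<^sup>2) * 1" using e q_bounds(3) by (intro mult_left_mono) auto
    finally show ?thesis by simp
  qed
  let ?c3 = "P (-1) * (A * (u (-1))^3 / 2 - B * (u (-1))\<^sup>2) + P 1 * (A * (u 1)^3 / 2 - B * (u 1)\<^sup>2) - S / 2 * A * u y"
  let ?c4 = "S / 2 * B * u y - P (-1) * (B * (u (-1))^3 / 2) - P 1 * (B * (u 1)^3 / 2)"
  have avg: "\<bar>P (-1) * x1 + P 1 * x2\<bar> \<le> c" if "\<bar>x1\<bar> \<le> c" "\<bar>x2\<bar> \<le> c" for x1 x2 c :: real
  proof -
    have "\<bar>P (-1) * x1 + P 1 * x2\<bar> \<le> P (-1) * \<bar>x1\<bar> + P 1 * \<bar>x2\<bar>"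
      using Pn by (intro order_trans[OF abs_triangle_ineq]) (simp add: abs_mult)
    also have "\<dots> \<le> P (-1) * c + P 1 * c" using that Pn by (intro add_mono mult_left_mono) auto
    also have "\<dots> = c" using P1 by (simp flip: distrib_right)
    finally show ?thesis .
  qed
  have t3: "\<bar>A * (u z)^3 / 2\<bar> \<le> 4 * v" "\<bar>B * (u z)\<^sup>2\<bar> \<le> 8 * v\<^sup>2" "\<bar>B * (u z)^3 / 2\<bar> \<le> 8 * v\<^sup>2"
    if z: "z \<in> {-1, 1}" for z
  proof -
    have "\<bar>A\<bar> * \<bar>u z\<bar>^3 \<le> v * 8" "\<bar>B\<bar> * \<bar>u z\<bar>\<^sup>2 \<le> 2 * v\<^sup>2 * 4" "\<bar>B\<bar> * \<bar>u z\<bar>^3 \<le> 2 * v\<^sup>2 * 8"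
      using cb ub2[OF z] by (intro mult_mono; simp)+
    then show "\<bar>A * (u z)^3 / 2\<bar> \<le> 4 * v" "\<bar>B * (u z)\<^sup>2\<bar> \<le> 8 * v\<^sup>2" "\<bar>B * (u z)^3 / 2\<bar> \<le> 8 * v\<^sup>2"
      by (simp_all add: abs_mult power_abs)
  qed
  have SAu: "\<bar>S / 2 * A * u y\<bar> \<le> 2 * v\<^sup>2"
  proof -
    have "\<bar>S\<bar> / 2 * \<bar>A\<bar> * \<bar>u y\<bar> \<le> v * v * 2" using cb ub[OF y] by (intro mult_mono) auto
    then show ?thesis by (simp add: abs_mult power2_eq_square)
  qed
  have SBu: "\<bar>S / 2 * B * u y\<bar> \<le> 4 * v^3"
  proof -
    have "\<bar>S\<bar> / 2 * \<bar>B\<bar> * \<bar>u y\<bar> \<le> v * (2 * v\<^sup>2) * 2" using cb ub[OF y] by (intro mult_mono) auto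
    then show ?thesis by (simp add: abs_mult power2_eq_square power3_eq_cube)
  qed
  have c3: "\<bar>?c3\<bar> \<le> 4 * v + 10 * v\<^sup>2"
  proof -
    have "\<bar>P (-1) * (A * (u (-1))^3 / 2 - B * (u (-1))\<^sup>2) + P 1 * (A * (u 1)^3 / 2 - B * (u 1)\<^sup>2)\<bar> \<le> 4 * v + 8 * v\<^sup>2"
      using t3[of "-1"] t3[of 1] by (intro avg) auto
    with SAu show ?thesis by linarith
  qed
  have c4: "\<bar>?c4\<bar> \<le> 8 * v\<^sup>2 + 4 * v^3"
  proof -
    have "\<bar>P (-1) * (B * (u (-1))^3 / 2) + P 1 * (B * (u 1)^3 / 2)\<bar> \<le> 8 * v\<^sup>2"
      using t3[of "-1"] t3[of 1] by (intro avg) auto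
    with SBu show ?thesis by linarith
  qed
  have lam: "of_real (1 - S * e\<^sup>2 / 2) = 1 + E\<^sup>2 * of_real S / 2"
    by (simp add: E_def power_mult_distrib algebra_simps)
  have expansion: "(\<Sum>z\<in>{-1, 1}. P z *\<^sub>R (iexp (e * u z) * w z)) - of_real (1 - S * e\<^sup>2 / 2) * w y
     = (\<Sum>z\<in>{-1, 1}. P z *\<^sub>R (R z * w z)) + E^3 * of_real ?c3 + E^4 * of_real ?c4"
  proof -
    have cc: "of_real (P (-1)) + of_real (P 1) - 1 = (0::complex)"
      "E * ((1 + of_real A) * (of_real (P (-1)) * of_real (u (-1)) + of_real (P 1) * of_real (u 1)) - of_real A * of_real (u y)) = 0"
      "E\<^sup>2 * ((1/2 + of_real A) * (of_real (P (-1)) * (of_real (u (-1)))\<^sup>2 + of_real (P 1) * (of_real (u 1))\<^sup>2)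
          - of_real B * (of_real (P (-1)) * of_real (u (-1)) + of_real (P 1) * of_real (u 1)) - of_real S / 2
          + of_real B * of_real (u y)) = 0"
      using arg_cong[OF P1, of complex_of_real] arg_cong[OF c1, of complex_of_real] arg_cong[OF c2, of complex_of_real]
      by simp_all
    have "(\<Sum>z\<in>{-1, 1}. P z *\<^sub>R (iexp (e * u z) * w z)) - of_real (1 - S * e\<^sup>2 / 2) * w y
      = (\<Sum>z\<in>{-1, 1}. P z *\<^sub>R (R z * w z)) +
      (P (-1) * (q (-1) * w (-1)) + P 1 * (q 1 * w 1) - of_real (1 - S * e\<^sup>2 / 2) * w y)"
      unfolding sum_over_states R_def scaleR_conv_of_real by (simp only: left_diff_distrib right_diff_distrib) simp
    also have "P (-1) * (q (-1) * w (-1)) + P 1 * (q 1 * w 1) - of_real (1 - S * e\<^sup>2 / 2) * w y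
      = E^3 * of_real ?c3 + E^4 * of_real ?c4"
      unfolding w q_def lam of_real_power
      by (rule trans[OF two_point_expansion])
        (simp only: cc add_0_left of_real_add of_real_diff of_real_mult of_real_power of_real_divide of_real_numeral)
    finally show ?thesis by (simp only: add.assoc)
  qed
  have "cmod ((\<Sum>z\<in>{-1, 1}. P z *\<^sub>R (R z * w z)) + E^3 * of_real ?c3 + E^4 * of_real ?c4)
     \<le> (\<Sum>z\<in>{-1, 1}. P z * (2 * \<bar>e\<bar>^3 * (1 + 2 * v + 4 * v\<^sup>2))) + \<bar>e\<bar>^3 * (4 * v + 10 * v\<^sup>2) + \<bar>e\<bar>^3 * (8 * v\<^sup>2 + 4 * v^3)"
  proof (intro order_trans[OF norm_triangle_ineq] add_mono)
    show "cmod (\<Sum>z\<in>{-1, 1}. P z *\<^sub>R (R z * w z)) \<le> (\<Sum>z\<in>{-1, 1}. P z * (2 * \<bar>e\<bar>^3 * (1 + 2 * v + 4 * v\<^sup>2)))"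
    proof (rule order_trans[OF norm_sum sum_mono])
      fix z :: int assume z: "z \<in> {-1, 1}"
      have "cmod (R z) * cmod (w z) \<le> 2 * \<bar>e\<bar>^3 * (1 + 2 * v + 4 * v\<^sup>2)"
        using Rb[OF z] wb[OF z] by (intro mult_mono) auto
      then show "cmod (P z *\<^sub>R (R z * w z)) \<le> P z * (2 * \<bar>e\<bar>^3 * (1 + 2 * v + 4 * v\<^sup>2))"
        using Pn[of z] by (simp add: norm_mult mult_left_mono)
    qed
    have nE: "cmod E = \<bar>e\<bar>" by (simp add: E_def norm_mult)
    show "cmod (E^3 * of_real ?c3) \<le> \<bar>e\<bar>^3 * (4 * v + 10 * v\<^sup>2)"
      unfolding norm_mult norm_power nE norm_of_real using c3 by (intro mult_left_mono) auto
    have "\<bar>e\<bar>^4 \<le> \<bar>e\<bar>^3" using e by (intro power_decreasing) auto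
    then show "cmod (E^4 * of_real ?c4) \<le> \<bar>e\<bar>^3 * (8 * v\<^sup>2 + 4 * v^3)"
      unfolding norm_mult norm_power nE norm_of_real using c4 by (intro mult_mono) auto
  qed
  also have "\<dots> = (P (-1) + P 1) * (2 * \<bar>e\<bar>^3 * (1 + 2 * v + 4 * v\<^sup>2)) + \<bar>e\<bar>^3 * (4 * v + 10 * v\<^sup>2) + \<bar>e\<bar>^3 * (8 * v\<^sup>2 + 4 * v^3)"
    by (simp add: distrib_right)
  also have "\<dots> = err_const v * \<bar>e\<bar>^3" unfolding P1 err_const_def by (simp add: algebra_simps)
  finally show ?thesis unfolding expansion[symmetric] by (simp only: P_def u_def m_def w_def S_def)
qed

text \<open>
  The transfer operator, which multiplies by \<open>iexp (e * (z - m))\<close> and averages over one step, is a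
  contraction in the maximum norm. So \<open>k\<close> applications to the
  approximate eigenvector accumulate an error of order \<open>k \<bar>e\<bar>\<^sup>3\<close>, while replacing the eigenvector by the
  constant \<open>1\<close> costs order \<open>\<bar>e\<bar>\<close>.
\<close>
lemma char_walk_bound:
  assumes y: "y \<in> {-1, 1}" and e: "\<bar>e\<bar> \<le> 1" "v * e\<^sup>2 \<le> 2"
  shows "cmod (path_mean a b k y (\<lambda>l. iexp (e * centered_sum (stationary_mean a b) l))
      - of_real (exp (- (asymptotic_variance a b * e\<^sup>2 / 2 * k))))
    \<le> (4 * v + 9 * v\<^sup>2 + err_const v) * (\<bar>e\<bar> + k * \<bar>e\<bar>^3)"
proof -
  let ?m = "stationary_mean a b" and ?w = "eigvec a b e" and ?D = "(2 * v + 4 * v\<^sup>2) * \<bar>e\<bar>"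
  let ?E = "\<lambda>k y. path_mean a b k y (\<lambda>l. iexp (e * centered_sum ?m l))"
  define x where "x = asymptotic_variance a b * e\<^sup>2 / 2"
  have x: "0 \<le> x" "x \<le> v * e\<^sup>2" "x \<le> 2"
  proof -
    show "0 \<le> x" using coeff_bounds by (simp add: x_def)
    have "asymptotic_variance a b * e\<^sup>2 \<le> 2 * v * e\<^sup>2" using coeff_bounds by (intro mult_right_mono) auto
    then show "x \<le> v * e\<^sup>2" by (simp add: x_def)
    with e show "x \<le> 2" by simp
  qed
  define lm where "lm = complex_of_real (1 - x)"
  have l1: "cmod lm \<le> 1" unfolding lm_def norm_of_real using x by auto
  have ind: "cmod (?E k y - lm^k * ?w y) \<le> ?D + k * (err_const v * \<bar>e\<bar>^3)"
    using y
  proof (induction k arbitrary: y)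
    case 0
    then show ?case using eigvec_near_1[OF 0 e(1)] by (simp add: centered_sum_def norm_minus_commute)
  next
    case (Suc k)
    let ?P = "walk_transition a b y"
    let ?u = "\<lambda>z::int. iexp (e * (z - ?m))"
    have Pn: "0 \<le> ?P z" for z using transition_nonneg[OF ab] by simp
    have alg: "(p1 * (u1 * e1) + p2 * (u2 * e2)) - l * lk * w
        = (p1 * (u1 * (e1 - lk * w1)) + p2 * (u2 * (e2 - lk * w2))) + lk * ((p1 * (u1 * w1) + p2 * (u2 * w2)) - l * w)"
      for p1 p2 u1 u2 e1 e2 l lk w w1 w2 :: complex
      by (simp add: algebra_simps)
    have split: "iexp (e * centered_sum ?m (z # l)) = ?u z * iexp (e * centered_sum ?m l)" for z l
    proof -
      have "e * centered_sum ?m (z # l) = e * (z - ?m) + e * centered_sum ?m l" by (simp add: centered_sum_def distrib_left)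
      then show ?thesis by (simp only: of_real_add distrib_left exp_add)
    qed
    have "?E (Suc k) y = (\<Sum>z\<in>{-1, 1}. ?P z *\<^sub>R (?u z * ?E k z))"
      unfolding expectation_path_Suc[OF ab Suc.prems] split integral_mult_right_zero ..
    then have step: "?E (Suc k) y - lm^Suc k * ?w y
        = (\<Sum>z\<in>{-1, 1}. ?P z *\<^sub>R (?u z * (?E k z - lm^k * ?w z)))
          + lm^k * ((\<Sum>z\<in>{-1, 1}. ?P z *\<^sub>R (?u z * ?w z)) - lm * ?w y)"
      by (simp only: sum_over_states scaleR_conv_of_real power_Suc) (rule alg)
    have "cmod (?E (Suc k) y - lm^Suc k * ?w y) \<le> (\<Sum>z\<in>{-1, 1}. ?P z * (?D + k * (err_const v * \<bar>e\<bar>^3))) + 1 * (err_const v * \<bar>e\<bar>^3)"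
      unfolding step
    proof (intro order_trans[OF norm_triangle_ineq] add_mono)
      show "cmod (\<Sum>z\<in>{-1, 1}. ?P z *\<^sub>R (?u z * (?E k z - lm^k * ?w z))) \<le> (\<Sum>z\<in>{-1, 1}. ?P z * (?D + k * (err_const v * \<bar>e\<bar>^3)))"
      proof (rule order_trans[OF norm_sum sum_mono])
        fix z :: int assume z: "z \<in> {-1, 1}"
        have "cmod (?u z * (?E k z - lm^k * ?w z)) = cmod (?E k z - lm^k * ?w z)"
          by (simp add: norm_mult)
        also have "\<dots> \<le> ?D + k * (err_const v * \<bar>e\<bar>^3)" by (rule Suc.IH[OF z])
        finally show "cmod (?P z *\<^sub>R (?u z * (?E k z - lm^k * ?w z))) \<le> ?P z * (?D + k * (err_const v * \<bar>e\<bar>^3))"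
          using Pn[of z] by (simp add: mult_left_mono)
      qed
      show "cmod (lm^k * ((\<Sum>z\<in>{-1, 1}. ?P z *\<^sub>R (?u z * ?w z)) - lm * ?w y)) \<le> 1 * (err_const v * \<bar>e\<bar>^3)"
        unfolding norm_mult norm_power
      proof (intro mult_mono)
        show "cmod lm ^ k \<le> 1" using l1 by (simp add: power_le_one)
        show "cmod ((\<Sum>z\<in>{-1, 1}. ?P z *\<^sub>R (?u z * ?w z)) - lm * ?w y) \<le> err_const v * \<bar>e\<bar>^3"
          using approx_eigenvector[OF Suc.prems e(1)] by (simp only: lm_def x_def)
      qed auto
    qed
    also have "\<dots> = (?P (-1) + ?P 1) * (?D + k * (err_const v * \<bar>e\<bar>^3)) + err_const v * \<bar>e\<bar>^3"
      by (simp add: distrib_right)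
    also have "\<dots> = ?D + Suc k * (err_const v * \<bar>e\<bar>^3)"
      unfolding transition_sum[OF Suc.prems] by (simp add: algebra_simps)
    finally show ?case .
  qed
  have w1: "cmod (lm^k * ?w y - lm^k) \<le> ?D"
  proof -
    have "cmod (lm^k * ?w y - lm^k) = cmod lm^k * cmod (?w y - 1)"
      by (simp add: norm_mult[symmetric] norm_power[symmetric] algebra_simps)
    also have "\<dots> \<le> 1 * ?D" using eigvec_near_1[OF y e(1)] l1 by (intro mult_mono) (auto simp: power_le_one)
    finally show ?thesis by simp
  qed
  have ex: "cmod (lm^k - of_real (exp (- (x * k)))) \<le> k * (v\<^sup>2 * \<bar>e\<bar>^3)"
  proof -
    have "exp (- (x * k)) = exp (- x) ^ k" by (simp add: exp_of_nat_mult[symmetric] mult.commute)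
    then have "cmod (lm^k - of_real (exp (- (x * k)))) = cmod (lm^k - (of_real (exp (- x)))^k)" by simp
    also have "\<dots> \<le> k * cmod (lm - of_real (exp (- x)))"
      by (rule norm_power_diff[OF l1]) (use x in simp)
    also have "cmod (lm - of_real (exp (- x))) = \<bar>(1 - x) - exp (- x)\<bar>"
      unfolding lm_def of_real_diff[symmetric] norm_of_real ..
    also have "\<dots> \<le> x\<^sup>2" by (rule exp_second_order[OF x(1)])
    also have "x\<^sup>2 \<le> (v * e\<^sup>2)\<^sup>2" using x by (intro power_mono) auto
    also have "\<dots> = v\<^sup>2 * \<bar>e\<bar>^4" by (simp add: power_mult_distrib flip: power_mult)
    also have "\<dots> \<le> v\<^sup>2 * \<bar>e\<bar>^3" using e by (intro mult_left_mono power_decreasing) auto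
    finally show ?thesis by (simp add: mult_left_mono)
  qed
  have "cmod (?E k y - of_real (exp (- (x * k)))) \<le>
     cmod (?E k y - lm^k * ?w y) + cmod (lm^k * ?w y - lm^k) + cmod (lm^k - of_real (exp (- (x * k))))"
    by norm
  also have "\<dots> \<le> (?D + k * (err_const v * \<bar>e\<bar>^3)) + ?D + k * (v\<^sup>2 * \<bar>e\<bar>^3)"
    using ind w1 ex by (intro add_mono)
  also have "\<dots> = (4 * v + 8 * v\<^sup>2) * \<bar>e\<bar> + (v\<^sup>2 + err_const v) * (k * \<bar>e\<bar>^3)" by (simp add: algebra_simps)
  also have "\<dots> \<le> (4 * v + 9 * v\<^sup>2 + err_const v) * \<bar>e\<bar> + (4 * v + 9 * v\<^sup>2 + err_const v) * (k * \<bar>e\<bar>^3)"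
    using q_bounds(3) by (intro add_mono mult_right_mono) (auto simp: err_const_def)
  finally show ?thesis by (simp add: x_def algebra_simps)
qed

end

section \<open>Central limit theorem for the walk\<close>

text \<open>
  The image of the standard normal law instead of a density, so that the variance may be zero.
\<close>
definition gaussian_law :: "real \<Rightarrow> real measure" where
  "gaussian_law c = distr std_normal_distribution borel (\<lambda>x. c * x)"

lemma real_distribution_gaussian_law: "real_distribution (gaussian_law c)"
proof -
  interpret real_distribution std_normal_distribution by (rule real_dist_normal_dist)
  show ?thesis unfolding gaussian_law_def by (rule real_distribution_distr) simp
qed

lemma char_gaussian_law: "char (gaussian_law c) t = of_real (exp (- (c\<^sup>2 * t\<^sup>2 / 2)))"
proof -
  have "char (gaussian_law c) t = char std_normal_distribution (t * c)"
    unfolding char_def gaussian_law_def by (subst integral_distr) (auto simp: mult.assoc)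
  then show ?thesis by (simp add: char_std_normal_distribution power_mult_distrib mult.commute)
qed

text \<open>
  With \<open>e = t * d n\<close> and \<open>k = L n\<close> of order \<open>1 / (d n)\<^sup>2\<close>, the error of \<open>char_walk_bound\<close> is of order
  \<open>d n\<close>. The parameters of the chain may vary with \<open>n\<close>.
\<close>
lemma walk_clt:
  fixes a b d :: "nat \<Rightarrow> real" and L :: "nat \<Rightarrow> nat"
  assumes ab: "\<And>n. a n \<in> {0..1}" "\<And>n. b n \<in> {0..1}" and \<kappa>: "0 < \<kappa>" "\<And>n. \<kappa> \<le> a n + b n"
    and d: "d \<longlonglongrightarrow> 0" and L: "(\<lambda>n. real (L n) * (d n)\<^sup>2) \<longlonglongrightarrow> s"
    and var: "(\<lambda>n. asymptotic_variance (a n) (b n)) \<longlonglongrightarrow> V" and y: "y \<in> {-1, 1}"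
  shows "weak_conv_m (\<lambda>n. distr (measure_pmf (path_pmf (a n) (b n) (L n) y)) borel
      (\<lambda>l. d n * centered_sum (stationary_mean (a n) (b n)) l)) (gaussian_law (sqrt (V * s)))"
proof (rule levy_continuity)
  show "real_distribution (distr (measure_pmf (path_pmf (a n) (b n) (L n) y)) borel (\<lambda>l. d n * centered_sum (stationary_mean (a n) (b n)) l))" for n
    by (intro prob_space.real_distribution_distr prob_space_measure_pmf) simp
  show "real_distribution (gaussian_law (sqrt (V * s)))" by (rule real_distribution_gaussian_law)
  have V: "V \<ge> 0" by (rule LIMSEQ_le_const[OF var]) (use coeff_bounds(3)[OF ab \<kappa>(1) \<kappa>(2) refl] in auto)
  have s: "s \<ge> 0" by (rule LIMSEQ_le_const[OF L]) auto
  define v where "v = 1 / \<kappa>"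
  fix t :: real
  let ?E = "\<lambda>n. path_mean (a n) (b n) (L n) y (\<lambda>l. iexp (t * d n * centered_sum (stationary_mean (a n) (b n)) l))"
  define x where "x = (\<lambda>n. asymptotic_variance (a n) (b n) * (t * d n)\<^sup>2 / 2 * L n)"
  define C where "C = 4 * v + 9 * v\<^sup>2 + err_const v"
  define r where "r = (\<lambda>n. C * (\<bar>t * d n\<bar> + L n * \<bar>t * d n\<bar>^3))"
  have td: "(\<lambda>n. t * d n) \<longlonglongrightarrow> 0" using tendsto_mult_right_zero[OF d] .
  have "(\<lambda>n. C * (\<bar>t * d n\<bar> + t\<^sup>2 * (L n * (d n)\<^sup>2) * \<bar>t * d n\<bar>)) \<longlonglongrightarrow> C * (\<bar>0\<bar> + t\<^sup>2 * s * \<bar>0\<bar>)"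
    by (intro tendsto_intros td L)
  moreover have "L n * \<bar>t * d n\<bar>^3 = t\<^sup>2 * (L n * (d n)\<^sup>2) * \<bar>t * d n\<bar>" for n
    by (simp add: power3_eq_cube abs_mult power2_eq_square algebra_simps)
  ultimately have r: "r \<longlonglongrightarrow> 0" by (simp only: r_def) simp
  have "(\<lambda>n. asymptotic_variance (a n) (b n) * t\<^sup>2 / 2 * (L n * (d n)\<^sup>2)) \<longlonglongrightarrow> V * t\<^sup>2 / 2 * s"
    by (intro tendsto_intros var L) simp
  moreover have "asymptotic_variance (a n) (b n) * t\<^sup>2 / 2 * (L n * (d n)\<^sup>2) = x n" for n
    by (simp add: x_def power_mult_distrib algebra_simps)
  ultimately have x: "x \<longlonglongrightarrow> V * t\<^sup>2 / 2 * s" by simp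
  have ev: "\<forall>\<^sub>F n in sequentially. norm (?E n - of_real (exp (- x n))) \<le> r n"
  proof -
    have "(\<lambda>n. v * (t * d n)\<^sup>2) \<longlonglongrightarrow> v * 0\<^sup>2" by (intro tendsto_intros td)
    then have e2: "\<forall>\<^sub>F n in sequentially. v * (t * d n)\<^sup>2 < 2" by (rule order_tendstoD) simp
    have "(\<lambda>n. \<bar>t * d n\<bar>) \<longlonglongrightarrow> \<bar>0\<bar>" by (intro tendsto_intros td)
    then have e1: "\<forall>\<^sub>F n in sequentially. \<bar>t * d n\<bar> < 1" by (rule order_tendstoD) simp
    from e1 e2 show ?thesis
    proof eventually_elim
      case (elim n)
      show ?case unfolding x_def r_def C_def
        by (rule char_walk_bound[OF ab \<kappa>(1) \<kappa>(2) v_def y]) (use elim in auto)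
    qed
  qed
  have "(\<lambda>n. ?E n - of_real (exp (- x n))) \<longlonglongrightarrow> 0" by (rule Lim_null_comparison[OF ev r])
  moreover have "(\<lambda>n. complex_of_real (exp (- x n))) \<longlonglongrightarrow> of_real (exp (- (V * t\<^sup>2 / 2 * s)))"
    by (intro tendsto_of_real tendsto_exp tendsto_minus x)
  ultimately have "(\<lambda>n. (?E n - of_real (exp (- x n))) + of_real (exp (- x n))) \<longlonglongrightarrow> 0 + of_real (exp (- (V * t\<^sup>2 / 2 * s)))"
    by (rule tendsto_add)
  moreover have "char (gaussian_law (sqrt (V * s))) t = 0 + of_real (exp (- (V * t\<^sup>2 / 2 * s)))"
    using V s by (simp add: char_gaussian_law mult.commute mult.left_commute)
  moreover have "char (distr (measure_pmf (path_pmf (a n) (b n) (L n) y)) borel (\<lambda>l. d n * centered_sum (stationary_mean (a n) (b n)) l)) t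
     = (?E n - of_real (exp (- x n))) + of_real (exp (- x n))" for n
    unfolding char_def by (subst integral_distr) (auto simp: mult.assoc)
  ultimately show "(\<lambda>n. char (distr (measure_pmf (path_pmf (a n) (b n) (L n) y)) borel (\<lambda>l. d n * centered_sum (stationary_mean (a n) (b n)) l)) t)
      \<longlonglongrightarrow> char (gaussian_law (sqrt (V * s))) t" by presburger
qed

section \<open>Joint convergence of consecutive blocks\<close>

text \<open>
  On the probability space of the Skorohod representation the distance of the two integrals is at most
  the mean of \<open>min (K \<bar>Z\<^sub>n - Z\<bar>) (2 B)\<close>, a bound that does not depend on \<open>\<phi>\<close> and tends to \<open>0\<close>.
\<close>
lemma weak_conv_uniform:
  fixes \<mu> :: "nat \<Rightarrow> real measure" and \<nu> :: "real measure"
  assumes \<mu>: "\<And>n. real_distribution (\<mu> n)" and \<nu>: "real_distribution \<nu>" and w: "weak_conv_m \<mu> \<nu>"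
    and K: "K \<ge> 0"
  shows "\<exists>e. e \<longlonglongrightarrow> 0 \<and> (\<forall>n \<phi>. (\<forall>x. \<bar>\<phi> x\<bar> \<le> B) \<longrightarrow> (\<forall>x y. \<bar>\<phi> x - \<phi> y\<bar> \<le> K * \<bar>x - y\<bar>) \<longrightarrow>
     \<bar>integral\<^sup>L (\<mu> n) \<phi> - integral\<^sup>L \<nu> \<phi>\<bar> \<le> e n)"
proof -
  from Skorohod[OF \<mu> \<nu> w] obtain \<Omega> :: "real measure" and Z :: "nat \<Rightarrow> real \<Rightarrow> real" and Z' :: "real \<Rightarrow> real" where
    *: "prob_space \<Omega> \<and> (\<forall>n. Z n \<in> borel_measurable \<Omega>) \<and> (\<forall>n. distr \<Omega> borel (Z n) = \<mu> n) \<and>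
      Z' \<in> measurable \<Omega> lborel \<and> distr \<Omega> borel Z' = \<nu> \<and> (\<forall>x\<in>space \<Omega>. (\<lambda>n. Z n x) \<longlonglongrightarrow> Z' x)"
    by blast
  then have \<Omega>: "prob_space \<Omega>" and Z: "\<And>n. Z n \<in> borel_measurable \<Omega>" "\<And>n. distr \<Omega> borel (Z n) = \<mu> n"
    and Z': "Z' \<in> borel_measurable \<Omega>" "distr \<Omega> borel Z' = \<nu>"
    and lim: "\<And>x. x \<in> space \<Omega> \<Longrightarrow> (\<lambda>n. Z n x) \<longlonglongrightarrow> Z' x"
    by simp_all
  interpret prob_space \<Omega> by fact
  define g where "g = (\<lambda>n x. min (K * \<bar>Z n x - Z' x\<bar>) (2 * \<bar>B\<bar>))"
  have gm: "g n \<in> borel_measurable \<Omega>" for n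
    unfolding g_def using Z(1) Z'(1) by measurable
  have gb: "\<bar>g n x\<bar> \<le> 2 * \<bar>B\<bar>" for n x
    unfolding g_def using K by (auto simp: abs_le_iff min_def)
  have gi: "integrable \<Omega> (g n)" for n
    using gm gb by (intro integrable_const_bound[of _ "2 * \<bar>B\<bar>"]) auto
  have "(\<lambda>n. integral\<^sup>L \<Omega> (g n)) \<longlonglongrightarrow> integral\<^sup>L \<Omega> (\<lambda>_. 0)"
  proof (rule integral_dominated_convergence[where w = "\<lambda>_. 2 * \<bar>B\<bar>"])
    show "AE x in \<Omega>. (\<lambda>n. g n x) \<longlonglongrightarrow> 0"
    proof (rule AE_I2)
      fix x assume x: "x \<in> space \<Omega>"
      have "(\<lambda>n. min (K * \<bar>Z n x - Z' x\<bar>) (2 * \<bar>B\<bar>)) \<longlonglongrightarrow> min (K * \<bar>Z' x - Z' x\<bar>) (2 * \<bar>B\<bar>)"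
        by (intro tendsto_min tendsto_mult tendsto_rabs tendsto_diff tendsto_const lim[OF x])
      then show "(\<lambda>n. g n x) \<longlonglongrightarrow> 0" by (simp add: g_def)
    qed
  qed (use gm gb in auto)
  moreover have "\<bar>integral\<^sup>L (\<mu> n) \<phi> - integral\<^sup>L \<nu> \<phi>\<bar> \<le> integral\<^sup>L \<Omega> (g n)"
    if \<phi>: "\<forall>x. \<bar>\<phi> x\<bar> \<le> B" "\<forall>x y. \<bar>\<phi> x - \<phi> y\<bar> \<le> K * \<bar>x - y\<bar>" for n \<phi>
  proof -
    have "continuous_on UNIV \<phi>"
      by (rule lipschitz_on_continuous_on[of K], rule lipschitz_onI) (use \<phi> K in \<open>auto simp: dist_real_def\<close>)
    then have m: "\<phi> \<in> borel_measurable borel" by (rule borel_measurable_continuous_onI)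
    have i: "integrable \<Omega> (\<lambda>x. \<phi> (Z n x))" "integrable \<Omega> (\<lambda>x. \<phi> (Z' x))"
      using \<phi>(1) Z(1) Z'(1) m by (auto intro!: integrable_const_bound[of _ B] measurable_compose[OF _ m])
    have "integral\<^sup>L (\<mu> n) \<phi> - integral\<^sup>L \<nu> \<phi> = (\<integral>x. \<phi> (Z n x) \<partial>\<Omega>) - (\<integral>x. \<phi> (Z' x) \<partial>\<Omega>)"
      unfolding Z(2)[symmetric] Z'(2)[symmetric] using Z(1) Z'(1) m by (simp add: integral_distr)
    also have "\<dots> = (\<integral>x. \<phi> (Z n x) - \<phi> (Z' x) \<partial>\<Omega>)" using i by simp
    also have "\<bar>\<dots>\<bar> \<le> (\<integral>x. \<bar>\<phi> (Z n x) - \<phi> (Z' x)\<bar> \<partial>\<Omega>)" by (rule integral_abs_bound)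
    also have "\<dots> \<le> integral\<^sup>L \<Omega> (g n)"
    proof (rule integral_mono)
      fix x
      have "\<bar>\<phi> (Z n x) - \<phi> (Z' x)\<bar> \<le> \<bar>\<phi> (Z n x)\<bar> + \<bar>\<phi> (Z' x)\<bar>" by simp
      also have "\<dots> \<le> 2 * \<bar>B\<bar>" using \<phi>(1)[rule_format, of "Z n x"] \<phi>(1)[rule_format, of "Z' x"] by linarith
      finally show "\<bar>\<phi> (Z n x) - \<phi> (Z' x)\<bar> \<le> g n x" using \<phi>(2) by (simp add: g_def)
    qed (use i gi in auto)
    finally show ?thesis .
  qed
  ultimately show ?thesis by (intro exI[of _ "\<lambda>n. integral\<^sup>L \<Omega> (g n)"]) auto
qed

definition sum_lipschitz :: "nat \<Rightarrow> real \<Rightarrow> real \<Rightarrow> ((nat \<Rightarrow> real) \<Rightarrow> real) \<Rightarrow> bool" where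
  "sum_lipschitz q K B \<Phi> \<longleftrightarrow> (\<forall>x. \<bar>\<Phi> x\<bar> \<le> B) \<and> (\<forall>x y. \<bar>\<Phi> x - \<Phi> y\<bar> \<le> K * (\<Sum>j<q. \<bar>x j - y j\<bar>))"

text \<open>
  Mean of \<open>\<Phi>\<close> under the \<open>q\<close>-fold product of \<open>\<nu>\<close>, integrated one coordinate at a time, beginning with the
  last. Coordinates from \<open>q\<close> on are set to the default \<open>0\<close>.
\<close>
primrec iterated_integral :: "real measure \<Rightarrow> nat \<Rightarrow> ((nat \<Rightarrow> real) \<Rightarrow> real) \<Rightarrow> real" where
  "iterated_integral \<nu> 0 \<Phi> = \<Phi> (\<lambda>_. 0)"
| "iterated_integral \<nu> (Suc q) \<Phi> = iterated_integral \<nu> q (\<lambda>x. \<integral>u. \<Phi> (x(q := u)) \<partial>\<nu>)"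

definition block :: "nat \<Rightarrow> nat \<Rightarrow> 'x list \<Rightarrow> 'x list" where
  "block L j l = take L (drop (j * L) l)"

lemma sum_lipschitz_cong:
  assumes "sum_lipschitz q K B \<Phi>" "\<And>j. j < q \<Longrightarrow> x j = y j"
  shows "\<Phi> x = \<Phi> y"
proof -
  have "\<bar>\<Phi> x - \<Phi> y\<bar> \<le> K * (\<Sum>j<q. \<bar>x j - y j\<bar>)" using assms(1) by (simp add: sum_lipschitz_def)
  also have "(\<Sum>j<q. \<bar>x j - y j\<bar>) = 0" using assms(2) by simp
  finally show ?thesis by simp
qed

lemma sum_lipschitz_measurable:
  assumes "sum_lipschitz q K B \<Phi>"
  shows "\<Phi> \<in> borel_measurable borel"
proof (rule borel_measurable_continuous_onI)
  show "continuous_on UNIV \<Phi>"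
    unfolding continuous_on_def
  proof
    fix x :: "nat \<Rightarrow> real"
    have "continuous_on UNIV (\<lambda>y::nat \<Rightarrow> real. y j)" for j by (rule continuous_on_product_coordinates)
    then have c: "((\<lambda>y. y j) \<longlongrightarrow> x j) (at x)" for j unfolding continuous_on_def by auto
    have "((\<lambda>y. K * (\<Sum>j<q. \<bar>y j - x j\<bar>)) \<longlongrightarrow> K * (\<Sum>j<q. \<bar>x j - x j\<bar>)) (at x)"
      by (intro tendsto_intros c)
    then have "((\<lambda>y. K * (\<Sum>j<q. \<bar>y j - x j\<bar>)) \<longlongrightarrow> 0) (at x)" by simp
    then have "((\<lambda>y. \<Phi> y - \<Phi> x) \<longlongrightarrow> 0) (at x)"
      by (rule Lim_null_comparison[rotated]) (use assms in \<open>auto simp: sum_lipschitz_def\<close>)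
    then show "(\<Phi> \<longlongrightarrow> \<Phi> x) (at x)" by (rule LIM_zero_cancel)
  qed
qed

lemma sum_lipschitz_measurable_PiM:
  assumes \<Phi>: "sum_lipschitz q K B \<Phi>" and N: "\<And>i. sets (N i) = sets borel"
  shows "\<Phi> \<in> borel_measurable (Pi\<^sub>M {..<q} N)"
proof -
  have "(\<lambda>x i. if i < q then x i else 0) \<in> borel_measurable (Pi\<^sub>M {..<q} N)"
  proof (rule measurable_coordinatewise_then_product)
    fix i
    have "(\<lambda>x. x i) \<in> borel_measurable (Pi\<^sub>M {..<q} N)" if "i < q"
      using measurable_component_singleton[of i "{..<q}" N] that measurable_cong_sets[OF refl N] by blast
    then show "(\<lambda>x. if i < q then x i else 0) \<in> borel_measurable (Pi\<^sub>M {..<q} N)"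
      by (cases "i < q") auto
  qed
  from measurable_compose[OF this sum_lipschitz_measurable[OF \<Phi>]]
  have "(\<lambda>x. \<Phi> (\<lambda>i. if i < q then x i else 0)) \<in> borel_measurable (Pi\<^sub>M {..<q} N)" .
  also have "(\<lambda>x. \<Phi> (\<lambda>i. if i < q then x i else 0)) = \<Phi>"
    by (intro ext sum_lipschitz_cong[OF \<Phi>]) simp
  finally show ?thesis .
qed

lemma sum_lipschitz_section:
  assumes \<Phi>: "sum_lipschitz (Suc q) K B \<Phi>"
  shows "\<bar>\<Phi> (x(q := u)) - \<Phi> (x(q := w))\<bar> \<le> K * \<bar>u - w\<bar>"
proof -
  have "\<bar>\<Phi> (x(q := u)) - \<Phi> (x(q := w))\<bar> \<le> K * (\<Sum>j<Suc q. \<bar>(x(q := u)) j - (x(q := w)) j\<bar>)"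
    using \<Phi> unfolding sum_lipschitz_def by blast
  also have "(\<Sum>j<Suc q. \<bar>(x(q := u)) j - (x(q := w)) j\<bar>) = \<bar>u - w\<bar>" by simp
  finally show ?thesis .
qed

lemma section_measurable:
  assumes \<Phi>: "sum_lipschitz (Suc q) K B \<Phi>"
  shows "(\<lambda>u. \<Phi> (x(q := u))) \<in> borel_measurable borel"
proof (rule measurable_compose[OF _ sum_lipschitz_measurable[OF \<Phi>]])
  show "(\<lambda>u. x(q := u)) \<in> borel_measurable borel"
  proof (rule measurable_coordinatewise_then_product)
    fix i show "(\<lambda>u. (x(q := u)) i) \<in> borel_measurable borel" by (cases "i = q") auto
  qed
qed

lemma sum_lipschitz_integrate:
  assumes \<Phi>: "sum_lipschitz (Suc q) K B \<Phi>" and \<nu>: "real_distribution \<nu>"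
  shows "sum_lipschitz q K B (\<lambda>x. \<integral>u. \<Phi> (x(q := u)) \<partial>\<nu>)"
proof -
  interpret real_distribution \<nu> by fact
  have m: "(\<lambda>u. \<Phi> (x(q := u))) \<in> borel_measurable \<nu>" for x using section_measurable[OF \<Phi>] by simp
  have i: "integrable \<nu> (\<lambda>u. \<Phi> (x(q := u)))" for x
    using \<Phi> m by (intro integrable_const_bound[of _ B]) (auto simp: sum_lipschitz_def)
  have "\<bar>\<integral>u. \<Phi> (x(q := u)) \<partial>\<nu>\<bar> \<le> B" for x
  proof -
    have "\<bar>\<integral>u. \<Phi> (x(q := u)) \<partial>\<nu>\<bar> \<le> (\<integral>u. \<bar>\<Phi> (x(q := u))\<bar> \<partial>\<nu>)" by (rule integral_abs_bound)
    also have "\<dots> \<le> (\<integral>u. B \<partial>\<nu>)"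
      using i \<Phi> by (intro integral_mono) (auto simp: sum_lipschitz_def)
    also have "\<dots> = B" by (simp add: prob_space del: space_eq_univ)
    finally show ?thesis .
  qed
  moreover have "\<bar>(\<integral>u. \<Phi> (x(q := u)) \<partial>\<nu>) - (\<integral>u. \<Phi> (y(q := u)) \<partial>\<nu>)\<bar> \<le> K * (\<Sum>j<q. \<bar>x j - y j\<bar>)" for x y
  proof -
    have "\<bar>(\<integral>u. \<Phi> (x(q := u)) \<partial>\<nu>) - (\<integral>u. \<Phi> (y(q := u)) \<partial>\<nu>)\<bar> = \<bar>\<integral>u. \<Phi> (x(q := u)) - \<Phi> (y(q := u)) \<partial>\<nu>\<bar>"
      using i by simp
    also have "\<dots> \<le> (\<integral>u. \<bar>\<Phi> (x(q := u)) - \<Phi> (y(q := u))\<bar> \<partial>\<nu>)" by (rule integral_abs_bound)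
    also have "\<dots> \<le> (\<integral>u. K * (\<Sum>j<q. \<bar>x j - y j\<bar>) \<partial>\<nu>)"
    proof (rule integral_mono)
      fix u
      have "\<bar>\<Phi> (x(q := u)) - \<Phi> (y(q := u))\<bar> \<le> K * (\<Sum>j<Suc q. \<bar>(x(q := u)) j - (y(q := u)) j\<bar>)"
        using \<Phi> unfolding sum_lipschitz_def by blast
      also have "(\<Sum>j<Suc q. \<bar>(x(q := u)) j - (y(q := u)) j\<bar>) = (\<Sum>j<q. \<bar>x j - y j\<bar>)" by simp
      finally show "\<bar>\<Phi> (x(q := u)) - \<Phi> (y(q := u))\<bar> \<le> K * (\<Sum>j<q. \<bar>x j - y j\<bar>)" .
    qed (use i in auto)
    also have "\<dots> = K * (\<Sum>j<q. \<bar>x j - y j\<bar>)" by (simp add: prob_space del: space_eq_univ)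
    finally show ?thesis .
  qed
  ultimately show ?thesis by (simp add: sum_lipschitz_def)
qed

lemma block_append:
  assumes "length l = q * L" "length l' = L"
  shows "j < q \<Longrightarrow> block L j (l @ l') = block L j l" "block L q (l @ l') = l'"
proof -
  show "block L q (l @ l') = l'" using assms by (simp add: block_def)
  assume "j < q"
  then have "Suc j * L \<le> q * L" by (intro mult_right_mono) auto
  then have "j * L + L \<le> length l" using assms by (simp add: add.commute)
  then show "block L j (l @ l') = block L j l" by (simp add: block_def)
qed

text \<open>
  Conditionally on the first \<open>q\<close> blocks the last block is the walk started from one of the two states,
  so it may be integrated out against \<open>\<nu>\<close> with an error that is uniform in the past. What remains is again
  a Lipschitz functional, of the first \<open>q\<close> blocks.
\<close>
lemma block_convergence:
  fixes a b :: "nat \<Rightarrow> real" and L :: "nat \<Rightarrow> nat" and U :: "nat \<Rightarrow> int list \<Rightarrow> real"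
  assumes \<nu>: "real_distribution \<nu>" and K: "K \<ge> 0"
    and uni: "e \<longlonglongrightarrow> 0" "\<And>n \<phi> y. \<lbrakk>y \<in> {-1, 1}; \<forall>x. \<bar>\<phi> x\<bar> \<le> B; \<forall>x z. \<bar>\<phi> x - \<phi> z\<bar> \<le> K * \<bar>x - z\<bar>\<rbrakk>
      \<Longrightarrow> \<bar>path_mean (a n) (b n) (L n) y (\<lambda>l. \<phi> (U n l)) - integral\<^sup>L \<nu> \<phi>\<bar> \<le> e n"
    and \<Phi>: "sum_lipschitz q K B \<Phi>" and y: "y \<in> {-1, 1}"
  shows "(\<lambda>n. path_mean (a n) (b n) (q * L n) y (\<lambda>l. \<Phi> (\<lambda>j. U n (block (L n) j l))))
    \<longlonglongrightarrow> iterated_integral \<nu> q \<Phi>"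
  using \<Phi>
proof (induction q arbitrary: \<Phi>)
  case 0
  define k where "k = \<Phi> (\<lambda>_. 0)"
  have "\<Phi> x = k" for x unfolding k_def by (rule sum_lipschitz_cong[OF 0]) simp
  then show ?case by simp
next
  case (Suc q)
  interpret \<nu>: real_distribution \<nu> by fact
  define \<Psi> where "\<Psi> = (\<lambda>x. \<integral>u. \<Phi> (x(q := u)) \<partial>\<nu>)"
  have \<Psi>: "sum_lipschitz q K B \<Psi>" unfolding \<Psi>_def by (rule sum_lipschitz_integrate[OF Suc.prems \<nu>])
  let ?E = "\<lambda>n k y. path_mean (a n) (b n) k y"
  let ?X = "\<lambda>n l j. U n (block (L n) j l)"
  have diff: "norm (?E n (Suc q * L n) y (\<lambda>l. \<Phi> (?X n l)) - ?E n (q * L n) y (\<lambda>l. \<Psi> (?X n l))) \<le> e n" for n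
  proof -
    have "?E n (Suc q * L n) y (\<lambda>l. \<Phi> (?X n l)) = ?E n (q * L n + L n) y (\<lambda>l. \<Phi> (?X n l))"
      by (simp add: add.commute)
    also have "\<dots> = ?E n (q * L n) y (\<lambda>l. ?E n (L n) (last (y # l)) (\<lambda>l'. \<Phi> (?X n (l @ l'))))"
      by (rule expectation_path_add)
    finally have eq: "?E n (Suc q * L n) y (\<lambda>l. \<Phi> (?X n l)) - ?E n (q * L n) y (\<lambda>l. \<Psi> (?X n l))
      = ?E n (q * L n) y (\<lambda>l. ?E n (L n) (last (y # l)) (\<lambda>l'. \<Phi> (?X n (l @ l'))) - \<Psi> (?X n l))"
      by simp
    have "\<bar>?E n (L n) (last (y # l)) (\<lambda>l'. \<Phi> (?X n (l @ l'))) - \<Psi> (?X n l)\<bar> \<le> e n"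
      if l: "l \<in> set_pmf (path_pmf (a n) (b n) (q * L n) y)" for l
    proof -
      have "?E n (L n) (last (y # l)) (\<lambda>l'. \<Phi> (?X n (l @ l'))) = ?E n (L n) (last (y # l)) (\<lambda>l'. \<Phi> ((?X n l)(q := U n l')))"
      proof (rule integral_cong_AE)
        show "AE l' in path_pmf (a n) (b n) (L n) (last (y # l)). \<Phi> (?X n (l @ l')) = \<Phi> ((?X n l)(q := U n l'))"
        proof (rule AE_pmfI)
          fix l' assume l': "l' \<in> set_pmf (path_pmf (a n) (b n) (L n) (last (y # l)))"
          show "\<Phi> (?X n (l @ l')) = \<Phi> ((?X n l)(q := U n l'))"
            by (rule sum_lipschitz_cong[OF Suc.prems])
              (use block_append[OF set_path_pmf(1)[OF l] set_path_pmf(1)[OF l']] in \<open>auto simp: less_Suc_eq\<close>)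
        qed
      qed simp_all
      then show ?thesis unfolding \<Psi>_def
        using uni(2)[of "last (y # l)" "\<lambda>u. \<Phi> ((?X n l)(q := u))" n] last_in_states[OF y l]
          sum_lipschitz_section[OF Suc.prems] Suc.prems
        by (simp add: sum_lipschitz_def)
    qed
    then have "\<bar>?E n (q * L n) y (\<lambda>l. ?E n (L n) (last (y # l)) (\<lambda>l'. \<Phi> (?X n (l @ l'))) - \<Psi> (?X n l))\<bar>
       \<le> ?E n (q * L n) y (\<lambda>l. e n)"
      by (intro order_trans[OF integral_abs_bound] integral_mono_AE AE_pmfI) auto
    then show ?thesis unfolding eq by simp
  qed
  have "(\<lambda>n. ?E n (Suc q * L n) y (\<lambda>l. \<Phi> (?X n l)) - ?E n (q * L n) y (\<lambda>l. \<Psi> (?X n l))) \<longlonglongrightarrow> 0"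
    by (rule Lim_null_comparison[OF _ uni(1)]) (use diff in auto)
  from tendsto_add[OF this Suc.IH[OF \<Psi>]] show ?case by (simp add: \<Psi>_def)
qed

lemma iterated_integral_PiM:
  assumes \<nu>: "real_distribution \<nu>" and \<Phi>: "sum_lipschitz q K B \<Phi>"
  shows "integral\<^sup>L (Pi\<^sub>M {..<q} (\<lambda>_. \<nu>)) \<Phi> = iterated_integral \<nu> q \<Phi>"
  using \<Phi>
proof (induction q arbitrary: \<Phi>)
  interpret \<nu>: real_distribution \<nu> by fact
  interpret product_sigma_finite "\<lambda>_::nat. \<nu>" by unfold_locales
  {
    case 0
    define k where "k = \<Phi> (\<lambda>_. 0)"
    have c: "\<Phi> x = k" for x unfolding k_def by (rule sum_lipschitz_cong[OF 0]) simp
    interpret P: prob_space "Pi\<^sub>M {..<0::nat} (\<lambda>_. \<nu>)" by (rule prob_space_PiM) unfold_locales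
    show ?case using P.prob_space by (simp add: c)
  next
    case (Suc q)
    interpret P: prob_space "Pi\<^sub>M {..<Suc q} (\<lambda>_. \<nu>)" by (rule prob_space_PiM) unfold_locales
    have ins: "{..<Suc q} = insert q {..<q}" by auto
    have m: "\<Phi> \<in> borel_measurable (Pi\<^sub>M {..<Suc q} (\<lambda>_. \<nu>))"
      by (rule sum_lipschitz_measurable_PiM[OF Suc.prems]) simp
    have i: "integrable (Pi\<^sub>M {..<Suc q} (\<lambda>_. \<nu>)) \<Phi>"
      using Suc.prems m by (intro P.integrable_const_bound[of _ B]) (auto simp: sum_lipschitz_def)
    have "integral\<^sup>L (Pi\<^sub>M {..<Suc q} (\<lambda>_. \<nu>)) \<Phi> = (\<integral>x. (\<integral>u. \<Phi> (x(q := u)) \<partial>\<nu>) \<partial>Pi\<^sub>M {..<q} (\<lambda>_. \<nu>))"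
      using i unfolding ins by (intro product_integral_insert) auto
    also have "\<dots> = iterated_integral \<nu> (Suc q) \<Phi>"
      unfolding iterated_integral.simps by (rule Suc.IH[OF sum_lipschitz_integrate[OF Suc.prems \<nu>]])
    finally show ?case .
  }
qed

lemma expectation_indep:
  fixes G :: "nat \<Rightarrow> 'b \<Rightarrow> real"
  assumes N: "prob_space N" and G: "\<And>i. i < q \<Longrightarrow> G i \<in> borel_measurable N" "\<And>i. i < q \<Longrightarrow> distr N borel (G i) = \<nu>"
    and ind: "prob_space.indep_vars N (\<lambda>_. borel) G {..<q}" and q: "q > 0"
    and \<nu>: "real_distribution \<nu>" and \<Phi>: "sum_lipschitz q K B \<Phi>"
  shows "(\<integral>\<omega>. \<Phi> (\<lambda>i. G i \<omega>) \<partial>N) = iterated_integral \<nu> q \<Phi>"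
proof -
  interpret prob_space N by fact
  have ne: "{..<q} \<noteq> {}" using q by auto
  have dist: "distr N (Pi\<^sub>M {..<q} (\<lambda>_. borel)) (\<lambda>\<omega>. \<lambda>i\<in>{..<q}. G i \<omega>) = Pi\<^sub>M {..<q} (\<lambda>i. distr N borel (G i))"
    using ind indep_vars_iff_distr_eq_PiM'[OF ne, where X = G and M' = "\<lambda>_. borel"] G(1) by simp
  also have "\<dots> = Pi\<^sub>M {..<q} (\<lambda>_. \<nu>)" using G(2) by (intro PiM_cong) auto
  finally have dist: "distr N (Pi\<^sub>M {..<q} (\<lambda>_. borel)) (\<lambda>\<omega>. \<lambda>i\<in>{..<q}. G i \<omega>) = Pi\<^sub>M {..<q} (\<lambda>_. \<nu>)" .
  have m: "\<Phi> \<in> borel_measurable (Pi\<^sub>M {..<q} (\<lambda>_. borel))"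
    by (rule sum_lipschitz_measurable_PiM[OF \<Phi>]) simp
  have "(\<integral>\<omega>. \<Phi> (\<lambda>i. G i \<omega>) \<partial>N) = (\<integral>\<omega>. \<Phi> (\<lambda>i\<in>{..<q}. G i \<omega>) \<partial>N)"
    by (intro Bochner_Integration.integral_cong refl sum_lipschitz_cong[OF \<Phi>]) simp
  also have "\<dots> = integral\<^sup>L (distr N (Pi\<^sub>M {..<q} (\<lambda>_. borel)) (\<lambda>\<omega>. \<lambda>i\<in>{..<q}. G i \<omega>)) \<Phi>"
    by (rule integral_distr[symmetric, OF measurable_restrict m]) (use G(1) in auto)
  also have "\<dots> = iterated_integral \<nu> q \<Phi>" unfolding dist by (rule iterated_integral_PiM[OF \<nu> \<Phi>])
  finally show ?thesis .
qed

section \<open>Polygonal skeletons of paths\<close>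

text \<open>
  Continuous path that starts at \<open>0\<close> and is linear on cells of length \<open>\<delta>\<close>, with increment \<open>x j\<close> over the
  cell number \<open>j\<close>. It is constant after \<open>q\<close> cells.
\<close>
definition skeleton :: "nat \<Rightarrow> real \<Rightarrow> (nat \<Rightarrow> real) \<Rightarrow> real \<Rightarrow> real" where
  "skeleton q \<delta> x t = (\<Sum>j<q. x j * min 1 (max 0 (t / \<delta> - real j)))"

lemma skeleton_continuous: "continuous_on S (skeleton q \<delta> x)"
  unfolding skeleton_def divide_inverse by (intro continuous_intros)

lemma skeleton_lipschitz: "\<bar>skeleton q \<delta> x t - skeleton q \<delta> y t\<bar> \<le> (\<Sum>j<q. \<bar>x j - y j\<bar>)"
proof -
  have "skeleton q \<delta> x t - skeleton q \<delta> y t = (\<Sum>j<q. (x j - y j) * min 1 (max 0 (t / \<delta> - real j)))"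
    by (simp add: skeleton_def sum_subtractf left_diff_distrib)
  also have "\<bar>\<dots>\<bar> \<le> (\<Sum>j<q. \<bar>(x j - y j) * min 1 (max 0 (t / \<delta> - real j))\<bar>)" by (rule sum_abs)
  also have "\<dots> \<le> (\<Sum>j<q. \<bar>x j - y j\<bar>)"
  proof (rule sum_mono)
    fix j
    have "\<bar>min 1 (max 0 (t / \<delta> - real j))\<bar> \<le> 1" by auto
    then show "\<bar>(x j - y j) * min 1 (max 0 (t / \<delta> - real j))\<bar> \<le> \<bar>x j - y j\<bar>"
      unfolding abs_mult by (rule mult_left_le) simp
  qed
  finally show ?thesis .
qed

lemma skeleton_interpolates:
  assumes V: "V 0 = (0::real)" and j: "j < q" "real j \<le> t / \<delta>" "t / \<delta> \<le> real j + 1"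
  shows "skeleton q \<delta> (\<lambda>i. V (Suc i) - V i) t = V j + (V (Suc j) - V j) * (t / \<delta> - real j)"
proof -
  let ?c = "\<lambda>i. (V (Suc i) - V i) * min 1 (max 0 (t / \<delta> - real i))"
  have "skeleton q \<delta> (\<lambda>i. V (Suc i) - V i) t = (\<Sum>i<Suc j. ?c i)"
    unfolding skeleton_def
  proof (rule sum.mono_neutral_right)
    show "\<forall>i\<in>{..<q} - {..<Suc j}. ?c i = 0"
    proof
      fix i assume "i \<in> {..<q} - {..<Suc j}"
      then have "real j + 1 \<le> real i" by auto
      then show "?c i = 0" using j by auto
    qed
  qed (use j in auto)
  also have "\<dots> = (\<Sum>i<j. V (Suc i) - V i) + ?c j"
  proof -
    have "?c i = V (Suc i) - V i" if "i < j" for i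
    proof -
      have "real i + 1 \<le> real j" using that by auto
      then have "min 1 (max 0 (t / \<delta> - real i)) = 1" using j by auto
      then show ?thesis by simp
    qed
    then have "(\<Sum>i<j. ?c i) = (\<Sum>i<j. V (Suc i) - V i)" by (intro sum.cong) auto
    then show ?thesis by (simp only: sum.lessThan_Suc)
  qed
  also have "(\<Sum>i<j. V (Suc i) - V i) = V j" using V by (simp add: sum_lessThan_telescope)
  also have "?c j = (V (Suc j) - V j) * (t / \<delta> - real j)" using j by auto
  finally show ?thesis .
qed

lemma skeleton_near_node:
  assumes V: "V 0 = (0::real)" and j: "j < q" "real j \<le> t / \<delta>" "t / \<delta> \<le> real j + 1"
  shows "\<bar>skeleton q \<delta> (\<lambda>i. V (Suc i) - V i) t - V j\<bar> \<le> \<bar>V (Suc j) - V j\<bar>"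
proof -
  have "\<bar>V (Suc j) - V j\<bar> * \<bar>t / \<delta> - real j\<bar> \<le> \<bar>V (Suc j) - V j\<bar>"
    using j by (intro mult_left_le) auto
  then show ?thesis unfolding skeleton_interpolates[of V, OF V j] by (simp add: abs_mult)
qed

lemma cell_exists:
  assumes "0 < \<delta>" "0 \<le> t" "t \<le> real q * \<delta>" "0 < q"
  shows "\<exists>j<q. real j \<le> t / \<delta> \<and> t / \<delta> \<le> real j + 1"
proof (cases "t / \<delta> < real q")
  case True
  let ?j = "nat \<lfloor>t / \<delta>\<rfloor>"
  have nn: "0 \<le> t / \<delta>" using assms by simp
  then have "real ?j \<le> t / \<delta>" "t / \<delta> < real ?j + 1" by simp_all
  moreover from this True have "?j < q" by linarith
  ultimately show ?thesis by (intro exI[of _ ?j]) auto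
next
  case False
  have "t / \<delta> \<le> real q" using assms by (simp add: pos_divide_le_eq)
  then show ?thesis using False assms by (intro exI[of _ "q - 1"]) (auto simp: of_nat_diff)
qed

lemma interpolated_walk_formula:
  fixes k :: nat and \<theta> :: real
  assumes "dt > 0" "t \<ge> 0" and k: "k = nat \<lfloor>t / dt\<rfloor>" and \<theta>: "\<theta> = t / dt - real k"
  shows "interpolated_walk dx dt Y t \<omega> = dx * ((1 - \<theta>) * walk Y k \<omega> + \<theta> * walk Y (Suc k) \<omega>)"
    and "0 \<le> \<theta>" "\<theta> \<le> 1"
proof -
  have nn: "0 \<le> t / dt" using assms by simp
  then have kr: "real_of_int \<lfloor>t / dt\<rfloor> = real k" by (simp add: k)
  show "0 \<le> \<theta>" "\<theta> \<le> 1" using nn unfolding \<theta> k by (simp_all add: le_diff_eq) linarith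
  have f: "normalized_walk dx dt Y (dt * real k) \<omega> = dx * walk Y k \<omega>"
    "normalized_walk dx dt Y (dt * (real k + 1)) \<omega> = dx * walk Y (Suc k) \<omega>"
  proof -
    have "nat \<lfloor>dt * (real k + 1) / dt\<rfloor> = Suc k"
    proof -
      have "dt * (real k + 1) / dt = real (Suc k)" using assms by simp
      then show ?thesis by (simp only: floor_of_nat nat_int)
    qed
    then show "normalized_walk dx dt Y (dt * (real k + 1)) \<omega> = dx * walk Y (Suc k) \<omega>"
      by (simp only: normalized_walk_def)
  qed (use assms in \<open>simp add: normalized_walk_def\<close>)
  show "interpolated_walk dx dt Y t \<omega> = dx * ((1 - \<theta>) * walk Y k \<omega> + \<theta> * walk Y (Suc k) \<omega>)"
    unfolding interpolated_walk_def linear_interpolation_def Let_def kr f \<theta>[symmetric]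
    by (simp add: algebra_simps)
qed

lemma centered_sum_append: "centered_sum m (l @ l') = centered_sum m l + centered_sum m l'"
  by (simp add: centered_sum_def)

lemma walk_centered_sum:
  assumes "k \<le> n"
  shows "walk Y k \<omega> = real_of_int (Y 0 \<omega>) + centered_sum m (take k (map (\<lambda>i. Y (Suc i) \<omega>) [0..<n])) + real k * m"
proof -
  have "centered_sum m (take k (map (\<lambda>i. Y (Suc i) \<omega>) [0..<n])) = (\<Sum>i<k. real_of_int (Y (Suc i) \<omega>) - m)"
    using assms by (simp add: centered_sum_def take_map interv_sum_list_conv_sum_set_nat o_def atLeast0LessThan)
  moreover have "walk Y k \<omega> = real_of_int (Y 0 \<omega>) + (\<Sum>i<k. real_of_int (Y (Suc i) \<omega>))"
    unfolding walk_def by (simp add: sum.atMost_shift)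
  ultimately show ?thesis by (simp add: sum_subtractf)
qed

lemma interpolated_walk_centered_sum:
  fixes k :: nat and \<theta> :: real
  assumes "dt > 0" "t \<ge> 0" and k: "k = nat \<lfloor>t / dt\<rfloor>" and \<theta>: "\<theta> = t / dt - real k" and n: "Suc k \<le> n"
    and l: "l = map (\<lambda>i. Y (Suc i) \<omega>) [0..<n]"
  shows "interpolated_walk dx dt Y t \<omega> = dx * real_of_int (Y 0 \<omega>)
     + ((1 - \<theta>) * (dx * centered_sum m (take k l)) + \<theta> * (dx * centered_sum m (take (Suc k) l))) + dx * m * (t / dt)"
proof -
  have t: "t / dt = \<theta> + real k" by (simp add: \<theta>)
  have "k \<le> n" using n by simp
  then show ?thesis
    unfolding interpolated_walk_formula(1)[OF assms(1-4)] l t walk_centered_sum[OF n, of Y \<omega> m] walk_centered_sum[OF \<open>k \<le> n\<close>, of Y \<omega> m]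
    by (simp add: algebra_simps)
qed

lemma convex_comb_close:
  fixes x y z e :: real
  assumes "0 \<le> \<theta>" "\<theta> \<le> 1" "\<bar>x - z\<bar> \<le> e" "\<bar>y - z\<bar> \<le> e"
  shows "\<bar>(1 - \<theta>) * x + \<theta> * y - z\<bar> \<le> e"
proof -
  have "(1 - \<theta>) * x + \<theta> * y - z = (1 - \<theta>) * (x - z) + \<theta> * (y - z)" by (simp add: algebra_simps)
  also have "\<bar>\<dots>\<bar> \<le> (1 - \<theta>) * \<bar>x - z\<bar> + \<theta> * \<bar>y - z\<bar>"
    using assms by (intro order_trans[OF abs_triangle_ineq]) (simp add: abs_mult)
  also have "\<dots> \<le> (1 - \<theta>) * e + \<theta> * e" using assms by (intro add_mono mult_left_mono) auto
  finally show ?thesis by (simp add: algebra_simps)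
qed

lemma centered_sum_block:
  assumes "k \<le> L"
  shows "centered_sum m (take (j * L + k) l) = centered_sum m (take (j * L) l) + centered_sum m (take k (block L j l))"
  unfolding take_add centered_sum_append using assms by (simp add: block_def min_absorb1)

text \<open>
  A cell of length \<open>\<delta>\<close> contains \<open>\<delta> / dt\<close> time steps of the walk, and the blocks use only the integer part
  \<open>L\<close> of this number. Up to the end of the cell number \<open>j\<close> the walk is therefore up to \<open>j + 1\<close> steps ahead of
  the blocks, which is at most one further block if \<open>q \<le> L\<close>. This is the reason for the
  \<open>q + 1\<close> blocks.
\<close>
lemma path_near_skeleton:
  fixes L q :: nat
  assumes dx: "dx > 0" and dt: "dt > 0" and \<delta>: "\<delta> > 0" and q: "0 < q" and L: "L = nat \<lfloor>\<delta> / dt\<rfloor>" "q \<le> L"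
    and l: "l = map (\<lambda>i. Y (Suc i) \<omega>) [0..<Suc q * L]"
    and good: "\<And>j k. j \<le> q \<Longrightarrow> k \<le> L \<Longrightarrow> dx * \<bar>centered_sum m (take k (block L j l))\<bar> \<le> e"
    and t: "0 \<le> t" "t \<le> real q * \<delta>"
  shows "\<bar>interpolated_walk dx dt Y t \<omega> - dx * real_of_int (Y 0 \<omega>) - dx * m * (t / dt)
    - skeleton q \<delta> (\<lambda>j. dx * centered_sum m (block L j l)) t\<bar> \<le> 3 * e"
proof -
  define V where "V = (\<lambda>j. dx * centered_sum m (take (j * L) l))"
  have V0: "V 0 = 0" by (simp add: V_def centered_sum_def)
  have near1: "\<bar>dx * centered_sum m (take (j * L + k) l) - V j\<bar> \<le> e" if "j \<le> q" "k \<le> L" for j k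
    using good[OF that] dx unfolding centered_sum_block[OF that(2)] V_def
    by (simp add: abs_mult flip: right_diff_distrib)
  have incr: "V (Suc j) - V j = dx * centered_sum m (block L j l)" for j
    using centered_sum_block[of L L m j l] by (simp add: V_def block_def add.commute distrib_left)
  have incr_le: "\<bar>V (Suc j) - V j\<bar> \<le> e" if "j \<le> q" for j
    using near1[OF that, of L] by (simp add: V_def add.commute)
  have near2: "\<bar>dx * centered_sum m (take i l) - V j\<bar> \<le> 2 * e" if j: "j < q" and i: "j * L \<le> i" "i \<le> j * L + 2 * L" for i j
  proof (cases "i \<le> j * L + L")
    case True
    have "\<bar>dx * centered_sum m (take (j * L + (i - j * L)) l) - V j\<bar> \<le> e" using True j by (intro near1) auto
    moreover have "0 \<le> e" using incr_le[of 0] by linarith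
    ultimately show ?thesis using i by simp
  next
    case False
    have "\<bar>dx * centered_sum m (take (Suc j * L + (i - Suc j * L)) l) - V (Suc j)\<bar> \<le> e" using i j by (intro near1) auto
    moreover have "Suc j * L + (i - Suc j * L) = i" using False by simp
    ultimately show ?thesis using incr_le[of j] j by simp
  qed
  obtain j where j: "j < q" "real j \<le> t / \<delta>" "t / \<delta> \<le> real j + 1" using cell_exists[OF \<delta> t q] by blast
  define k where "k = nat \<lfloor>t / dt\<rfloor>"
  define \<theta> where "\<theta> = t / dt - real k"
  note \<theta> = interpolated_walk_formula(2,3)[OF dt t(1) k_def \<theta>_def]
  have Lr: "real L \<le> \<delta> / dt" "\<delta> / dt < real L + 1" using \<delta> dt by (simp_all add: L)
  have tdt: "t / dt = t / \<delta> * (\<delta> / dt)" using \<delta> by simp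
  have "real j * real L \<le> t / \<delta> * (\<delta> / dt)" using j Lr by (intro mult_mono) auto
  then have "real (j * L) \<le> t / dt" by (simp only: tdt of_nat_mult)
  moreover have "t / dt < real (Suc k)"
  proof -
    have "0 \<le> t / dt" using t dt by simp
    then show ?thesis unfolding k_def by simp linarith
  qed
  ultimately have "real (j * L) < real (Suc k)" by linarith
  then have lo0: "j * L < Suc k" by (simp only: of_nat_less_iff)
  then have lo: "j * L \<le> k" by simp
  have "t / \<delta> * (\<delta> / dt) < (real j + 1) * (real L + 1)"
  proof -
    have "t / \<delta> * (\<delta> / dt) \<le> (real j + 1) * (\<delta> / dt)" using j \<delta> dt by (intro mult_right_mono) auto
    also have "\<dots> < (real j + 1) * (real L + 1)" using Lr by (intro mult_strict_left_mono) auto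
    finally show ?thesis .
  qed
  then have "real k < real (Suc j * Suc L)" using \<theta> unfolding \<theta>_def tdt by (simp add: algebra_simps)
  then have "k < Suc j * Suc L" by (simp only: of_nat_less_iff)
  then have hi: "Suc k \<le> j * L + 2 * L" using j L(2) by simp
  have "j * L + 2 * L \<le> Suc q * L"
  proof -
    have "(j + 2) * L \<le> Suc q * L" using j by (intro mult_right_mono) auto
    then show ?thesis by (simp add: algebra_simps)
  qed
  with hi have kn: "Suc k \<le> Suc q * L" by linarith
  have "\<bar>((1 - \<theta>) * (dx * centered_sum m (take k l)) + \<theta> * (dx * centered_sum m (take (Suc k) l))) - V j\<bar> \<le> 2 * e"
    by (rule convex_comb_close[OF \<theta>]) (use near2[OF j(1)] lo hi in auto)
  moreover have "\<bar>skeleton q \<delta> (\<lambda>j. dx * centered_sum m (block L j l)) t - V j\<bar> \<le> e"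
    using skeleton_near_node[of V, OF V0 j] incr_le[of j] j unfolding incr by linarith
  ultimately show ?thesis
    unfolding interpolated_walk_centered_sum[where dx = dx and m = m and Y = Y and \<omega> = \<omega>, OF dt t(1) k_def \<theta>_def kn l] by linarith
qed

section \<open>The interpolated walk and Brownian motion as random paths\<close>

lemma markov_chain_expectation:
  fixes h :: "int list \<Rightarrow> real"
  assumes mc: "markov_chain M {-1, 1} (walk_transition a b) Y"
    and ab: "a \<in> {0..1}" "b \<in> {0..1}"
    and y: "\<And>\<omega>. \<omega> \<in> space M \<Longrightarrow> Y 0 \<omega> = y" "y \<in> {-1, 1}"
  shows "(\<integral>\<omega>. h (map (\<lambda>i. Y (Suc i) \<omega>) [0..<n]) \<partial>M) = path_mean a b n y h"
    and "integrable M (\<lambda>\<omega>. h (map (\<lambda>i. Y (Suc i) \<omega>) [0..<n]))"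
proof -
  have law: "(\<lambda>\<omega>. map (\<lambda>i. Y (Suc i) \<omega>) [0..<n]) \<in> M \<rightarrow>\<^sub>M count_space UNIV"
    "distr M (count_space UNIV) (\<lambda>\<omega>. map (\<lambda>i. Y (Suc i) \<omega>) [0..<n]) = measure_pmf (path_pmf a b n y)"
    using markov_chain_law[where M = M and Y = Y and y = y and a = a and b = b and n = n] mc ab y by simp_all
  have m: "h \<in> borel_measurable (count_space UNIV)" by simp
  show "(\<integral>\<omega>. h (map (\<lambda>i. Y (Suc i) \<omega>) [0..<n]) \<partial>M) = path_mean a b n y h"
    by (rule trans[OF integral_distr[OF law(1) m, symmetric]]) (simp only: law(2))
  have "integrable (distr M (count_space UNIV) (\<lambda>\<omega>. map (\<lambda>i. Y (Suc i) \<omega>) [0..<n])) h"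
    unfolding law(2) by simp
  then show "integrable M (\<lambda>\<omega>. h (map (\<lambda>i. Y (Suc i) \<omega>) [0..<n]))"
    by (subst (asm) integrable_distr_eq[OF law(1) m])
qed

text \<open>
  Union bound: given the past, every block is a walk started from one of the two states.
\<close>
lemma some_block_bad:
  assumes bound: "\<And>y. y \<in> {-1, 1} \<Longrightarrow> path_mean a b L y (\<lambda>l. of_bool (A l) :: real) \<le> p"
    and y: "y \<in> {-1, 1}"
  shows "path_mean a b (q * L) y (\<lambda>l. of_bool (\<exists>j<q. A (block L j l)) :: real) \<le> real q * p"
proof (induction q)
  case (Suc q)
  let ?E = "\<lambda>k y. path_mean a b k y"
  have "?E (Suc q * L) y (\<lambda>l. of_bool (\<exists>j<Suc q. A (block L j l)) :: real)
      = ?E (q * L + L) y (\<lambda>l. of_bool (\<exists>j<Suc q. A (block L j l)))" by (simp add: add.commute)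
  also have "\<dots> = ?E (q * L) y (\<lambda>l. ?E L (last (y # l)) (\<lambda>l'. of_bool (\<exists>j<Suc q. A (block L j (l @ l')))))"
    by (rule expectation_path_add)
  also have "\<dots> \<le> ?E (q * L) y (\<lambda>l. of_bool (\<exists>j<q. A (block L j l)) + p)"
  proof (intro integral_mono_AE AE_pmfI)
    fix l assume l: "l \<in> set_pmf (path_pmf a b (q * L) y)"
    have "?E L (last (y # l)) (\<lambda>l'. of_bool (\<exists>j<Suc q. A (block L j (l @ l'))) :: real)
      \<le> ?E L (last (y # l)) (\<lambda>l'. of_bool (\<exists>j<q. A (block L j l)) + of_bool (A l'))"
    proof (intro integral_mono_AE AE_pmfI)
      fix l' assume l': "l' \<in> set_pmf (path_pmf a b L (last (y # l)))"
      note ba = block_append[OF set_path_pmf(1)[OF l] set_path_pmf(1)[OF l']]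
      have "(\<exists>j<Suc q. A (block L j (l @ l'))) \<longleftrightarrow> (\<exists>j<q. A (block L j l)) \<or> A l'"
        using ba by (auto simp: less_Suc_eq)
      then show "(of_bool (\<exists>j<Suc q. A (block L j (l @ l'))) :: real) \<le> of_bool (\<exists>j<q. A (block L j l)) + of_bool (A l')"
        by auto
    qed simp_all
    also have "\<dots> = of_bool (\<exists>j<q. A (block L j l)) + ?E L (last (y # l)) (\<lambda>l'. of_bool (A l'))" by simp
    also have "\<dots> \<le> of_bool (\<exists>j<q. A (block L j l)) + p" using bound[OF last_in_states[OF y l]] by simp
    finally show "?E L (last (y # l)) (\<lambda>l'. of_bool (\<exists>j<Suc q. A (block L j (l @ l'))) :: real)
       \<le> of_bool (\<exists>j<q. A (block L j l)) + p" .
  qed simp_all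
  also have "\<dots> = ?E (q * L) y (\<lambda>l. of_bool (\<exists>j<q. A (block L j l))) + p" by simp
  also have "\<dots> \<le> real (Suc q) * p" using Suc by (simp add: algebra_simps)
  finally show ?case .
qed simp

lemma interpolated_walk_measurable:
  assumes mc: "markov_chain M {-1, 1} p Y"
  shows "(\<lambda>\<omega>. interpolated_walk dx dt Y t \<omega>) \<in> borel_measurable M"
proof -
  have "Y i \<in> M \<rightarrow>\<^sub>M count_space {-1, 1}" for i using mc by (simp add: markov_chain_def)
  then have "(\<lambda>\<omega>. real_of_int (Y i \<omega>)) \<in> borel_measurable M" for i
    by (rule measurable_compose) simp
  then show ?thesis
    unfolding interpolated_walk_def linear_interpolation_def normalized_walk_def walk_def Let_def
    by measurable
qed

text \<open>
  Near any time the interpolated walk agrees with a skeleton of mesh \<open>dt\<close> with enough cells.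
\<close>
lemma interpolated_walk_continuous:
  assumes dt: "dt > 0"
  shows "continuous_on {0..} (\<lambda>t. interpolated_walk dx dt Y t \<omega>)"
  unfolding continuous_on_eq_continuous_within
proof
  fix t :: real assume t: "t \<in> {0..}"
  define V where "V = (\<lambda>i. walk Y i \<omega> - walk Y 0 \<omega>)"
  obtain q :: nat where q: "t / dt + 1 < real q" using reals_Archimedean2 by blast
  let ?g = "\<lambda>s. dx * (walk Y 0 \<omega> + skeleton q dt (\<lambda>i. V (Suc i) - V i) s)"
  have eq: "?g s = interpolated_walk dx dt Y s \<omega>" if s: "s \<in> {0..}" "dist s t < dt" for s
  proof -
    define k where "k = nat \<lfloor>s / dt\<rfloor>"
    have "s / dt < t / dt + 1" using s dt by (simp add: dist_real_def field_simps)
    then have sq: "s / dt < real q" using q by linarith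
    have nn: "0 \<le> s / dt" using s dt by simp
    then have k: "real k \<le> s / dt" "s / dt \<le> real k + 1" unfolding k_def by simp_all
    with sq have kq: "k < q" by linarith
    have sk: "skeleton q dt (\<lambda>i. V (Suc i) - V i) s = V k + (V (Suc k) - V k) * (s / dt - real k)"
      by (rule skeleton_interpolates[of V, OF _ kq k]) (simp add: V_def)
    have "0 \<le> s" using s by simp
    then show ?thesis
      unfolding sk interpolated_walk_formula(1)[OF dt \<open>0 \<le> s\<close> k_def refl, of dx Y \<omega>]
      by (simp add: V_def algebra_simps)
  qed
  show "continuous (at t within {0..}) (\<lambda>t. interpolated_walk dx dt Y t \<omega>)"
  proof (rule continuous_transform_within[OF _ dt t eq])
    have "continuous_on {0..} ?g" by (intro continuous_intros skeleton_continuous)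
    then show "continuous (at t within {0..}) ?g" using t by (simp add: continuous_on_eq_continuous_within)
  qed
qed

lemma path_of_continuous_paths:
  assumes "continuous_on {0..} (\<lambda>t. \<xi> t \<omega>)"
  shows "path_of \<xi> \<omega> \<in> continuous_paths"
  using continuous_on_eq[OF assms, of "path_of \<xi> \<omega>"] by (simp add: continuous_paths_def path_of_def)

lemma path_of_measurable:
  assumes "\<And>\<omega>. \<omega> \<in> space M \<Longrightarrow> continuous_on {0..} (\<lambda>t. \<xi> t \<omega>)"
    and "\<And>t. t \<ge> 0 \<Longrightarrow> \<xi> t \<in> borel_measurable M"
  shows "path_of \<xi> \<in> M \<rightarrow>\<^sub>M borel_of path_topology"
proof (rule measurable_into_path_space)
  show "path_of \<xi> \<omega> \<in> continuous_paths" if "\<omega> \<in> space M" for \<omega>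
    by (rule path_of_continuous_paths[of \<xi> \<omega>, OF assms(1)[OF that]])
next
  fix t :: real assume "t \<ge> 0"
  then show "(\<lambda>\<omega>. path_of \<xi> \<omega> t) \<in> borel_measurable M"
    using assms(2) by (simp add: path_of_def)
qed

lemma brownian_increment_law:
  assumes W: "standard_brownian_motion N W" and st: "0 \<le> s" "s < t"
  shows "distr N borel (\<lambda>\<omega>. \<sigma> * (W t \<omega> - W s \<omega>)) = gaussian_law (\<sigma> * sqrt (t - s))"
proof -
  interpret prob_space N using W by (simp add: standard_brownian_motion_def)
  have pos: "0 < sqrt (t - s)" using st by simp
  have "distributed N lborel (\<lambda>\<omega>. W t \<omega> - W s \<omega>) (normal_density 0 (sqrt (t - s)))"
    using W st unfolding standard_brownian_motion_def by blast
  then have d: "distributed N lborel (\<lambda>\<omega>. (W t \<omega> - W s \<omega> - 0) / sqrt (t - s)) std_normal_density"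
    using normal_standard_normal_convert[OF pos, of "\<lambda>\<omega>. W t \<omega> - W s \<omega>" 0] by blast
  let ?Z = "\<lambda>\<omega>. (W t \<omega> - W s \<omega> - 0) / sqrt (t - s)"
  have m: "?Z \<in> N \<rightarrow>\<^sub>M lborel" and law: "distr N lborel ?Z = std_normal_distribution"
    using d by (auto dest: distributed_measurable distributed_distr_eq_density)
  have "gaussian_law (\<sigma> * sqrt (t - s)) = distr N borel (\<lambda>\<omega>. \<sigma> * sqrt (t - s) * ?Z \<omega>)"
    unfolding gaussian_law_def law[symmetric] using m by (subst distr_distr) (auto simp: comp_def)
  also have "(\<lambda>\<omega>. \<sigma> * sqrt (t - s) * ?Z \<omega>) = (\<lambda>\<omega>. \<sigma> * (W t \<omega> - W s \<omega>))"
    using pos by auto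
  finally show ?thesis by simp
qed


lemma block_length_limit:
  assumes d: "\<And>n. d n > 0" "d \<longlonglongrightarrow> 0" and r: "r > 0" and \<delta>: "\<delta> > 0"
  shows "(\<lambda>n. real (nat \<lfloor>\<delta> / ((d n)\<^sup>2 / r)\<rfloor>) * (d n)\<^sup>2) \<longlonglongrightarrow> \<delta> * r"
proof (rule tendsto_sandwich)
  have fl: "x - 1 \<le> real (nat \<lfloor>x\<rfloor>)" "real (nat \<lfloor>x\<rfloor>) \<le> x" if "0 \<le> x" for x :: real
    using that by linarith+
  have nn: "0 \<le> \<delta> / ((d n)\<^sup>2 / r)" for n using \<delta> r by simp
  have eq: "\<delta> / ((d n)\<^sup>2 / r) * (d n)\<^sup>2 = \<delta> * r" for n using d(1)[of n] r by simp
  show "\<forall>\<^sub>F n in sequentially. \<delta> * r - (d n)\<^sup>2 \<le> real (nat \<lfloor>\<delta> / ((d n)\<^sup>2 / r)\<rfloor>) * (d n)\<^sup>2"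
  proof (rule always_eventually, rule allI)
    fix n
    have "(\<delta> / ((d n)\<^sup>2 / r) - 1) * (d n)\<^sup>2 \<le> real (nat \<lfloor>\<delta> / ((d n)\<^sup>2 / r)\<rfloor>) * (d n)\<^sup>2"
      by (intro mult_right_mono fl nn) simp
    then show "\<delta> * r - (d n)\<^sup>2 \<le> real (nat \<lfloor>\<delta> / ((d n)\<^sup>2 / r)\<rfloor>) * (d n)\<^sup>2"
      unfolding left_diff_distrib eq by simp
  qed
  show "\<forall>\<^sub>F n in sequentially. real (nat \<lfloor>\<delta> / ((d n)\<^sup>2 / r)\<rfloor>) * (d n)\<^sup>2 \<le> \<delta> * r"
  proof (rule always_eventually, rule allI)
    fix n
    have "real (nat \<lfloor>\<delta> / ((d n)\<^sup>2 / r)\<rfloor>) * (d n)\<^sup>2 \<le> \<delta> / ((d n)\<^sup>2 / r) * (d n)\<^sup>2"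
      by (intro mult_right_mono fl nn) simp
    then show "real (nat \<lfloor>\<delta> / ((d n)\<^sup>2 / r)\<rfloor>) * (d n)\<^sup>2 \<le> \<delta> * r" unfolding eq .
  qed
  have "(\<lambda>n. \<delta> * r - (d n)\<^sup>2) \<longlonglongrightarrow> \<delta> * r - 0\<^sup>2" by (intro tendsto_intros d(2))
  then show "(\<lambda>n. \<delta> * r - (d n)\<^sup>2) \<longlonglongrightarrow> \<delta> * r" by simp
qed simp

definition skeleton_functional :: "((real \<Rightarrow> real) \<Rightarrow> real) \<Rightarrow> real \<Rightarrow> nat \<Rightarrow> real \<Rightarrow> (nat \<Rightarrow> real) \<Rightarrow> real" where
  "skeleton_functional F \<mu> q \<delta> x = F (restrict (\<lambda>t. \<mu> * t + skeleton q \<delta> x t) {0..})"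

lemma skeleton_path: "restrict (\<lambda>t. \<mu> * t + skeleton q \<delta> x t) {0..} \<in> continuous_paths"
proof -
  have "continuous_on {0..} (\<lambda>t. \<mu> * t + skeleton q \<delta> x t)"
    by (intro continuous_intros skeleton_continuous)
  then have "continuous_on {0..} (restrict (\<lambda>t. \<mu> * t + skeleton q \<delta> x t) {0..})"
    by (rule continuous_on_eq) simp
  then show ?thesis by (simp add: continuous_paths_def)
qed

lemma skeleton_functional_sum_lipschitz:
  assumes F: "sup_lipschitz T K F" "\<And>x. x \<in> continuous_paths \<Longrightarrow> \<bar>F x\<bar> \<le> B" and K: "K \<ge> 0" and q: "q \<le> q'"
  shows "sum_lipschitz q' K B (skeleton_functional F \<mu> q \<delta>)"
  unfolding sum_lipschitz_def
proof (intro conjI allI)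
  fix x y :: "nat \<Rightarrow> real"
  show "\<bar>skeleton_functional F \<mu> q \<delta> x\<bar> \<le> B"
    unfolding skeleton_functional_def by (rule F(2)[OF skeleton_path])
  have "\<bar>restrict (\<lambda>t. \<mu> * t + skeleton q \<delta> x t) {0..} t - restrict (\<lambda>t. \<mu> * t + skeleton q \<delta> y t) {0..} t\<bar>
      \<le> (\<Sum>j<q. \<bar>x j - y j\<bar>)" if "t \<in> {0..T}" for t
    using skeleton_lipschitz[of q \<delta> x t y] that by simp
  then have "\<bar>skeleton_functional F \<mu> q \<delta> x - skeleton_functional F \<mu> q \<delta> y\<bar> \<le> K * (\<Sum>j<q. \<bar>x j - y j\<bar>)"
    using F(1) skeleton_path unfolding skeleton_functional_def sup_lipschitz_def by blast
  also have "\<dots> \<le> K * (\<Sum>j<q'. \<bar>x j - y j\<bar>)"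
    using K q by (intro mult_left_mono sum_mono2) auto
  finally show "\<bar>skeleton_functional F \<mu> q \<delta> x - skeleton_functional F \<mu> q \<delta> y\<bar> \<le> K * (\<Sum>j<q'. \<bar>x j - y j\<bar>)" .
qed

text \<open>
  Pathwise, uniform continuity on \<open>[0, T]\<close> makes the skeleton of mesh \<open>T / (q + 1)\<close> converge uniformly to
  the path. The means then converge by dominated convergence.
\<close>
lemma scaled_brownian_skeleton_limit:
  assumes W: "standard_brownian_motion N W"
    and F: "sup_lipschitz T K F" "\<And>x. x \<in> continuous_paths \<Longrightarrow> \<bar>F x\<bar> \<le> B" and K: "K \<ge> 0" and T: "T > 0"
  shows "(\<lambda>q. \<integral>\<omega>. skeleton_functional F \<mu> (Suc q) (T / Suc q)
        (\<lambda>j. \<sigma> * (W (real (Suc j) * (T / Suc q)) \<omega> - W (real j * (T / Suc q)) \<omega>)) \<partial>N)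
    \<longlonglongrightarrow> (\<integral>\<omega>. F (path_of (\<lambda>t \<omega>. \<mu> * t + \<sigma> * W t \<omega>) \<omega>) \<partial>N)"
proof (rule integral_dominated_convergence[where w = "\<lambda>_. B"])
  interpret prob_space N using W by (simp add: standard_brownian_motion_def)
  have Wm: "W t \<in> borel_measurable N" if "t \<ge> 0" for t using W that by (simp add: standard_brownian_motion_def)
  have W0: "W 0 \<omega> = 0" and Wc: "continuous_on {0..} (\<lambda>t. W t \<omega>)" if "\<omega> \<in> space N" for \<omega>
    using W that by (simp_all add: standard_brownian_motion_def)
  let ?X = "\<lambda>q \<omega> j. \<sigma> * (W (real (Suc j) * (T / Suc q)) \<omega> - W (real j * (T / Suc q)) \<omega>)"
  let ?p = "path_of (\<lambda>t \<omega>. \<mu> * t + \<sigma> * W t \<omega>)"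
  have pc: "?p \<omega> \<in> continuous_paths" if "\<omega> \<in> space N" for \<omega>
    by (intro path_of_continuous_paths continuous_intros Wc[OF that])
  have Fm: "F \<in> borel_measurable (borel_of path_topology)"
    by (intro continuous_map_borel_of_measurable sup_lipschitz_continuous[OF F(1) K])
  have "?p \<in> N \<rightarrow>\<^sub>M borel_of path_topology"
    by (rule path_of_measurable) (use Wc Wm in \<open>auto intro!: continuous_intros\<close>)
  then show "(\<lambda>\<omega>. F (?p \<omega>)) \<in> borel_measurable N" by (rule measurable_compose[OF _ Fm])
  show "(\<lambda>\<omega>. skeleton_functional F \<mu> (Suc q) (T / Suc q) (?X q \<omega>)) \<in> borel_measurable N" for q
  proof (rule measurable_compose[OF _ sum_lipschitz_measurable[OF skeleton_functional_sum_lipschitz[OF F K order_refl]]])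
    show "?X q \<in> borel_measurable N"
      by (rule measurable_coordinatewise_then_product) (use Wm T in \<open>auto intro!: borel_measurable_times borel_measurable_diff\<close>)
  qed
  show "AE \<omega> in N. norm (skeleton_functional F \<mu> (Suc q) (T / Suc q) (?X q \<omega>)) \<le> B" for q
    unfolding skeleton_functional_def using F(2)[OF skeleton_path] by simp
  show "AE \<omega> in N. (\<lambda>q. skeleton_functional F \<mu> (Suc q) (T / Suc q) (?X q \<omega>)) \<longlonglongrightarrow> F (?p \<omega>)"
  proof (rule AE_I2, rule LIMSEQ_I)
    fix \<omega> and e :: real assume \<omega>: "\<omega> \<in> space N" and e: "0 < e"
    define h where "h = e / (2 * (K + 1))"
    have h: "h > 0" "K * (2 * h) < e" using e K by (auto simp: h_def field_simps)
    have "continuous_on {0..T} (\<lambda>t. \<sigma> * W t \<omega>)"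
      by (intro continuous_intros continuous_on_subset[OF Wc[OF \<omega>]]) auto
    then have "uniformly_continuous_on {0..T} (\<lambda>t. \<sigma> * W t \<omega>)"
      by (rule compact_uniformly_continuous) simp
    then obtain \<gamma> where \<gamma>: "\<gamma> > 0"
      "\<And>s t. s \<in> {0..T} \<Longrightarrow> t \<in> {0..T} \<Longrightarrow> \<bar>s - t\<bar> < \<gamma> \<Longrightarrow> \<bar>\<sigma> * W s \<omega> - \<sigma> * W t \<omega>\<bar> < h"
      unfolding uniformly_continuous_on_def dist_real_def using h(1) by metis
    obtain q0 :: nat where q0: "T / \<gamma> < real q0" using reals_Archimedean2 by blast
    have "norm (skeleton_functional F \<mu> (Suc q) (T / Suc q) (?X q \<omega>) - F (?p \<omega>)) < e" if q: "q \<ge> q0" for q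
    proof -
      define \<delta> where "\<delta> = T / Suc q"
      have \<delta>: "\<delta> > 0" "real (Suc q) * \<delta> = T" using T by (simp_all add: \<delta>_def)
      have "T / \<gamma> < real (Suc q)" using q0 q by linarith
      then have \<delta>\<gamma>: "\<delta> < \<gamma>" using \<gamma>(1) by (simp add: \<delta>_def field_simps)
      define V where "V = (\<lambda>j. \<sigma> * W (real j * \<delta>) \<omega>)"
      have V0: "V 0 = 0" using W0[OF \<omega>] by (simp add: V_def)
      have X: "?X q \<omega> = (\<lambda>j. V (Suc j) - V j)" by (simp add: V_def \<delta>_def right_diff_distrib)
      have close: "\<bar>restrict (\<lambda>t. \<mu> * t + skeleton (Suc q) \<delta> (\<lambda>j. V (Suc j) - V j) t) {0..} t - ?p \<omega> t\<bar> \<le> 2 * h"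
        if t: "t \<in> {0..T}" for t
      proof -
        obtain j where j: "j < Suc q" "real j \<le> t / \<delta>" "t / \<delta> \<le> real j + 1"
          using cell_exists[OF \<delta>(1), of t "Suc q"] t \<delta>(2) by auto
        have jt: "real j * \<delta> \<le> t" "t \<le> real (Suc j) * \<delta>" using j \<delta>(1) by (simp_all add: field_simps)
        have jT: "real (Suc j) * \<delta> \<le> T"
        proof -
          have "real (Suc j) * \<delta> \<le> real (Suc q) * \<delta>" using j \<delta>(1) by (intro mult_right_mono) auto
          then show ?thesis using \<delta>(2) by simp
        qed
        have step: "real (Suc j) * \<delta> = real j * \<delta> + \<delta>" by (simp add: algebra_simps)
        have nn: "0 \<le> real j * \<delta>" using \<delta>(1) by simp
        have "\<bar>V (Suc j) - V j\<bar> < h" unfolding V_def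
          by (rule \<gamma>(2)) (use step jT nn \<delta>(1) \<delta>\<gamma> in auto)
        moreover have "\<bar>V j - \<sigma> * W t \<omega>\<bar> < h" unfolding V_def
          by (rule \<gamma>(2)) (use step jT nn jt t \<delta>(1) \<delta>\<gamma> in auto)
        ultimately have "\<bar>skeleton (Suc q) \<delta> (\<lambda>j. V (Suc j) - V j) t - \<sigma> * W t \<omega>\<bar> \<le> 2 * h"
          using skeleton_near_node[of V, OF V0 j] by linarith
        then show ?thesis using t by (simp add: path_of_def)
      qed
      have "\<bar>F (restrict (\<lambda>t. \<mu> * t + skeleton (Suc q) \<delta> (\<lambda>j. V (Suc j) - V j) t) {0..}) - F (?p \<omega>)\<bar> \<le> K * (2 * h)"
        using F(1) skeleton_path[of \<mu> "Suc q" \<delta>] pc[OF \<omega>] close unfolding sup_lipschitz_def by blast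
      then show ?thesis using h(2) unfolding X unfolding skeleton_functional_def \<delta>_def[symmetric] by simp
    qed
    then show "\<exists>q0. \<forall>q\<ge>q0. norm (skeleton_functional F \<mu> (Suc q) (T / Suc q) (?X q \<omega>) - F (?p \<omega>)) < e" by blast
  qed
qed (use W in \<open>auto simp: standard_brownian_motion_def prob_space_def finite_measure.integrable_const\<close>)

section \<open>Law of large numbers and invariance principle along sequences\<close>

text \<open>
  Unless some block exceeds \<open>\<epsilon>\<close>, the path and its skeleton differ by at most \<open>4 \<epsilon>\<close>: the skeleton accounts
  for \<open>3 \<epsilon>\<close>, the initial value and the drift for \<open>\<epsilon> / 2\<close> each. On the exceptional event the
  functional is estimated by its bound.
\<close>
lemma walk_near_skeleton_functional:
  fixes M :: "'a measure" and Y :: "nat \<Rightarrow> 'a \<Rightarrow> int"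
  assumes ab: "a \<in> {0..1}" "b \<in> {0..1}" and \<kappa>: "0 < \<kappa>" "\<kappa> \<le> a + b"
    and mc: "markov_chain M {-1, 1} (walk_transition a b) Y"
    and y: "\<And>\<omega>. \<omega> \<in> space M \<Longrightarrow> Y 0 \<omega> = y" "y \<in> {-1, 1}"
    and d: "d > 0" and r: "r > 0" and T: "T > 0"
    and F: "sup_lipschitz T K F" "\<And>x. x \<in> continuous_paths \<Longrightarrow> \<bar>F x\<bar> \<le> B" and K: "K \<ge> 0" and q: "q > 0"
    and \<delta>: "\<delta> = T / real q" and L: "L = nat \<lfloor>\<delta> / (d\<^sup>2 / r)\<rfloor>" "q \<le> L"
    and \<epsilon>: "\<epsilon> > 0" "2 * d \<le> \<epsilon>" "4 * d \<le> \<kappa> * \<epsilon>"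
      "\<bar>d * stationary_mean a b * (r / d\<^sup>2) - g - \<mu>\<bar> * T \<le> \<epsilon> / 2"
  shows "\<bar>(\<integral>\<omega>. F (path_of (\<lambda>t \<omega>. interpolated_walk d (d\<^sup>2 / r) Y t \<omega> - g * t) \<omega>) \<partial>M)
      - path_mean a b (Suc q * L) y
          (\<lambda>l. skeleton_functional F \<mu> q \<delta> (\<lambda>j. d * centered_sum (stationary_mean a b) (block L j l)))\<bar>
    \<le> K * (4 * \<epsilon>) + 2 * B * (real (Suc q) * (1792 * (\<delta> * r)\<^sup>2 / (\<kappa> * \<epsilon> / 2)^4))"
proof -
  interpret prob_space M using mc by (simp add: markov_chain_def)
  define m where "m = stationary_mean a b"
  define dt where "dt = d\<^sup>2 / r"
  have dt: "dt > 0" using d r by (simp add: dt_def)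
  have \<delta>0: "\<delta> > 0" "real q * \<delta> = T" using T q by (simp_all add: \<delta>)
  define n where "n = Suc q * L"
  define l where "l = (\<lambda>\<omega>. map (\<lambda>i. Y (Suc i) \<omega>) [0..<n])"
  define bad where "bad = (\<lambda>l. \<exists>j<Suc q. \<exists>k\<le>L. d * \<bar>centered_sum m (take k (block L j l))\<bar> > \<epsilon>)"
  define \<Phi> where "\<Phi> = (\<lambda>l. skeleton_functional F \<mu> q \<delta> (\<lambda>j. d * centered_sum m (block L j l)))"
  define \<xi> where "\<xi> = path_of (\<lambda>t \<omega>. interpolated_walk d dt Y t \<omega> - g * t)"
  note E = markov_chain_expectation[OF mc ab, of y]
  have E: "(\<integral>\<omega>. h (l \<omega>) \<partial>M) = path_mean a b n y h" "integrable M (\<lambda>\<omega>. h (l \<omega>))"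
    for h :: "int list \<Rightarrow> real"
    unfolding l_def by (rule E[OF y]; simp)+
  have B: "B \<ge> 0" using F(2)[OF skeleton_path[of 0 0 0 "\<lambda>_. 0"]] by linarith
  have \<xi>c: "\<xi> \<omega> \<in> continuous_paths" for \<omega>
    unfolding \<xi>_def
    by (intro path_of_continuous_paths continuous_intros interpolated_walk_continuous[OF dt])
  have \<xi>m: "\<xi> \<in> M \<rightarrow>\<^sub>M borel_of path_topology"
    unfolding \<xi>_def
    by (rule path_of_measurable)
      (auto intro!: continuous_intros interpolated_walk_continuous[OF dt] interpolated_walk_measurable[OF mc] borel_measurable_diff)
  have Fi: "integrable M (\<lambda>\<omega>. F (\<xi> \<omega>))"
  proof (rule bounded_integrable[of _ _ B])
    show "(\<lambda>\<omega>. F (\<xi> \<omega>)) \<in> borel_measurable M"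
      by (rule measurable_compose[OF \<xi>m])
        (intro continuous_map_borel_of_measurable sup_lipschitz_continuous[OF F(1) K])
  qed (use F(2) \<xi>c prob_space_axioms in auto)
  have close: "\<bar>F (\<xi> \<omega>) - \<Phi> (l \<omega>)\<bar> \<le> K * (4 * \<epsilon>) + 2 * B * of_bool (bad (l \<omega>))" if \<omega>: "\<omega> \<in> space M" for \<omega>
  proof (cases "bad (l \<omega>)")
    case True
    have "\<bar>F (\<xi> \<omega>)\<bar> \<le> B" "\<bar>\<Phi> (l \<omega>)\<bar> \<le> B"
      unfolding \<Phi>_def skeleton_functional_def by (rule F(2)[OF \<xi>c], rule F(2)[OF skeleton_path])
    moreover have "0 \<le> K * (4 * \<epsilon>)" using K \<epsilon>(1) by simp
    ultimately show ?thesis using True by simp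
  next
    case False
    let ?x = "\<lambda>j. d * centered_sum m (block L j (l \<omega>))"
    have good: "d * \<bar>centered_sum m (take k (block L j (l \<omega>)))\<bar> \<le> \<epsilon>" if "j \<le> q" "k \<le> L" for j k
      using False that unfolding bad_def by (meson le_imp_less_Suc not_le)
    have "\<bar>\<xi> \<omega> t - restrict (\<lambda>t. \<mu> * t + skeleton q \<delta> ?x t) {0..} t\<bar> \<le> 4 * \<epsilon>" if t: "t \<in> {0..T}" for t
    proof -
      have "\<bar>interpolated_walk d dt Y t \<omega> - d * real_of_int (Y 0 \<omega>) - d * m * (t / dt) - skeleton q \<delta> ?x t\<bar> \<le> 3 * \<epsilon>"
        by (rule path_near_skeleton[OF d dt \<delta>0(1) q _ L(2) _ good])
          (use t \<delta>0(2) in \<open>auto simp: L(1) dt_def l_def n_def\<close>)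
      moreover have "\<bar>d * real_of_int (Y 0 \<omega>)\<bar> \<le> \<epsilon> / 2" using y \<omega> \<epsilon>(2) d by auto
      moreover have "\<bar>d * m * (t / dt) - g * t - \<mu> * t\<bar> \<le> \<epsilon> / 2"
      proof -
        have "d * m * (t / dt) - g * t - \<mu> * t = (d * m * (r / d\<^sup>2) - g - \<mu>) * t"
          by (simp add: dt_def algebra_simps)
        also have "\<bar>\<dots>\<bar> \<le> \<bar>d * m * (r / d\<^sup>2) - g - \<mu>\<bar> * T"
          unfolding abs_mult using t by (intro mult_left_mono) auto
        finally show ?thesis using \<epsilon>(4) by (simp add: m_def)
      qed
      ultimately have "\<bar>interpolated_walk d dt Y t \<omega> - g * t - (\<mu> * t + skeleton q \<delta> ?x t)\<bar> \<le> 4 * \<epsilon>" by linarith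
      then show ?thesis using t by (simp add: \<xi>_def path_of_def)
    qed
    then have "\<bar>F (\<xi> \<omega>) - \<Phi> (l \<omega>)\<bar> \<le> K * (4 * \<epsilon>)"
      using F(1) \<xi>c[of \<omega>] skeleton_path[of \<mu> q \<delta> ?x]
      unfolding sup_lipschitz_def \<Phi>_def skeleton_functional_def by blast
    then show ?thesis using False by simp
  qed
  have "(\<integral>\<omega>. F (\<xi> \<omega>) \<partial>M) - path_mean a b n y \<Phi> = (\<integral>\<omega>. F (\<xi> \<omega>) - \<Phi> (l \<omega>) \<partial>M)"
    using E[of \<Phi>] Fi by simp
  also have "\<bar>\<dots>\<bar> \<le> (\<integral>\<omega>. \<bar>F (\<xi> \<omega>) - \<Phi> (l \<omega>)\<bar> \<partial>M)" by (rule integral_abs_bound)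
  also have "\<dots> \<le> (\<integral>\<omega>. K * (4 * \<epsilon>) + 2 * B * of_bool (bad (l \<omega>)) \<partial>M)"
    by (rule integral_mono[OF _ _ close])
      (use E(2)[of \<Phi>] E(2)[of "\<lambda>l. K * (4 * \<epsilon>) + 2 * B * of_bool (bad l)"] Fi in auto)
  also have "\<dots> = K * (4 * \<epsilon>) + 2 * B * path_mean a b n y (\<lambda>l. of_bool (bad l))"
    unfolding E(1)[of "\<lambda>l. K * (4 * \<epsilon>) + 2 * B * of_bool (bad l)"] by simp
  also have "\<dots> \<le> K * (4 * \<epsilon>) + 2 * B * (real (Suc q) * (1792 * (\<delta> * r)\<^sup>2 / (\<kappa> * \<epsilon> / 2)^4))"
  proof (intro add_left_mono mult_left_mono)
    show "path_mean a b n y (\<lambda>l. of_bool (bad l)) \<le> real (Suc q) * (1792 * (\<delta> * r)\<^sup>2 / (\<kappa> * \<epsilon> / 2)^4)"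
      unfolding n_def bad_def
    proof (rule some_block_bad[OF _ y(2)])
      fix z :: int assume z: "z \<in> {-1, 1}"
      have "path_mean a b L z (\<lambda>l. of_bool (\<exists>k\<le>L. d * \<bar>centered_sum m (take k l)\<bar> > \<epsilon>) :: real)
          \<le> 1792 * (real L * d\<^sup>2)\<^sup>2 / (\<kappa> * \<epsilon> / 2)^4"
        unfolding m_def by (rule centered_sum_maximal[OF ab \<kappa> z d \<epsilon>(1,3)])
      also have "\<dots> \<le> 1792 * (\<delta> * r)\<^sup>2 / (\<kappa> * \<epsilon> / 2)^4"
      proof (intro divide_right_mono mult_left_mono power_mono)
        have "0 \<le> \<delta> / (d\<^sup>2 / r)" using \<delta>0 r by simp
        then have "real L \<le> \<delta> / (d\<^sup>2 / r)" by (simp add: L)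
        then have "real L * d\<^sup>2 \<le> \<delta> / (d\<^sup>2 / r) * d\<^sup>2" by (intro mult_right_mono) auto
        then show "real L * d\<^sup>2 \<le> \<delta> * r" using d r by simp
      qed (use \<kappa> \<epsilon> in auto)
      finally show "path_mean a b L z (\<lambda>l. of_bool (\<exists>k\<le>L. d * \<bar>centered_sum m (take k l)\<bar> > \<epsilon>) :: real)
          \<le> 1792 * (\<delta> * r)\<^sup>2 / (\<kappa> * \<epsilon> / 2)^4" .
    qed
  qed (use B in simp)
  finally show ?thesis by (simp only: \<Phi>_def \<xi>_def m_def n_def dt_def)
qed

lemma walk_skeleton_limit:
  fixes a b d :: "nat \<Rightarrow> real" and N :: "'b measure"
  assumes ab: "\<And>n. a n \<in> {0..1}" "\<And>n. b n \<in> {0..1}" and \<kappa>: "0 < \<kappa>" "\<And>n. \<kappa> \<le> a n + b n"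
    and d: "\<And>n. d n > 0" "d \<longlonglongrightarrow> 0" and r: "r > 0" and y: "y \<in> {-1, 1}"
    and var: "(\<lambda>n. asymptotic_variance (a n) (b n)) \<longlonglongrightarrow> V"
    and W: "standard_brownian_motion N W"
    and \<Phi>: "sum_lipschitz q K B \<Phi>" and K: "K \<ge> 0" and q: "q > 0" and \<delta>: "\<delta> > 0"
    and L: "\<And>n. L n = nat \<lfloor>\<delta> / ((d n)\<^sup>2 / r)\<rfloor>"
  shows "(\<lambda>n. path_mean (a n) (b n) (q * L n) y
            (\<lambda>l. \<Phi> (\<lambda>j. d n * centered_sum (stationary_mean (a n) (b n)) (block (L n) j l))))
    \<longlonglongrightarrow> (\<integral>\<omega>. \<Phi> (\<lambda>j. sqrt (r * V) * (W (real (Suc j) * \<delta>) \<omega> - W (real j * \<delta>) \<omega>)) \<partial>N)"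
proof -
  interpret N: prob_space N using W by (simp add: standard_brownian_motion_def)
  define \<nu> where "\<nu> = gaussian_law (sqrt (V * (\<delta> * r)))"
  have \<nu>: "real_distribution \<nu>" unfolding \<nu>_def by (rule real_distribution_gaussian_law)
  define U where "U = (\<lambda>n l. d n * centered_sum (stationary_mean (a n) (b n)) l)"
  define D where "D = (\<lambda>z n. distr (measure_pmf (path_pmf (a n) (b n) (L n) z)) borel (U n))"
  have D: "real_distribution (D z n)" for z n
    unfolding D_def by (intro prob_space.real_distribution_distr prob_space_measure_pmf) simp
  have wc: "weak_conv_m (D z) \<nu>" if z: "z \<in> {-1, 1}" for z
    unfolding D_def U_def \<nu>_def
    by (rule walk_clt[OF ab \<kappa> d(2) _ var z]) (simp only: L block_length_limit[OF d r \<delta>])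
  obtain e1 e2 where e1: "e1 \<longlonglongrightarrow> 0" "\<And>n \<phi>. \<forall>x. \<bar>\<phi> x\<bar> \<le> B \<Longrightarrow> \<forall>x y. \<bar>\<phi> x - \<phi> y\<bar> \<le> K * \<bar>x - y\<bar> \<Longrightarrow>
       \<bar>integral\<^sup>L (D (-1) n) \<phi> - integral\<^sup>L \<nu> \<phi>\<bar> \<le> e1 n"
    and e2: "e2 \<longlonglongrightarrow> 0" "\<And>n \<phi>. \<forall>x. \<bar>\<phi> x\<bar> \<le> B \<Longrightarrow> \<forall>x y. \<bar>\<phi> x - \<phi> y\<bar> \<le> K * \<bar>x - y\<bar> \<Longrightarrow>
       \<bar>integral\<^sup>L (D 1 n) \<phi> - integral\<^sup>L \<nu> \<phi>\<bar> \<le> e2 n"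
    using weak_conv_uniform[OF D \<nu> wc K, of "-1" B] weak_conv_uniform[OF D \<nu> wc K, of 1 B] by fastforce
  define e where "e = (\<lambda>n. \<bar>e1 n\<bar> + \<bar>e2 n\<bar>)"
  have e0: "e \<longlonglongrightarrow> 0" unfolding e_def using tendsto_add[OF tendsto_rabs[OF e1(1)] tendsto_rabs[OF e2(1)]] by simp
  have lim: "(\<lambda>n. path_mean (a n) (b n) (q * L n) y (\<lambda>l. \<Phi> (\<lambda>j. U n (block (L n) j l))))
    \<longlonglongrightarrow> iterated_integral \<nu> q \<Phi>"
  proof (rule block_convergence[OF \<nu> K e0 _ \<Phi> y])
    fix n and z :: int and \<phi> :: "real \<Rightarrow> real"
    assume z: "z \<in> {-1, 1}" and \<phi>: "\<forall>x. \<bar>\<phi> x\<bar> \<le> B" "\<forall>x z. \<bar>\<phi> x - \<phi> z\<bar> \<le> K * \<bar>x - z\<bar>"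
    have "continuous_on UNIV \<phi>"
      by (rule lipschitz_on_continuous_on[of K], rule lipschitz_onI) (use \<phi> K in \<open>auto simp: dist_real_def\<close>)
    then have m: "\<phi> \<in> borel_measurable borel" by (rule borel_measurable_continuous_onI)
    have "path_mean (a n) (b n) (L n) z (\<lambda>l. \<phi> (U n l)) = integral\<^sup>L (D z n) \<phi>"
      unfolding D_def by (rule integral_distr[symmetric]) (use m in auto)
    moreover have "\<bar>integral\<^sup>L (D z n) \<phi> - integral\<^sup>L \<nu> \<phi>\<bar> \<le> e n"
      using z e1(2)[OF \<phi>, of n] e2(2)[OF \<phi>, of n] by (auto simp: e_def)
    ultimately show "\<bar>path_mean (a n) (b n) (L n) z (\<lambda>l. \<phi> (U n l)) - integral\<^sup>L \<nu> \<phi>\<bar> \<le> e n"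
      by simp
  qed
  let ?G = "\<lambda>j \<omega>. sqrt (r * V) * (W (real (Suc j) * \<delta>) \<omega> - W (real j * \<delta>) \<omega>)"
  have Wm: "W t \<in> borel_measurable N" if "t \<ge> 0" for t using W that by (simp add: standard_brownian_motion_def)
  have "(\<integral>\<omega>. \<Phi> (\<lambda>j. ?G j \<omega>) \<partial>N) = iterated_integral \<nu> q \<Phi>"
  proof (rule expectation_indep[OF N.prob_space_axioms _ _ _ q \<nu> \<Phi>])
    fix j
    show "?G j \<in> borel_measurable N"
      using Wm \<delta> by (intro borel_measurable_times borel_measurable_diff borel_measurable_const) auto
    have "real (Suc j) * \<delta> - real j * \<delta> = \<delta>" by (simp add: algebra_simps)
    then show "distr N borel (?G j) = \<nu>"
      using brownian_increment_law[OF W, of "real j * \<delta>" "real (Suc j) * \<delta>" "sqrt (r * V)"] \<delta>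
      unfolding \<nu>_def by (simp add: real_sqrt_mult mult_ac)
  next
    have "N.indep_vars (\<lambda>_. borel) (\<lambda>i \<omega>. W (real (Suc i) * \<delta>) \<omega> - W (real i * \<delta>) \<omega>) {..<q}"
    proof -
      have "\<forall>(n::nat) t. 0 \<le> t 0 \<longrightarrow> (\<forall>i<n. t i \<le> t (Suc i)) \<longrightarrow>
        N.indep_vars (\<lambda>_. borel) (\<lambda>i \<omega>. W (t (Suc i)) \<omega> - W (t i) \<omega>) {..<n}"
        using W unfolding standard_brownian_motion_def by blast
      from this[rule_format, of "\<lambda>i. real i * \<delta>" q] show ?thesis using \<delta> by simp
    qed
    then show "N.indep_vars (\<lambda>_. borel) ?G {..<q}"
      by (rule N.indep_vars_compose2) simp
  qed
  with lim show ?thesis by (simp add: U_def)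
qed

text \<open>
  The number \<open>q\<close> of cells is chosen first, so that the skeleton of the limit process is accurate and the
  exceptional event is unlikely for all meshes. Then the mesh tends to \<open>0\<close> with \<open>q\<close> fixed.
\<close>
lemma donsker_sequence:
  fixes M :: "nat \<Rightarrow> 'a measure" and Y :: "nat \<Rightarrow> nat \<Rightarrow> 'a \<Rightarrow> int" and N :: "'b measure"
  assumes ab: "\<And>n. a n \<in> {0..1}" "\<And>n. b n \<in> {0..1}" and \<kappa>: "0 < \<kappa>" "\<And>n. \<kappa> \<le> a n + b n"
    and mc: "\<And>n. markov_chain (M n) {-1, 1} (walk_transition (a n) (b n)) (Y n)"
    and y: "\<And>n \<omega>. \<omega> \<in> space (M n) \<Longrightarrow> Y n 0 \<omega> = y" "y \<in> {-1, 1}"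
    and d: "\<And>n. d n > 0" "d \<longlonglongrightarrow> 0" and r: "r > 0"
    and var: "(\<lambda>n. asymptotic_variance (a n) (b n)) \<longlonglongrightarrow> V"
    and drift: "(\<lambda>n. d n * stationary_mean (a n) (b n) * (r / (d n)\<^sup>2) - g n) \<longlonglongrightarrow> \<mu>"
    and W: "standard_brownian_motion N W"
    and T: "T > 0" and K: "K \<ge> 0"
    and F: "sup_lipschitz T K F" "\<And>x. x \<in> continuous_paths \<Longrightarrow> \<bar>F x\<bar> \<le> B"
  shows "(\<lambda>n. \<integral>\<omega>. F (path_of (\<lambda>t \<omega>. interpolated_walk (d n) ((d n)\<^sup>2 / r) (Y n) t \<omega> - g n * t) \<omega>) \<partial>M n)
    \<longlonglongrightarrow> (\<integral>\<omega>. F (path_of (\<lambda>t \<omega>. \<mu> * t + sqrt (r * V) * W t \<omega>) \<omega>) \<partial>N)"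
    (is "?I \<longlonglongrightarrow> ?J")
proof (rule LIMSEQ_I)
  fix e :: real assume e: "0 < e"
  \<comment> \<open>Four errors of size at most \<open>e / 4\<close> have to be controlled; this choice makes \<open>K * (4 * \<epsilon>)\<close> one of them.\<close>
  define \<epsilon> where "\<epsilon> = e / 16 / (K + 1)"
  have \<epsilon>: "\<epsilon> > 0" "K * (4 * \<epsilon>) < e / 4"
  proof -
    show "\<epsilon> > 0" using e K by (simp add: \<epsilon>_def)
    have "16 * (s * (e / 16 / s)) = e" if "s \<noteq> 0" for s :: real using that by simp
    from this[of "K + 1"] have "16 * ((K + 1) * \<epsilon>) = e" using K unfolding \<epsilon>_def by linarith
    then have "K * (4 * \<epsilon>) = e / 4 - 4 * \<epsilon>" by (simp add: algebra_simps)
    then show "K * (4 * \<epsilon>) < e / 4" using \<open>\<epsilon> > 0\<close> by simp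
  qed
  define \<delta> where "\<delta> = (\<lambda>q. T / real (Suc q))"
  define \<Phi> where "\<Phi> = (\<lambda>q. skeleton_functional F \<mu> (Suc q) (\<delta> q))"
  define J where "J = (\<lambda>q. \<integral>\<omega>. \<Phi> q (\<lambda>j. sqrt (r * V) * (W (real (Suc j) * \<delta> q) \<omega> - W (real j * \<delta> q) \<omega>)) \<partial>N)"
  have J: "J \<longlonglongrightarrow> ?J" unfolding J_def \<Phi>_def \<delta>_def by (rule scaled_brownian_skeleton_limit[OF W F K T])
  let ?p = "\<lambda>q. 2 * B * (real (Suc (Suc q)) * (1792 * (\<delta> q * r)\<^sup>2 / (\<kappa> * \<epsilon> / 2)^4))"
  have p: "?p \<longlonglongrightarrow> 0"
  proof -
    let ?c = "2 * B * 1792 * (T * r)\<^sup>2 / (\<kappa> * \<epsilon> / 2)^4"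
    have eq: "?p q = ?c * (inverse (real (Suc q)) * (1 + inverse (real (Suc q))))" for q
    proof -
      have 1: "x * (1 + x) = (s + 1) * x\<^sup>2" if "s * x = 1" for s x :: real
        using that by (simp add: power2_eq_square algebra_simps)
      have "inverse (real (Suc q)) * (1 + inverse (real (Suc q))) = (real (Suc q) + 1) * (inverse (real (Suc q)))\<^sup>2"
        by (rule 1) simp
      moreover have "(\<delta> q * r)\<^sup>2 = (T * r)\<^sup>2 * (inverse (real (Suc q)))\<^sup>2"
        unfolding \<delta>_def divide_inverse power_mult_distrib by (rule mult.assoc[THEN trans]) (simp only: mult_ac)
      moreover have "real (Suc (Suc q)) = real (Suc q) + 1" by simp
      moreover have "2 * B * (s * (1792 * (A * x) / D)) = 2 * B * 1792 * A / D * (s * x)" for s A x D :: real by simp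
      ultimately show ?thesis by (simp only:)
    qed
    have "(\<lambda>q. ?c * (inverse (real (Suc q)) * (1 + inverse (real (Suc q))))) \<longlonglongrightarrow> ?c * (0 * (1 + 0))"
      by (intro tendsto_intros LIMSEQ_inverse_real_of_nat)
    then show ?thesis unfolding eq by (simp only: mult_zero_left mult_zero_right)
  qed
  have "\<forall>\<^sub>F q in sequentially. \<bar>J q - ?J\<bar> < e / 4 \<and> ?p q < e / 4"
    using tendstoD[OF J, of "e / 4"] order_tendstoD(2)[OF p, of "e / 4"] e
    by (auto simp: dist_real_def intro: eventually_conj)
  then obtain q where q: "\<bar>J q - ?J\<bar> < e / 4" "?p q < e / 4" unfolding eventually_sequentially by blast
  have \<delta>0: "\<delta> q > 0" using T by (simp add: \<delta>_def)
  define L where "L = (\<lambda>n. nat \<lfloor>\<delta> q / ((d n)\<^sup>2 / r)\<rfloor>)"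
  let ?A = "\<lambda>n. path_mean (a n) (b n) (Suc (Suc q) * L n) y
            (\<lambda>l. \<Phi> q (\<lambda>j. d n * centered_sum (stationary_mean (a n) (b n)) (block (L n) j l)))"
  have "sum_lipschitz (Suc (Suc q)) K B (\<Phi> q)"
    unfolding \<Phi>_def by (rule skeleton_functional_sum_lipschitz[OF F K le_SucI[OF order_refl]])
  then have A: "?A \<longlonglongrightarrow> J q"
    unfolding J_def by (intro walk_skeleton_limit[OF ab \<kappa> d r y(2) var W _ K _ \<delta>0]) (auto simp: L_def)
  have ev1: "\<forall>\<^sub>F n in sequentially. \<bar>?A n - J q\<bar> < e / 4"
    using tendstoD[OF A, of "e / 4"] e by (simp add: dist_real_def)
  have ev2: "\<forall>\<^sub>F n in sequentially. Suc q \<le> L n"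
  proof -
    have "(\<lambda>n. (d n)\<^sup>2) \<longlonglongrightarrow> 0\<^sup>2" by (intro tendsto_intros d(2))
    then have "\<forall>\<^sub>F n in sequentially. (d n)\<^sup>2 < \<delta> q * r / real (Suc q)"
      by (rule order_tendstoD) (use \<delta>0 r in simp)
    then show ?thesis
    proof eventually_elim
      case (elim n)
      have "real (Suc q) \<le> \<delta> q / ((d n)\<^sup>2 / r)" using elim d(1)[of n] r by (simp add: field_simps)
      then show ?case unfolding L_def by linarith
    qed
  qed
  have ev3: "\<forall>\<^sub>F n in sequentially. d n < \<epsilon> / 2 \<and> d n < \<kappa> * \<epsilon> / 4"
    using order_tendstoD(2)[OF d(2), of "\<epsilon> / 2"] order_tendstoD(2)[OF d(2), of "\<kappa> * \<epsilon> / 4"] \<epsilon> \<kappa>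
    by (auto intro: eventually_conj)
  have ev4: "\<forall>\<^sub>F n in sequentially. \<bar>d n * stationary_mean (a n) (b n) * (r / (d n)\<^sup>2) - g n - \<mu>\<bar> < \<epsilon> / (2 * T)"
    using tendstoD[OF drift, of "\<epsilon> / (2 * T)"] \<epsilon> T by (simp add: dist_real_def)
  have "\<forall>\<^sub>F n in sequentially. norm (?I n - ?J) < e"
    using ev1 ev2 ev3 ev4
  proof eventually_elim
    case (elim n)
    have "\<bar>?I n - ?A n\<bar> \<le> K * (4 * \<epsilon>) + ?p q"
      unfolding \<Phi>_def
    proof (rule walk_near_skeleton_functional[OF ab \<kappa> mc y d(1) r T F K])
      have "\<bar>d n * stationary_mean (a n) (b n) * (r / (d n)\<^sup>2) - g n - \<mu>\<bar> * T \<le> \<epsilon> / (2 * T) * T"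
        using elim T by (intro mult_right_mono) auto
      then show "\<bar>d n * stationary_mean (a n) (b n) * (r / (d n)\<^sup>2) - g n - \<mu>\<bar> * T \<le> \<epsilon> / 2" using T by simp
    qed (use elim \<epsilon>(1) in \<open>auto simp: \<delta>_def L_def\<close>)
    then have "\<bar>?I n - ?J\<bar> < e" using elim(1) q \<epsilon>(2) by linarith
    then show ?case by simp
  qed
  then show "\<exists>n0. \<forall>n\<ge>n0. norm (?I n - ?J) < e" unfolding eventually_sequentially .
qed

text \<open>
  Up to time \<open>t\<close> there are of order \<open>1 / d n\<close> steps, so the maximal inequality bounds the probability of a
  fluctuation of fixed size by a multiple of \<open>(d n)\<^sup>2\<close>, and only the drift \<open>r * t * m\<close> is left.
\<close>
lemma lln_sequence:
  fixes M :: "nat \<Rightarrow> 'a measure" and Y :: "nat \<Rightarrow> nat \<Rightarrow> 'a \<Rightarrow> int" and f :: "real \<Rightarrow> real"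
  assumes ab: "\<And>n. a n \<in> {0..1}" "\<And>n. b n \<in> {0..1}" and \<kappa>: "0 < \<kappa>" "\<And>n. \<kappa> \<le> a n + b n"
    and mc: "\<And>n. markov_chain (M n) {-1, 1} (walk_transition (a n) (b n)) (Y n)"
    and y: "\<And>n \<omega>. \<omega> \<in> space (M n) \<Longrightarrow> Y n 0 \<omega> = y" "y \<in> {-1, 1}"
    and d: "\<And>n. d n > 0" "d \<longlonglongrightarrow> 0" and r: "r > 0" and t: "t \<ge> 0"
    and mean: "(\<lambda>n. stationary_mean (a n) (b n)) \<longlonglongrightarrow> m"
    and f: "continuous_on UNIV f" "\<And>x. \<bar>f x\<bar> \<le> B"
  shows "(\<lambda>n. \<integral>\<omega>. f (interpolated_walk (d n) (d n / r) (Y n) t \<omega>) \<partial>M n) \<longlonglongrightarrow> f (r * t * m)"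
proof (rule LIMSEQ_I)
  fix e :: real assume e: "0 < e"
  define c where "c = r * t * m"
  have B: "B \<ge> 0" using f(2)[of 0] by linarith
  have fm: "f \<in> borel_measurable borel" using f(1) by (rule borel_measurable_continuous_onI)
  obtain h where h: "h > 0" "\<And>x. \<bar>x - c\<bar> < h \<Longrightarrow> \<bar>f x - f c\<bar> < e / 2"
    using f(1) e unfolding continuous_on_iff dist_real_def by (metis UNIV_I half_gt_zero)
  \<comment> \<open>Initial value, fluctuation and drift contribute at most \<open>\<epsilon>\<close> each.\<close>
  define \<epsilon> where "\<epsilon> = h / 4"
  have \<epsilon>: "\<epsilon> > 0" using h by (simp add: \<epsilon>_def)
  define k where "k = (\<lambda>n. nat \<lfloor>t / (d n / r)\<rfloor>)"
  define p where "p = (\<lambda>n. 1792 * (t * r * d n + (d n)\<^sup>2)\<^sup>2 / (\<kappa> * \<epsilon> / 2)^4)"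
  have "p \<longlonglongrightarrow> 1792 * (t * r * 0 + 0\<^sup>2)\<^sup>2 / (\<kappa> * \<epsilon> / 2)^4"
    unfolding p_def by (intro tendsto_intros d(2)) (use \<kappa> \<epsilon> in auto)
  then have p0: "(\<lambda>n. 2 * B * p n) \<longlonglongrightarrow> 0" using tendsto_mult_right_zero by fastforce
  have ev1: "\<forall>\<^sub>F n in sequentially. 2 * B * p n < e / 2" using order_tendstoD(2)[OF p0, of "e / 2"] e by simp
  have ev2: "\<forall>\<^sub>F n in sequentially. d n < \<epsilon> \<and> d n < \<kappa> * \<epsilon> / 4"
    using order_tendstoD(2)[OF d(2), of \<epsilon>] order_tendstoD(2)[OF d(2), of "\<kappa> * \<epsilon> / 4"] \<epsilon> \<kappa>
    by (auto intro: eventually_conj)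
  have "(\<lambda>n. r * t * stationary_mean (a n) (b n)) \<longlonglongrightarrow> c" unfolding c_def by (intro tendsto_intros mean)
  then have ev3: "\<forall>\<^sub>F n in sequentially. \<bar>r * t * stationary_mean (a n) (b n) - c\<bar> < \<epsilon>"
    using tendstoD[of _ c sequentially \<epsilon>] \<epsilon> by (simp add: dist_real_def)
  let ?Z = "\<lambda>n \<omega>. interpolated_walk (d n) (d n / r) (Y n) t \<omega>"
  have "\<forall>\<^sub>F n in sequentially. norm ((\<integral>\<omega>. f (?Z n \<omega>) \<partial>M n) - f c) < e"
    using ev1 ev2 ev3
  proof eventually_elim
    case (elim n)
    interpret prob_space "M n" using mc[of n] by (simp add: markov_chain_def)
    define N where "N = Suc (k n)"
    define l where "l = (\<lambda>\<omega>. map (\<lambda>i. Y n (Suc i) \<omega>) [0..<N])"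
    let ?m = "stationary_mean (a n) (b n)"
    define bad where "bad = (\<lambda>l. \<exists>i\<le>N. d n * \<bar>centered_sum ?m (take i l)\<bar> > \<epsilon>)"
    note E = markov_chain_expectation[OF mc[of n] ab(1)[of n] ab(2)[of n], of y]
    have E: "(\<integral>\<omega>. g (l \<omega>) \<partial>M n) = path_mean (a n) (b n) N y g" "integrable (M n) (\<lambda>\<omega>. g (l \<omega>))"
      for g :: "int list \<Rightarrow> real"
      unfolding l_def by (rule E[OF y]; simp)+
    have dt: "d n / r > 0" using d(1)[of n] r by simp
    have close: "\<bar>f (?Z n \<omega>) - f c\<bar> \<le> e / 2 + 2 * B * of_bool (bad (l \<omega>))" if \<omega>: "\<omega> \<in> space (M n)" for \<omega>
    proof (cases "bad (l \<omega>)")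
      case True
      then show ?thesis using f(2)[of "?Z n \<omega>"] f(2)[of c] e by simp
    next
      case False
      define \<theta> where "\<theta> = t / (d n / r) - real (k n)"
      have kdef: "k n = nat \<lfloor>t / (d n / r)\<rfloor>" by (simp add: k_def)
      note \<theta> = interpolated_walk_formula(2,3)[OF dt t kdef \<theta>_def]
      have small: "\<bar>d n * centered_sum ?m (take i (l \<omega>)) - 0\<bar> \<le> \<epsilon>" if "i \<le> N" for i
        using False that d(1)[of n] by (auto simp: bad_def abs_mult not_less)
      have "\<bar>(1 - \<theta>) * (d n * centered_sum ?m (take (k n) (l \<omega>))) + \<theta> * (d n * centered_sum ?m (take (Suc (k n)) (l \<omega>))) - 0\<bar> \<le> \<epsilon>"
        by (rule convex_comb_close[OF \<theta>]) (rule small, simp add: N_def)+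
      moreover have "\<bar>d n * real_of_int (Y n 0 \<omega>)\<bar> < \<epsilon>" using y \<omega> elim d(1)[of n] by auto
      moreover have "d n * ?m * (t / (d n / r)) = r * t * ?m" using d(1)[of n] by simp
      moreover have "?Z n \<omega> = d n * real_of_int (Y n 0 \<omega>) + ((1 - \<theta>) * (d n * centered_sum ?m (take (k n) (l \<omega>)))
          + \<theta> * (d n * centered_sum ?m (take (Suc (k n)) (l \<omega>)))) + d n * ?m * (t / (d n / r))"
        by (rule interpolated_walk_centered_sum[OF dt t kdef \<theta>_def]) (auto simp: N_def l_def)
      ultimately have "\<bar>?Z n \<omega> - c\<bar> < 3 * \<epsilon>" using elim by linarith
      then have "\<bar>f (?Z n \<omega>) - f c\<bar> < e / 2" using \<epsilon> by (intro h(2)) (simp add: \<epsilon>_def)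
      then show ?thesis using False by simp
    qed
    have Zi: "integrable (M n) (\<lambda>\<omega>. f (?Z n \<omega>))"
      by (rule bounded_integrable[of _ _ B])
        (use f(2) prob_space_axioms in \<open>auto intro: measurable_compose[OF interpolated_walk_measurable[OF mc] fm]\<close>)
    have "(\<integral>\<omega>. f (?Z n \<omega>) \<partial>M n) - f c = (\<integral>\<omega>. f (?Z n \<omega>) - f c \<partial>M n)"
      using Zi by (simp add: prob_space)
    also have "\<bar>\<dots>\<bar> \<le> (\<integral>\<omega>. \<bar>f (?Z n \<omega>) - f c\<bar> \<partial>M n)" by (rule integral_abs_bound)
    also have "\<dots> \<le> (\<integral>\<omega>. e / 2 + 2 * B * of_bool (bad (l \<omega>)) \<partial>M n)"
      by (rule integral_mono[OF _ _ close]) (use E(2)[of "\<lambda>l. e / 2 + 2 * B * of_bool (bad l)"] Zi in auto)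
    also have "\<dots> = e / 2 + 2 * B * path_mean (a n) (b n) N y (\<lambda>l. of_bool (bad l))"
      unfolding E(1)[of "\<lambda>l. e / 2 + 2 * B * of_bool (bad l)"] by simp
    also have "\<dots> \<le> e / 2 + 2 * B * p n"
    proof (intro add_left_mono mult_left_mono)
      have "path_mean (a n) (b n) N y (\<lambda>l. of_bool (bad l)) \<le> 1792 * (real N * (d n)\<^sup>2)\<^sup>2 / (\<kappa> * \<epsilon> / 2)^4"
        unfolding bad_def by (rule centered_sum_maximal[OF ab \<kappa> y(2) d(1) \<epsilon>]) (use elim in simp)
      also have "\<dots> \<le> p n"
        unfolding p_def
      proof (intro divide_right_mono mult_left_mono power_mono)
        have "0 \<le> t / (d n / r)" using t d(1)[of n] r by simp
        then have "real (k n) \<le> t / (d n / r)" by (simp add: k_def)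
        then have "real N * (d n)\<^sup>2 \<le> (t / (d n / r) + 1) * (d n)\<^sup>2" unfolding N_def by (intro mult_right_mono) auto
        also have "\<dots> = t * r * d n + (d n)\<^sup>2" using d(1)[of n] by (simp add: power2_eq_square algebra_simps)
        finally show "real N * (d n)\<^sup>2 \<le> t * r * d n + (d n)\<^sup>2" .
      qed (use \<kappa> \<epsilon> in auto)
      finally show "path_mean (a n) (b n) N y (\<lambda>l. of_bool (bad l)) \<le> p n" .
    qed (use B in simp)
    also have "\<dots> < e" using elim by simp
    finally show ?case by simp
  qed
  then show "\<exists>n0. \<forall>n\<ge>n0. norm ((\<integral>\<omega>. f (?Z n \<omega>) \<partial>M n) - f (r * t * m)) < e"
    unfolding eventually_sequentially c_def .
qed

section \<open>Convergence in distribution as the mesh tends to zero\<close>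

text \<open>
  The tools for weak convergence on the real line speak of sequences of laws, so the
  limit in the mesh is reduced to sequences of admissible meshes.
\<close>
lemma tendsto_at_right_from_sequences:
  fixes f :: "real \<Rightarrow> real"
  assumes P: "\<forall>\<^sub>F x in at_right 0. P x"
    and lim: "\<And>X. (\<And>n. 0 < X n) \<Longrightarrow> (\<And>n. P (X n)) \<Longrightarrow> X \<longlonglongrightarrow> 0 \<Longrightarrow> (\<lambda>n. f (X n)) \<longlonglongrightarrow> l"
  shows "(f \<longlongrightarrow> l) (at_right 0)"
proof -
  obtain c where c: "c > 0" "\<And>x. 0 < x \<Longrightarrow> x < c \<Longrightarrow> P x"
    using P unfolding eventually_at_right_field by auto
  have "at_right 0 = at (0::real) within {0<..<c}"
    by (rule at_within_nhd[of _ "{..<c}"]) (use c(1) in auto)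
  moreover have "(f \<longlongrightarrow> l) (at 0 within {0<..<c})"
    unfolding tendsto_at_iff_sequentially comp_def using lim c(2) by simp
  ultimately show ?thesis by simp
qed

lemma parameter_limits:
  fixes \<alpha> \<beta> c c' :: real and X :: "nat \<Rightarrow> real"
  assumes X: "\<And>n. X n > 0" "X \<longlonglongrightarrow> 0" and pos: "\<alpha> + \<beta> > 0" and posn: "\<And>n. \<alpha> + c * X n + (\<beta> + c' * X n) > 0"
    and r: "r > 0"
  shows "(\<lambda>n. stationary_mean (\<alpha> + c * X n) (\<beta> + c' * X n)) \<longlonglongrightarrow> stationary_mean \<alpha> \<beta>"
    and "(\<lambda>n. asymptotic_variance (\<alpha> + c * X n) (\<beta> + c' * X n)) \<longlonglongrightarrow> asymptotic_variance \<alpha> \<beta>"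
    and "(\<lambda>n. X n * stationary_mean (\<alpha> + c * X n) (\<beta> + c' * X n) * (r / (X n)\<^sup>2) - r * stationary_mean \<alpha> \<beta> / X n)
      \<longlonglongrightarrow> r * ((c - c') / (\<alpha> + \<beta>) - (\<alpha> - \<beta>) * (c + c') / (\<alpha> + \<beta>)\<^sup>2)"
proof -
  have A: "(\<lambda>n. \<alpha> + c * X n) \<longlonglongrightarrow> \<alpha> + c * 0" "(\<lambda>n. \<beta> + c' * X n) \<longlonglongrightarrow> \<beta> + c' * 0"
    by (intro tendsto_intros X(2))+
  then have A: "(\<lambda>n. \<alpha> + c * X n) \<longlonglongrightarrow> \<alpha>" "(\<lambda>n. \<beta> + c' * X n) \<longlonglongrightarrow> \<beta>" by simp_all
  show m: "(\<lambda>n. stationary_mean (\<alpha> + c * X n) (\<beta> + c' * X n)) \<longlonglongrightarrow> stationary_mean \<alpha> \<beta>"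
    unfolding stationary_mean_def by (intro tendsto_intros A) (use pos in simp)
  show "(\<lambda>n. asymptotic_variance (\<alpha> + c * X n) (\<beta> + c' * X n)) \<longlonglongrightarrow> asymptotic_variance \<alpha> \<beta>"
    unfolding asymptotic_variance_def by (intro tendsto_intros A m) (use pos in simp)
  \<comment> \<open>The difference quotient of the stationary mean in the mesh is an explicit rational function.\<close>
  have eq: "X n * stationary_mean (\<alpha> + c * X n) (\<beta> + c' * X n) * (r / (X n)\<^sup>2) - r * stationary_mean \<alpha> \<beta> / X n
    = r * ((c - c') * (\<alpha> + \<beta>) - (\<alpha> - \<beta>) * (c + c')) / ((\<alpha> + \<beta>) * (\<alpha> + c * X n + (\<beta> + c' * X n)))" for n
  proof -
    have alg: "x * (u / s) * (r / x\<^sup>2) - r * (u0 / s0) / x = r * (u * s0 - u0 * s) / (s0 * s * x)"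
      if "x > 0" "s > 0" "s0 > 0" for x u s u0 s0 :: real
      using that by (simp add: field_simps power2_eq_square)
    have num: "(\<alpha> + c * X n - (\<beta> + c' * X n)) * (\<alpha> + \<beta>) - (\<alpha> - \<beta>) * (\<alpha> + c * X n + (\<beta> + c' * X n))
      = ((c - c') * (\<alpha> + \<beta>) - (\<alpha> - \<beta>) * (c + c')) * X n" by (simp add: algebra_simps)
    show ?thesis unfolding stationary_mean_def alg[OF X(1) posn pos] num using X(1)[of n] by simp
  qed
  have "(\<lambda>n. r * ((c - c') * (\<alpha> + \<beta>) - (\<alpha> - \<beta>) * (c + c')) / ((\<alpha> + \<beta>) * (\<alpha> + c * X n + (\<beta> + c' * X n))))
    \<longlonglongrightarrow> r * ((c - c') * (\<alpha> + \<beta>) - (\<alpha> - \<beta>) * (c + c')) / ((\<alpha> + \<beta>) * (\<alpha> + \<beta>))"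
    by (intro tendsto_intros A) (use pos in simp)
  also have "r * ((c - c') * (\<alpha> + \<beta>) - (\<alpha> - \<beta>) * (c + c')) / ((\<alpha> + \<beta>) * (\<alpha> + \<beta>))
    = r * ((c - c') / (\<alpha> + \<beta>) - (\<alpha> - \<beta>) * (c + c') / (\<alpha> + \<beta>)\<^sup>2)"
  proof -
    have "(x * s - z) / (s * s) = x / s - z / s\<^sup>2" if "s > 0" for x s z :: real
      using that by (simp add: power2_eq_square diff_divide_distrib)
    then show ?thesis using pos by (simp flip: times_divide_eq_right)
  qed
  finally show "(\<lambda>n. X n * stationary_mean (\<alpha> + c * X n) (\<beta> + c' * X n) * (r / (X n)\<^sup>2) - r * stationary_mean \<alpha> \<beta> / X n)
      \<longlonglongrightarrow> r * ((c - c') / (\<alpha> + \<beta>) - (\<alpha> - \<beta>) * (c + c') / (\<alpha> + \<beta>)\<^sup>2)"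
    unfolding eq .
qed

lemma law_convergence_from_sequences:
  assumes P: "\<forall>\<^sub>F x in at_right (0::real). P x"
    and valid: "\<And>x. 0 < x \<Longrightarrow> P x \<Longrightarrow> prob_space (M x) \<and> \<xi> x \<in> M x \<rightarrow>\<^sub>M borel_of X"
    and \<nu>: "prob_space \<nu>" "sets \<nu> = sets (borel_of X)"
    and lim: "\<And>f d. \<lbrakk>continuous_map X euclideanreal f; bounded (f ` topspace X);
        \<And>n. 0 < d n; \<And>n. P (d n); d \<longlonglongrightarrow> 0\<rbrakk>
        \<Longrightarrow> (\<lambda>n. integral\<^sup>L (distr (M (d n)) (borel_of X) (\<xi> (d n))) f) \<longlonglongrightarrow> integral\<^sup>L \<nu> f"
  shows "converges_in_distribution X M \<xi> \<nu> (at_right 0)"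
  unfolding converges_in_distribution_def
proof (intro conjI allI impI \<nu>)
  have "\<forall>\<^sub>F x in at_right (0::real). 0 < x" by (simp add: eventually_at_right_less)
  with P show "\<forall>\<^sub>F x in at_right 0. prob_space (M x) \<and> \<xi> x \<in> M x \<rightarrow>\<^sub>M borel_of X"
    by eventually_elim (use valid in blast)
  fix f :: "_ \<Rightarrow> real" assume "continuous_map X euclideanreal f \<and> bounded (f ` topspace X)"
  then show "((\<lambda>i. integral\<^sup>L (distr (M i) (borel_of X) (\<xi> i)) f) \<longlongrightarrow> integral\<^sup>L \<nu> f) (at_right 0)"
    by (intro tendsto_at_right_from_sequences[OF P] lim) auto
qed

theorem theorem2p2:
  fixes \<alpha>\<^sub>0 \<beta>\<^sub>0 c\<^sub>0 c\<^sub>1 \<rho>\<^sub>0 \<eta>\<^sub>0 \<tau> \<tau>' :: real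
    and y\<^sub>0 :: int
    and M :: "real \<Rightarrow> 'a measure"
    and Y :: "real \<Rightarrow> nat \<Rightarrow> 'a \<Rightarrow> int"
  assumes "\<alpha>\<^sub>0 \<in> {0..1}" and "\<beta>\<^sub>0 \<in> {0..1}"
    and "\<forall>\<^sub>F dx in at_right 0. \<alpha>\<^sub>0 + c\<^sub>0 * dx \<in> {0..1} \<and> \<beta>\<^sub>0 + c\<^sub>1 * dx \<in> {0..1}"
    and "\<rho>\<^sub>0 = 1 - \<alpha>\<^sub>0 - \<beta>\<^sub>0" and "\<eta>\<^sub>0 = \<beta>\<^sub>0 - \<alpha>\<^sub>0"
    and "\<tau> = (c\<^sub>0 + c\<^sub>1) / 2" and "\<tau>' = (c\<^sub>1 - c\<^sub>0) / 2"
    and "y\<^sub>0 \<in> {-1, 1}"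
    and "\<And>dx. dx > 0 \<Longrightarrow> \<alpha>\<^sub>0 + c\<^sub>0 * dx \<in> {0..1} \<Longrightarrow> \<beta>\<^sub>0 + c\<^sub>1 * dx \<in> {0..1} \<Longrightarrow>
           markov_chain (M dx) {-1, 1} (walk_transition (\<alpha>\<^sub>0 + c\<^sub>0 * dx) (\<beta>\<^sub>0 + c\<^sub>1 * dx)) (Y dx) \<and>
           (\<forall>\<omega>\<in>space (M dx). Y dx 0 \<omega> = y\<^sub>0)"
    and "\<rho>\<^sub>0 \<noteq> 1"
  shows "(\<forall>r>0. \<forall>dt :: real \<Rightarrow> real. (\<forall>dx>0. r * dt dx = dx) \<longrightarrow>
           (\<forall>t\<ge>0. converges_in_distribution euclideanreal M
              (\<lambda>dx. interpolated_walk dx (dt dx) (Y dx) t)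
              (return borel (- (r * t * \<eta>\<^sub>0) / (1 - \<rho>\<^sub>0)))
              (at_right 0)))
       \<and> (\<forall>r>0. \<forall>dt :: real \<Rightarrow> real. (\<forall>dx>0. r * dt dx = dx\<^sup>2) \<longrightarrow>
           (\<forall>(N :: 'b measure) W. standard_brownian_motion N W \<longrightarrow>
              converges_in_distribution path_topology M
                (\<lambda>dx. path_of (\<lambda>t \<omega>. interpolated_walk dx (dt dx) (Y dx) t \<omega>
                         + t * sqrt r * \<eta>\<^sub>0 / ((1 - \<rho>\<^sub>0) * sqrt (dt dx))))
                (distr N (borel_of path_topology)
                   (path_of (\<lambda>t \<omega>.
                      2 * r * (- \<tau>' / (1 - \<rho>\<^sub>0) + \<eta>\<^sub>0 * \<tau> / (1 - \<rho>\<^sub>0)\<^sup>2) * t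
                      + sqrt (r * (1 + \<rho>\<^sub>0) / (1 - \<rho>\<^sub>0) * (1 - \<eta>\<^sub>0\<^sup>2 / (1 - \<rho>\<^sub>0)\<^sup>2)) * W t \<omega>)))
                (at_right 0)))"
proof -
  define s where "s = \<alpha>\<^sub>0 + \<beta>\<^sub>0"
  have s: "s > 0" "1 - \<rho>\<^sub>0 = s" "1 + \<rho>\<^sub>0 = 2 - \<alpha>\<^sub>0 - \<beta>\<^sub>0"
    using assms(1,2,4,10) by (auto simp: s_def)
  define a where "a = (\<lambda>dx. \<alpha>\<^sub>0 + c\<^sub>0 * dx)"
  define b where "b = (\<lambda>dx. \<beta>\<^sub>0 + c\<^sub>1 * dx)"
  \<comment> \<open>The bound by half of the limiting value makes all estimates uniform in the mesh.\<close>
  define P where "P = (\<lambda>dx. a dx \<in> {0..1} \<and> b dx \<in> {0..1} \<and> s / 2 \<le> a dx + b dx)"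
  have evP: "\<forall>\<^sub>F dx in at_right 0. P dx"
  proof -
    have "((\<lambda>dx. a dx + b dx) \<longlongrightarrow> (\<alpha>\<^sub>0 + c\<^sub>0 * 0) + (\<beta>\<^sub>0 + c\<^sub>1 * 0)) (at_right 0)"
      unfolding a_def b_def by (intro tendsto_intros)
    then have "\<forall>\<^sub>F dx in at_right 0. s / 2 < a dx + b dx"
      by (rule order_tendstoD) (use s in \<open>simp add: s_def\<close>)
    with assms(3) show ?thesis by eventually_elim (auto simp: P_def a_def b_def)
  qed
  have mc: "markov_chain (M dx) {-1, 1} (walk_transition (a dx) (b dx)) (Y dx)"
    and y0: "\<And>\<omega>. \<omega> \<in> space (M dx) \<Longrightarrow> Y dx 0 \<omega> = y\<^sub>0" if "0 < dx" "P dx" for dx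
    using assms(9)[of dx] that unfolding P_def a_def b_def by auto
  have ab: "a dx \<in> {0..1}" "b dx \<in> {0..1}" "s / 2 \<le> a dx + b dx" if "P dx" for dx
    using that by (auto simp: P_def)
  have s2: "0 < s / 2" using s by simp
  have mean0: "stationary_mean \<alpha>\<^sub>0 \<beta>\<^sub>0 = - \<eta>\<^sub>0 / (1 - \<rho>\<^sub>0)"
    using assms(5) by (simp add: stationary_mean_def s(2) s_def minus_divide_left)
  have limits: "(\<lambda>n. stationary_mean (a (d n)) (b (d n))) \<longlonglongrightarrow> stationary_mean \<alpha>\<^sub>0 \<beta>\<^sub>0"
    "(\<lambda>n. asymptotic_variance (a (d n)) (b (d n))) \<longlonglongrightarrow> asymptotic_variance \<alpha>\<^sub>0 \<beta>\<^sub>0"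
    "(\<lambda>n. d n * stationary_mean (a (d n)) (b (d n)) * (r / (d n)\<^sup>2) - r * stationary_mean \<alpha>\<^sub>0 \<beta>\<^sub>0 / d n)
      \<longlonglongrightarrow> r * ((c\<^sub>0 - c\<^sub>1) / s - (\<alpha>\<^sub>0 - \<beta>\<^sub>0) * (c\<^sub>0 + c\<^sub>1) / s\<^sup>2)"
    if "\<And>n. 0 < d n" "\<And>n. P (d n)" "d \<longlonglongrightarrow> 0" "r > 0" for d :: "nat \<Rightarrow> real" and r :: real
  proof -
    have "\<alpha>\<^sub>0 + c\<^sub>0 * d n + (\<beta>\<^sub>0 + c\<^sub>1 * d n) > 0" for n
      using ab(3)[OF that(2)[of n]] s2 unfolding a_def b_def by linarith
    note pl = parameter_limits[OF that(1,3) s(1)[unfolded s_def] this that(4)]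
    show "(\<lambda>n. stationary_mean (a (d n)) (b (d n))) \<longlonglongrightarrow> stationary_mean \<alpha>\<^sub>0 \<beta>\<^sub>0"
      "(\<lambda>n. asymptotic_variance (a (d n)) (b (d n))) \<longlonglongrightarrow> asymptotic_variance \<alpha>\<^sub>0 \<beta>\<^sub>0"
      "(\<lambda>n. d n * stationary_mean (a (d n)) (b (d n)) * (r / (d n)\<^sup>2) - r * stationary_mean \<alpha>\<^sub>0 \<beta>\<^sub>0 / d n)
      \<longlonglongrightarrow> r * ((c\<^sub>0 - c\<^sub>1) / s - (\<alpha>\<^sub>0 - \<beta>\<^sub>0) * (c\<^sub>0 + c\<^sub>1) / s\<^sup>2)"
      unfolding a_def b_def s_def by (rule pl)+
  qed
  show ?thesis
  proof (intro conjI allI impI)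
    fix r t :: real and dt :: "real \<Rightarrow> real"
    assume r: "0 < r" and dt: "\<forall>dx>0. r * dt dx = dx" and t: "0 \<le> t"
    have dt: "dt dx = dx / r" if "0 < dx" for dx using dt that r by (simp add: eq_divide_eq mult.commute)
    define c where "c = - (r * t * \<eta>\<^sub>0) / (1 - \<rho>\<^sub>0)"
    have c: "c = r * t * stationary_mean \<alpha>\<^sub>0 \<beta>\<^sub>0" by (simp add: c_def mean0)
    show "converges_in_distribution euclideanreal M (\<lambda>dx. interpolated_walk dx (dt dx) (Y dx) t)
        (return borel (- (r * t * \<eta>\<^sub>0) / (1 - \<rho>\<^sub>0))) (at_right 0)"
      unfolding c_def[symmetric]
    proof (rule law_convergence_from_sequences[OF evP])
      fix dx assume dx: "0 < dx" "P dx"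
      show "prob_space (M dx) \<and> interpolated_walk dx (dt dx) (Y dx) t \<in> M dx \<rightarrow>\<^sub>M borel_of euclideanreal"
        using mc[OF dx] interpolated_walk_measurable[OF mc[OF dx], of dx "dt dx" t]
        by (simp add: markov_chain_def borel_of_euclidean)
    next
      show "prob_space (return borel c)" by (rule prob_space_return) simp
      show "sets (return borel c) = sets (borel_of euclideanreal)" by (simp add: borel_of_euclidean)
    next
      fix f :: "real \<Rightarrow> real" and d :: "nat \<Rightarrow> real"
      assume f: "continuous_map euclideanreal euclideanreal f" "bounded (f ` topspace euclideanreal)"
        and d: "\<And>n. 0 < d n" "\<And>n. P (d n)" "d \<longlonglongrightarrow> 0"
      have fc: "continuous_on UNIV f" using f(1) by simp
      then have fm: "f \<in> borel_measurable borel" by (rule borel_measurable_continuous_onI)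
      obtain B where B: "\<And>x. \<bar>f x\<bar> \<le> B" using f(2) by (auto simp: bounded_iff)
      have "(\<lambda>n. \<integral>\<omega>. f (interpolated_walk (d n) (d n / r) (Y (d n)) t \<omega>) \<partial>M (d n)) \<longlonglongrightarrow> f (r * t * stationary_mean \<alpha>\<^sub>0 \<beta>\<^sub>0)"
        by (rule lln_sequence[OF ab(1)[OF d(2)] ab(2)[OF d(2)] s2 ab(3)[OF d(2)] mc[OF d(1,2)] y0[OF d(1,2)] assms(8)
            d(1,3) r t limits(1)[OF d r] fc B])
      moreover have "integral\<^sup>L (distr (M (d n)) (borel_of euclideanreal) (interpolated_walk (d n) (dt (d n)) (Y (d n)) t)) f
          = (\<integral>\<omega>. f (interpolated_walk (d n) (d n / r) (Y (d n)) t \<omega>) \<partial>M (d n))" for n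
        unfolding borel_of_euclidean dt[OF d(1)]
        by (rule integral_distr[OF interpolated_walk_measurable[OF mc[OF d(1,2)]] fm])
      moreover have "integral\<^sup>L (return borel c) f = f (r * t * stationary_mean \<alpha>\<^sub>0 \<beta>\<^sub>0)"
        unfolding c by (rule integral_return) (use fm in simp_all)
      ultimately show "(\<lambda>n. integral\<^sup>L (distr (M (d n)) (borel_of euclideanreal) (interpolated_walk (d n) (dt (d n)) (Y (d n)) t)) f)
          \<longlonglongrightarrow> integral\<^sup>L (return borel c) f"
        by (simp only:)
    qed
  next
    fix r :: real and dt :: "real \<Rightarrow> real" and N :: "'b measure" and W :: "real \<Rightarrow> 'b \<Rightarrow> real"
    assume r: "0 < r" and dt: "\<forall>dx>0. r * dt dx = dx\<^sup>2" and W: "standard_brownian_motion N W"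
    have dt: "dt dx = dx\<^sup>2 / r" if "0 < dx" for dx using dt that r by (simp add: eq_divide_eq mult.commute)
    define \<xi> where "\<xi> = (\<lambda>dx. path_of (\<lambda>t \<omega>. interpolated_walk dx (dt dx) (Y dx) t \<omega>
                         + t * sqrt r * \<eta>\<^sub>0 / ((1 - \<rho>\<^sub>0) * sqrt (dt dx))))"
    define \<mu> where "\<mu> = 2 * r * (- \<tau>' / (1 - \<rho>\<^sub>0) + \<eta>\<^sub>0 * \<tau> / (1 - \<rho>\<^sub>0)\<^sup>2)"
    define V where "V = asymptotic_variance \<alpha>\<^sub>0 \<beta>\<^sub>0"
    define \<xi>\<^sub>0 where "\<xi>\<^sub>0 = path_of (\<lambda>t \<omega>. \<mu> * t + sqrt (r * V) * W t \<omega>)"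
    have rV: "r * (1 + \<rho>\<^sub>0) / (1 - \<rho>\<^sub>0) * (1 - \<eta>\<^sub>0\<^sup>2 / (1 - \<rho>\<^sub>0)\<^sup>2) = r * V"
      unfolding V_def asymptotic_variance_def mean0 s(3) by (simp add: s(2) s_def power_divide)
    have mu: "r * ((c\<^sub>0 - c\<^sub>1) / s - (\<alpha>\<^sub>0 - \<beta>\<^sub>0) * (c\<^sub>0 + c\<^sub>1) / s\<^sup>2) = \<mu>"
    proof -
      have e: "\<alpha>\<^sub>0 - \<beta>\<^sub>0 = - \<eta>\<^sub>0" "c\<^sub>0 + c\<^sub>1 = 2 * \<tau>" "c\<^sub>0 - c\<^sub>1 = - (2 * \<tau>')"
        using assms(5,6,7) by simp_all
      show ?thesis unfolding e \<mu>_def s(2) by (simp add: algebra_simps)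
    qed
    have \<xi>eq: "\<xi> dx = path_of (\<lambda>t \<omega>. interpolated_walk dx (dx\<^sup>2 / r) (Y dx) t \<omega> - r * stationary_mean \<alpha>\<^sub>0 \<beta>\<^sub>0 / dx * t)"
      if dx: "0 < dx" for dx
    proof -
      have "sqrt (dt dx) = dx / sqrt r" using dx r by (simp add: dt real_sqrt_divide)
      then have "t * sqrt r * \<eta>\<^sub>0 / ((1 - \<rho>\<^sub>0) * sqrt (dt dx)) = - (r * stationary_mean \<alpha>\<^sub>0 \<beta>\<^sub>0 / dx * t)" for t
        using r by (simp add: mean0 mult_ac)
      then show ?thesis unfolding \<xi>_def dt[OF dx] by simp
    qed
    have \<xi>m: "\<xi> dx \<in> M dx \<rightarrow>\<^sub>M borel_of path_topology" if dx: "0 < dx" "P dx" for dx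
    proof -
      have "dx\<^sup>2 / r > 0" using dx r by simp
      then show ?thesis unfolding \<xi>eq[OF dx(1)]
        by (intro path_of_measurable continuous_intros interpolated_walk_continuous
            borel_measurable_diff interpolated_walk_measurable[OF mc[OF dx]] borel_measurable_const)
    qed
    have \<xi>\<^sub>0m: "\<xi>\<^sub>0 \<in> N \<rightarrow>\<^sub>M borel_of path_topology"
      unfolding \<xi>\<^sub>0_def
      by (rule path_of_measurable) (use W in \<open>auto simp: standard_brownian_motion_def intro!: continuous_intros\<close>)
    interpret N: prob_space N using W by (simp add: standard_brownian_motion_def)
    show "converges_in_distribution path_topology M
                (\<lambda>dx. path_of (\<lambda>t \<omega>. interpolated_walk dx (dt dx) (Y dx) t \<omega>
                         + t * sqrt r * \<eta>\<^sub>0 / ((1 - \<rho>\<^sub>0) * sqrt (dt dx))))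
                (distr N (borel_of path_topology)
                   (path_of (\<lambda>t \<omega>.
                      2 * r * (- \<tau>' / (1 - \<rho>\<^sub>0) + \<eta>\<^sub>0 * \<tau> / (1 - \<rho>\<^sub>0)\<^sup>2) * t
                      + sqrt (r * (1 + \<rho>\<^sub>0) / (1 - \<rho>\<^sub>0) * (1 - \<eta>\<^sub>0\<^sup>2 / (1 - \<rho>\<^sub>0)\<^sup>2)) * W t \<omega>)))
                (at_right 0)"
      unfolding rV \<mu>_def[symmetric] \<xi>\<^sub>0_def[symmetric] \<xi>_def[symmetric]
    proof (rule law_convergence_from_sequences[OF evP])
      fix dx assume dx: "0 < dx" "P dx"
      show "prob_space (M dx) \<and> \<xi> dx \<in> M dx \<rightarrow>\<^sub>M borel_of path_topology"
        using mc[OF dx] \<xi>m[OF dx] by (simp add: markov_chain_def)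
    next
      show "prob_space (distr N (borel_of path_topology) \<xi>\<^sub>0)" by (rule N.prob_space_distr[OF \<xi>\<^sub>0m])
    next
      fix f :: "(real \<Rightarrow> real) \<Rightarrow> real" and d :: "nat \<Rightarrow> real"
      assume f: "continuous_map path_topology euclideanreal f" "bounded (f ` topspace path_topology)"
        and d: "\<And>n. 0 < d n" "\<And>n. P (d n)" "d \<longlonglongrightarrow> 0"
      show "(\<lambda>n. integral\<^sup>L (distr (M (d n)) (borel_of path_topology) (\<xi> (d n))) f)
          \<longlonglongrightarrow> integral\<^sup>L (distr N (borel_of path_topology) \<xi>\<^sub>0) f"
      proof (rule weak_convergence_from_lipschitz[OF _ _ _ _ _ f(1) f(2)[unfolded topspace_path_topology]])
        show "prob_space (distr (M (d n)) (borel_of path_topology) (\<xi> (d n)))" for n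
          using mc[OF d(1,2)[of n]] \<xi>m[OF d(1,2)[of n]] by (intro prob_space.prob_space_distr) (simp_all add: markov_chain_def)
        show "prob_space (distr N (borel_of path_topology) \<xi>\<^sub>0)" by (rule N.prob_space_distr[OF \<xi>\<^sub>0m])
        fix F T K B
        assume T: "0 < T" and K: "0 \<le> K" and F: "sup_lipschitz T K F" "\<And>x. x \<in> continuous_paths \<Longrightarrow> \<bar>F x\<bar> \<le> B"
        have Fm: "F \<in> borel_measurable (borel_of path_topology)"
          by (intro continuous_map_borel_of_measurable sup_lipschitz_continuous[OF F(1) K])
        have "(\<lambda>n. \<integral>\<omega>. F (path_of (\<lambda>t \<omega>. interpolated_walk (d n) ((d n)\<^sup>2 / r) (Y (d n)) t \<omega>
              - r * stationary_mean \<alpha>\<^sub>0 \<beta>\<^sub>0 / d n * t) \<omega>) \<partial>M (d n))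
          \<longlonglongrightarrow> (\<integral>\<omega>. F (path_of (\<lambda>t \<omega>. \<mu> * t + sqrt (r * V) * W t \<omega>) \<omega>) \<partial>N)"
          by (rule donsker_sequence[OF ab(1)[OF d(2)] ab(2)[OF d(2)] s2 ab(3)[OF d(2)] mc[OF d(1,2)] y0[OF d(1,2)] assms(8)
              d(1,3) r limits(2)[OF d r, folded V_def] limits(3)[OF d r, unfolded mu] W T K F])
        moreover have "integral\<^sup>L (distr (M (d n)) (borel_of path_topology) (\<xi> (d n))) F
          = (\<integral>\<omega>. F (path_of (\<lambda>t \<omega>. interpolated_walk (d n) ((d n)\<^sup>2 / r) (Y (d n)) t \<omega>
              - r * stationary_mean \<alpha>\<^sub>0 \<beta>\<^sub>0 / d n * t) \<omega>) \<partial>M (d n))" for n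
          using integral_distr[OF \<xi>m[OF d(1,2)[of n]] Fm] unfolding \<xi>eq[OF d(1)] .
        moreover have "integral\<^sup>L (distr N (borel_of path_topology) \<xi>\<^sub>0) F
          = (\<integral>\<omega>. F (path_of (\<lambda>t \<omega>. \<mu> * t + sqrt (r * V) * W t \<omega>) \<omega>) \<partial>N)"
          using integral_distr[OF \<xi>\<^sub>0m Fm] unfolding \<xi>\<^sub>0_def .
        ultimately show "(\<lambda>n. integral\<^sup>L (distr (M (d n)) (borel_of path_topology) (\<xi> (d n))) F)
          \<longlonglongrightarrow> integral\<^sup>L (distr N (borel_of path_topology) \<xi>\<^sub>0) F" by (simp only:)
      qed simp_all
    qed simp_all
  qed
qed

end
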